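(* Let $\beta\ge0$, let $m\in C(\mathbb{R}^n)$ and set $\widetilde m(\xi):=m(-\xi)$. Assume that the Fourier multiplier operator $\phi\mapsto\widetilde m(D)\phi:=\mathcal{F}^{-1}(\widetilde m\,\widehat\phi)$ maps $C_c^\infty(\mathbb{R}^n)$ into $L^1_\beta(\mathbb{R}^n)$. Suppose $f\in L^\infty_{-\beta}(\mathbb{R}^n)$ satisfies $m(D)f=0$ as a distribution, i.e. $\langle f,\widetilde m(D)\phi\rangle=0$ for all $\phi\in C_c^\infty(\mathbb{R}^n)$. If $\{\eta\in\mathbb{R}^n\mid m(\eta)=0\}\subseteq\{0\}$, then $f$ coincides Lebesgue almost everywhere with a polynomial of degree at most $\lfloor\beta\rfloor$. Conversely, if every $f\in L^\infty(\mathbb{R}^n)$ satisfying $\langle f,\widetilde m(D)\phi\rangle=0$ for all $\phi\in C_c^\infty(\mathbb{R}^n)$ coincides Lebesgue almost everywhere with a polynomial, then $\{\eta\in\mathbb{R}^n\mid m(\eta)=0\}\subseteq\{0\}$.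
   Context: $\Lambda(x):=(1+|x|^2)^{1/2}$. $L^1_\beta(\mathbb{R}^n):=\{g\in L^1(\mathbb{R}^n)\mid \int|g|\Lambda^\beta\,dx<\infty\}$, $L^\infty_{-\beta}(\mathbb{R}^n):=\{f\in L^\infty_{\mathrm{loc}}(\mathbb{R}^n)\mid \operatorname{ess\,sup}_x\Lambda(x)^{-\beta}|f(x)|<\infty\}$. Fourier transform $\widehat\phi(\xi)=(2\pi)^{-n}\int e^{-ix\cdot\xi}\phi(x)\,dx$, $\mathcal{F}^{-1}u(x)=\int e^{ix\cdot\xi}u(\xi)\,d\xi$. Pairing $\langle f,g\rangle=\int fg\,dx$. *)

theory Defs
  imports "HOL-Analysis.Analysis"
begin

definition jbr :: "real ^ 'n \<Rightarrow> real" where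
  "jbr x = sqrt (1 + norm x ^ 2)"

primrec Ck :: "nat \<Rightarrow> (real ^ 'n \<Rightarrow> complex) \<Rightarrow> bool" where
  "Ck 0 f = continuous_on UNIV f"
| "Ck (Suc k) f = (f differentiable_on UNIV \<and>
      (\<forall>v. Ck k (\<lambda>x. frechet_derivative f (at x) v)))"

definition smooth_fun :: "(real ^ 'n \<Rightarrow> complex) \<Rightarrow> bool" where
  "smooth_fun f = (\<forall>k. Ck k f)"

definition test_fun :: "(real ^ 'n \<Rightarrow> complex) \<Rightarrow> bool" where
  "test_fun \<phi> = (smooth_fun \<phi> \<and> compact (closure {x. \<phi> x \<noteq> 0}))"

text \<open>Fourier transform with the paper's normalisation (2 pi)^(-n) int e^(-i x.xi) phi(x) dx.\<close>
definition fourier :: "(real ^ 'n \<Rightarrow> complex) \<Rightarrow> real ^ 'n \<Rightarrow> complex" where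
  "fourier \<phi> \<xi> = complex_of_real ((2 * pi) powr (- real CARD('n))) *
     (\<integral>x. exp (- \<i> * complex_of_real (x \<bullet> \<xi>)) * \<phi> x \<partial>lborel)"

definition L1w :: "real \<Rightarrow> (real ^ 'n \<Rightarrow> complex) set" where
  "L1w \<beta> = {g. integrable lborel g \<and> integrable lborel (\<lambda>x. norm (g x) * jbr x powr \<beta>)}"

definition Linfw :: "real \<Rightarrow> (real ^ 'n \<Rightarrow> complex) set" where
  "Linfw \<beta> = {f. f \<in> borel_measurable lborel \<and>
      (\<exists>C. AE x in lborel. norm (f x) \<le> C * jbr x powr \<beta>)}"

text \<open>Fourier multiplier operator  mt(D) phi = F^{-1}(mt * hat phi), with mt(xi) = m(-xi),
  understood as the (a.e. unique) L^1 function whose Fourier transform is mt * hat phi.\<close>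
definition mult_image :: "(real ^ 'n \<Rightarrow> complex) \<Rightarrow> (real ^ 'n \<Rightarrow> complex) \<Rightarrow> (real ^ 'n \<Rightarrow> complex) \<Rightarrow> bool" where
  "mult_image m \<phi> g = (\<forall>\<xi>. fourier g \<xi> = m (- \<xi>) * fourier \<phi> \<xi>)"

definition mult_op :: "(real ^ 'n \<Rightarrow> complex) \<Rightarrow> (real ^ 'n \<Rightarrow> complex) \<Rightarrow> (real ^ 'n \<Rightarrow> complex)" where
  "mult_op m \<phi> = (SOME g. g \<in> L1w 0 \<and> mult_image m \<phi> g)"

definition maps_into_L1w :: "(real ^ 'n \<Rightarrow> complex) \<Rightarrow> real \<Rightarrow> bool" where
  "maps_into_L1w m \<beta> = (\<forall>\<phi>. test_fun \<phi> \<longrightarrow> (\<exists>g. g \<in> L1w \<beta> \<and> mult_image m \<phi> g))"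

definition poly_deg_le :: "nat \<Rightarrow> (real ^ 'n \<Rightarrow> complex) \<Rightarrow> bool" where
  "poly_deg_le d p = (\<exists>c :: ('n \<Rightarrow> nat) \<Rightarrow> complex.
      p = (\<lambda>x. \<Sum>\<alpha> \<in> {\<alpha>. sum \<alpha> UNIV \<le> d}. c \<alpha> * (\<Prod>i\<in>UNIV. complex_of_real (x $ i) ^ \<alpha> i)))"

definition poly_fun :: "(real ^ 'n \<Rightarrow> complex) \<Rightarrow> bool" where
  "poly_fun p = (\<exists>d. poly_deg_le d p)"

end

theory Submission
  imports Defs
begin

text \<open>
  Let \<open>f\<close> be annihilated by all \<open>mt(D) \<phi>\<close>. Convolving \<open>f\<close> with the reflection \<open>k\<close> of one such function gives
  \<open>0\<close>, and the Fourier transform of \<open>k\<close> is \<open>m(\<xi>)\<close> times a factor that can be made nonzero on any given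
  compact set. Near a frequency \<open>\<eta> \<noteq> 0\<close> one inverts it by Wiener's trick: with \<open>v\<close> a kernel whose
  Fourier transform is a plateau, dilated by a small \<open>\<epsilon>\<close> and modulated to \<open>\<eta>\<close>, the function
  \<open>u = v - k * v / hat k \<eta>\<close> has \<open>L\<^sup>1\<close> norm below 1, uniformly in \<open>\<eta>\<close> where \<open>hat k\<close> is bounded away from
  \<open>0\<close>. The part \<open>F\<close> of \<open>f\<close> with frequencies near \<open>\<eta>\<close> satisfies \<open>F = F * u\<close>, and since the weights
  \<open>(1 + \<delta> |x|) powr \<beta>\<close> are submultiplicative and equivalent for all \<open>\<delta> > 0\<close>, letting \<open>\<delta> \<rightarrow> 0\<close> forces \<open>F = 0\<close>.

  So only the frequency \<open>0\<close> is left, and \<open>f\<close> is reproduced by the low-pass kernels of all widths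
  \<open>\<epsilon>\<close>. Hence \<open>n\<close>-fold differences of \<open>f\<close> are \<open>O(\<epsilon> powr (n - \<beta>))\<close> and vanish for \<open>n > \<beta>\<close>, which makes \<open>f\<close> a
  polynomial; its growth bounds the degree. Conversely, a zero \<open>\<eta> \<noteq> 0\<close> of \<open>m\<close> yields the
  bounded non-polynomial solution \<open>exp (\<i> x \<bullet> \<eta>)\<close>.
\<close>

subsection \<open>Weights, convolution and the Fourier transform\<close>

text \<open>The argument therefore never transforms \<open>f\<close>: it enters only through
  convolutions with kernels from weighted L1, and identities between such kernels are decided by
  injectivity of the transform. Wiener's trick fits because it asks for no smoothness of
  \<open>hat k\<close>, only that convolution with \<open>k\<close> acts almost like the constant
  \<open>hat k \<eta>\<close> on a kernel whose frequencies are concentrated near \<eta>. The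
  contraction so obtained lives in the unweighted norm, while \<open>f\<close> demands the weighted
  one; the weights with \<delta> bridge this gap, and a single small \<delta> is enough. Uniformity
  in \<eta> is essential: a function is recognised as 0 from its convolutions with kernels of one
  common width at all frequencies. The plateau is 1 up to radius 1 and 0 from radius 2, which is the
  origin of the factors 2 between kernel widths.\<close>

lemma nn_integral_lborel_affine:
  fixes t :: "'a::euclidean_space"
  assumes [measurable]: "f \<in> borel_measurable borel" and c: "c \<noteq> 0"
  shows "(\<integral>\<^sup>+x. f x \<partial>lborel) = \<bar>c\<bar> ^ DIM('a) * (\<integral>\<^sup>+x. f (t + c *\<^sub>R x) \<partial>lborel)"
  by (subst lborel_affine[OF c, of t])
     (simp add: nn_integral_density nn_integral_distr nn_integral_cmult ennreal_power)

lemma integrable_boundI: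
  fixes f :: "'a \<Rightarrow> real" and g :: "'a \<Rightarrow> 'b::{banach, second_countable_topology}"
  assumes "integrable M f" "g \<in> borel_measurable M" "\<And>x. norm (g x) \<le> f x"
  shows "integrable M g"
  by (rule Bochner_Integration.integrable_bound[OF assms(1,2) AE_I2]) (use assms(3) in \<open>auto intro: order_trans[OF _ abs_ge_self]\<close>)

lemma integrable_lborel_affine:
  fixes f :: "'a::euclidean_space \<Rightarrow> 'b :: {banach, second_countable_topology}"
  assumes f: "integrable lborel f" and c: "c \<noteq> 0"
  shows "integrable lborel (\<lambda>x. f (t + c *\<^sub>R x))"
proof -
  have [measurable]: "f \<in> borel_measurable borel" using f by auto
  have "(\<integral>\<^sup>+x. norm (f x) \<partial>lborel) = \<bar>c\<bar> ^ DIM('a) * (\<integral>\<^sup>+x. norm (f (t + c *\<^sub>R x)) \<partial>lborel)"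
    using nn_integral_lborel_affine[of "\<lambda>x. ennreal (norm (f x))", OF _ c] by (simp add: ennreal_power)
  then show ?thesis
    using f c unfolding integrable_iff_bounded
    by (auto simp: ennreal_mult_less_top)
qed

lemma integrable_lborel_affine_iff:
  fixes f :: "'a::euclidean_space \<Rightarrow> 'b :: {banach, second_countable_topology}"
  assumes c: "c \<noteq> 0"
  shows "integrable lborel (\<lambda>x. f (t + c *\<^sub>R x)) \<longleftrightarrow> integrable lborel f"
  using integrable_lborel_affine[of f c t] c
    integrable_lborel_affine[of "\<lambda>x. f (t + c *\<^sub>R x)" "1/c" "-(1/c) *\<^sub>R t"]
  by (auto simp add: algebra_simps)

lemma integral_lborel_affine:
  fixes f :: "'a::euclidean_space \<Rightarrow> 'b :: {banach, second_countable_topology}"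
  assumes c: "c \<noteq> 0"
  shows "(\<integral>x. f x \<partial>lborel) = \<bar>c\<bar> ^ DIM('a) *\<^sub>R (\<integral>x. f (t + c *\<^sub>R x) \<partial>lborel)"
proof cases
  assume f[measurable]: "integrable lborel f"
  then show ?thesis
    using c f f[THEN borel_measurable_integrable] integrable_lborel_affine[OF f c, of t]
    by (subst lborel_affine[OF c, of t])
       (simp add: integral_density integral_distr)
next
  \<comment> \<open>A non-integrable function has integral 0 by convention, and integrability is
    invariant under the substitution, so both sides are 0.\<close>
  assume "\<not> integrable lborel f" with c show ?thesis
    by (simp add: integrable_lborel_affine_iff not_integrable_integral_eq)
qed

lemmas integral_lborel_translate = integral_lborel_affine[of 1, simplified]
  and integrable_lborel_translate_iff = integrable_lborel_affine_iff[of 1, simplified]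
  and integral_lborel_reflect = integral_lborel_affine[of "-1", simplified]
  and integrable_lborel_reflect_iff = integrable_lborel_affine_iff[of "-1", simplified]

lemma nn_integral_lborel_translate:
  fixes t :: "'a::euclidean_space"
  assumes "f \<in> borel_measurable borel"
  shows "(\<integral>\<^sup>+x. f (x - t) \<partial>lborel) = (\<integral>\<^sup>+x. f x \<partial>lborel)"
  using nn_integral_lborel_affine[OF assms, of 1 "- t"] by simp

section \<open>Polynomial weights\<close>

text \<open>Comparable to \<open>jbr x powr \<beta>\<close>, but submultiplicative with constant
  exactly 1. This matters because weights are split repeatedly: a larger constant would be raised to
  a power and could destroy a contraction.\<close>

definition wt :: "real \<Rightarrow> 'a::real_normed_vector \<Rightarrow> real" where
  "wt \<beta> x = (1 + norm x) powr \<beta>"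

lemma wt_pos [simp]: "0 < wt \<beta> x" and wt_nonneg [simp]: "0 \<le> wt \<beta> x" and wt_nz [simp]: "wt \<beta> x \<noteq> 0"
proof -
  have *: "1 + norm x \<noteq> 0" using norm_ge_zero[of x] by linarith
  show "0 < wt \<beta> x" using * by (simp add: wt_def)
  then show "0 \<le> wt \<beta> x" "wt \<beta> x \<noteq> 0" by simp_all
qed

lemma wt_0 [simp]: "wt \<beta> 0 = 1" and wt_zero_exp [simp]: "wt 0 x = 1"
  using wt_nz[of 1 x] by (auto simp: wt_def)

lemma wt_minus [simp]: "wt \<beta> (- x) = wt \<beta> x"
  by (simp add: wt_def)

lemma wt_mono: "\<beta> \<ge> 0 \<Longrightarrow> norm x \<le> norm y \<Longrightarrow> wt \<beta> x \<le> wt \<beta> y"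
  by (simp add: wt_def powr_mono2)

lemma wt_mono_exp: "\<beta> \<le> \<gamma> \<Longrightarrow> wt \<beta> x \<le> wt \<gamma> x"
  by (simp add: wt_def powr_mono)

lemma wt_add: "\<beta> \<ge> 0 \<Longrightarrow> wt \<beta> (x + y) \<le> wt \<beta> x * wt \<beta> y"
proof -
  assume b: "\<beta> \<ge> 0"
  have "1 + norm (x + y) \<le> (1 + norm x) * (1 + norm y)"
    using norm_triangle_ineq[of x y] mult_nonneg_nonneg[of "norm x" "norm y"]
    by (simp add: algebra_simps del: mult_nonneg_nonneg)
  then have "wt \<beta> (x + y) \<le> ((1 + norm x) * (1 + norm y)) powr \<beta>"
    unfolding wt_def by (intro powr_mono2) (use b in auto)
  then show ?thesis by (simp add: wt_def powr_mult)
qed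

lemma wt_diff: "\<beta> \<ge> 0 \<Longrightarrow> wt \<beta> (x - y) \<le> wt \<beta> x * wt \<beta> y"
  using wt_add[of \<beta> x "-y"] by simp

lemma wt_of_nat: "wt (real N) x = (1 + norm x) ^ N"
  by (simp add: wt_def powr_realpow add_pos_nonneg)

lemma wt_measurable [measurable]: "wt \<beta> \<in> borel_measurable (borel :: 'a::real_normed_vector measure)"
  unfolding wt_def[abs_def] by measurable

lemma continuous_wt [continuous_intros]: "continuous_on S f \<Longrightarrow> continuous_on S (\<lambda>x. wt \<beta> (f x))"
  unfolding wt_def by (intro continuous_intros) (auto simp: add_nonneg_eq_0_iff)

section \<open>Weighted classes and convolution\<close>

definition wint :: "real \<Rightarrow> ('a::euclidean_space \<Rightarrow> complex) \<Rightarrow> bool" where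
  "wint \<beta> w \<longleftrightarrow> w \<in> borel_measurable borel \<and> integrable lborel (\<lambda>x. wt \<beta> x * norm (w x))"

text \<open>The bound holds at every point and not just almost everywhere, so that estimates of
  convolutions are pointwise. Elements of \<open>Linfw\<close> are replaced by such a
  representative.\<close>

definition pbd :: "real \<Rightarrow> ('a::euclidean_space \<Rightarrow> complex) \<Rightarrow> bool" where
  "pbd \<beta> f \<longleftrightarrow> f \<in> borel_measurable borel \<and> (\<exists>C. \<forall>x. norm (f x) \<le> C * wt \<beta> x)"

definition conv :: "('a::euclidean_space \<Rightarrow> complex) \<Rightarrow> ('a \<Rightarrow> complex) \<Rightarrow> 'a \<Rightarrow> complex" where
  "conv f w x = (\<integral>y. f (x - y) * w y \<partial>lborel)"

text \<open>\<open>fourier\<close> without its factor (2 pi)^(-n), so that convolutions go to plain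
  products.\<close>

definition hat :: "('a::euclidean_space \<Rightarrow> complex) \<Rightarrow> 'a \<Rightarrow> complex" where
  "hat g \<xi> = (\<integral>x. exp (- \<i> * of_real (x \<bullet> \<xi>)) * g x \<partial>lborel)"

lemma wint_measurable [measurable_dest]: "wint \<beta> w \<Longrightarrow> w \<in> borel_measurable borel"
  and pbd_measurable [measurable_dest]: "pbd \<beta> f \<Longrightarrow> f \<in> borel_measurable borel"
  by (auto simp: wint_def pbd_def)

lemma wint_integrable_wt: "wint \<beta> w \<Longrightarrow> integrable lborel (\<lambda>x. wt \<beta> x * norm (w x))"
  by (auto simp: wint_def)

lemma pbdE:
  assumes "pbd \<beta> f" obtains C where "C \<ge> 0" "\<And>x. norm (f x) \<le> C * wt \<beta> x"
proof -
  obtain C where C: "\<And>x. norm (f x) \<le> C * wt \<beta> x" using assms by (auto simp: pbd_def)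
  have "0 \<le> C * wt \<beta> (0::'a)" using C[of 0] norm_ge_zero order_trans by blast
  then have "C \<ge> 0" by simp
  then show thesis using that C by blast
qed

lemma wint_mono:
  assumes w: "wint \<beta> w" and [measurable]: "u \<in> borel_measurable borel"
    and le: "\<And>x. wt \<gamma> x * norm (u x) \<le> C * (wt \<beta> x * norm (w x))"
  shows "wint \<gamma> u"
proof -
  have "integrable lborel (\<lambda>x. wt \<gamma> x * norm (u x))"
    by (rule integrable_boundI[where f="\<lambda>x. C * (wt \<beta> x * norm (w x))"])
      (use wint_integrable_wt[OF w] le in \<open>simp_all add: abs_mult\<close>)
  then show ?thesis by (auto simp: wint_def)
qed

lemma wint_mono_exp: "wint \<beta> w \<Longrightarrow> \<gamma> \<le> \<beta> \<Longrightarrow> wint \<gamma> w"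
  by (rule wint_mono[where C=1]) (auto intro: mult_right_mono wt_mono_exp wint_measurable)

lemma wint_integrable:
  assumes "wint \<beta> w" "\<beta> \<ge> 0" shows "integrable lborel w"
  using wint_mono_exp[of \<beta> w 0] assms integrable_norm_cancel[of lborel w]
  by (auto simp: wint_def)

lemma wint_0_iff: "wint 0 w \<longleftrightarrow> integrable lborel w"
  using integrable_norm[of lborel w] integrable_norm_cancel[of lborel w] by (auto simp: wint_def)

lemma wint_add:
  assumes u: "wint \<beta> u" and w: "wint \<beta> w" shows "wint \<beta> (\<lambda>x. u x + w x)"
proof -
  have [measurable]: "u \<in> borel_measurable borel" "w \<in> borel_measurable borel"
    using u w by auto
  have "integrable lborel (\<lambda>x. wt \<beta> x * norm (u x + w x))"
    by (rule integrable_boundI[where f="\<lambda>x. wt \<beta> x * norm (u x) + wt \<beta> x * norm (w x)"])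
      (use wint_integrable_wt[OF u] wint_integrable_wt[OF w] in \<open>simp_all add: norm_triangle_ineq mult_left_mono flip: distrib_left\<close>, simp add: distrib_left)
  then show ?thesis by (auto simp: wint_def)
qed

lemma wint_cmult:
  assumes w: "wint \<beta> w" shows "wint \<beta> (\<lambda>x. c * w x)"
  by (rule wint_mono[OF w, where C="norm c"]) (use w in \<open>auto simp: norm_mult\<close>)

lemma wint_diff:
  assumes u: "wint \<beta> u" and w: "wint \<beta> w" shows "wint \<beta> (\<lambda>x. u x - w x)"
  using wint_add[OF u wint_cmult[OF w, of "-1"]] by simp

lemma pbd_add:
  assumes "pbd \<beta> f" "pbd \<beta> g" shows "pbd \<beta> (\<lambda>x. f x + g x)"
proof -
  obtain C D where "\<And>x. norm (f x) \<le> C * wt \<beta> x" "\<And>x. norm (g x) \<le> D * wt \<beta> x"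
    using assms by (auto simp: pbd_def)
  then have "norm (f x + g x) \<le> (C + D) * wt \<beta> x" for x
    using norm_triangle_mono by (fastforce simp: distrib_right)
  then show ?thesis using assms by (auto simp: pbd_def)
qed

lemma pbd_cmult:
  assumes "pbd \<beta> f" shows "pbd \<beta> (\<lambda>x. c * f x)"
proof -
  obtain C where "\<And>x. norm (f x) \<le> C * wt \<beta> x"
    using assms by (auto simp: pbd_def)
  then have "norm (c * f x) \<le> (norm c * C) * wt \<beta> x" for x
    by (auto simp: norm_mult mult.assoc intro!: mult_left_mono)
  then show ?thesis using assms by (auto simp: pbd_def)
qed

lemma pbd_diff: "pbd \<beta> f \<Longrightarrow> pbd \<beta> g \<Longrightarrow> pbd \<beta> (\<lambda>x. f x - g x)"
  using pbd_add[OF _ pbd_cmult[of \<beta> g "-1"]] by simp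

lemma wt_scaled_le: "\<beta> \<ge> 0 \<Longrightarrow> 0 \<le> \<delta> \<Longrightarrow> \<delta> \<le> 1 \<Longrightarrow> wt \<beta> (\<delta> *\<^sub>R x) \<le> wt \<beta> x"
  by (intro wt_mono) (auto simp: mult_left_le_one_le)

lemma wint_integrable_wt_scaled:
  assumes "\<beta> \<ge> 0" "0 \<le> \<delta>" "\<delta> \<le> 1" and w: "wint \<beta> w"
  shows "integrable lborel (\<lambda>x. wt \<beta> (\<delta> *\<^sub>R x) * norm (w x))"
  by (rule integrable_boundI[OF wint_integrable_wt[OF w]])
    (use assms in \<open>auto simp: mult_right_mono wt_scaled_le\<close>)

lemma integrable_conv:
  assumes "\<beta> \<ge> 0" and f: "pbd \<beta> f" and w: "wint \<beta> w"
  shows "integrable lborel (\<lambda>y. f (x - y) * w y)"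
proof -
  note [measurable] = pbd_measurable[OF f] wint_measurable[OF w]
  obtain C where C: "C \<ge> 0" "\<And>x. norm (f x) \<le> C * wt \<beta> x" using pbdE[OF f] by blast
  show ?thesis
  proof (rule integrable_boundI[where f="\<lambda>y. C * wt \<beta> x * (wt \<beta> y * norm (w y))"])
    fix y
    have "norm (f (x - y)) \<le> C * (wt \<beta> x * wt \<beta> y)"
      using C wt_diff[OF assms(1), of x y] by (meson mult_left_mono order_trans)
    then show "norm (f (x - y) * w y) \<le> C * wt \<beta> x * (wt \<beta> y * norm (w y))"
      by (auto simp: norm_mult mult_right_mono mult.assoc[symmetric])
  qed (use wint_integrable_wt[OF w] in auto)
qed

text \<open>The dilated weight is still submultiplicative with constant 1, so convolution with
  \<open>w\<close> acts on the corresponding weighted sup space with norm at most the dilated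
  weighted L1 norm of \<open>w\<close>. A small \<delta> serves the contraction argument, \<delta>
  equal to the kernel width serves finite differences.\<close>

lemma norm_conv_le_scaled:
  assumes b: "\<beta> \<ge> 0" and \<delta>: "0 \<le> \<delta>" "\<delta> \<le> 1" and f: "pbd \<beta> f" and w: "wint \<beta> w"
    and C: "\<And>x. norm (f x) \<le> C * wt \<beta> (\<delta> *\<^sub>R x)"
  shows "norm (conv f w x) \<le> C * (\<integral>y. wt \<beta> (\<delta> *\<^sub>R y) * norm (w y) \<partial>lborel) * wt \<beta> (\<delta> *\<^sub>R x)"
proof -
  have C0: "C \<ge> 0" using order_trans[OF norm_ge_zero C[of 0]] by simp
  have "norm (conv f w x) \<le> (\<integral>y. norm (f (x - y) * w y) \<partial>lborel)"
    unfolding conv_def by (rule integral_norm_bound)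
  also have "\<dots> \<le> (\<integral>y. C * wt \<beta> (\<delta> *\<^sub>R x) * (wt \<beta> (\<delta> *\<^sub>R y) * norm (w y)) \<partial>lborel)"
  proof (rule integral_mono)
    fix y
    have "wt \<beta> (\<delta> *\<^sub>R (x - y)) \<le> wt \<beta> (\<delta> *\<^sub>R x) * wt \<beta> (\<delta> *\<^sub>R y)"
      using wt_diff[OF b, of "\<delta> *\<^sub>R x" "\<delta> *\<^sub>R y"] by (simp add: scaleR_diff_right)
    then have "norm (f (x - y)) \<le> C * (wt \<beta> (\<delta> *\<^sub>R x) * wt \<beta> (\<delta> *\<^sub>R y))"
      using C C0 by (meson mult_left_mono order_trans)
    then show "norm (f (x - y) * w y) \<le> C * wt \<beta> (\<delta> *\<^sub>R x) * (wt \<beta> (\<delta> *\<^sub>R y) * norm (w y))"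
      by (auto simp: norm_mult mult_right_mono mult.assoc[symmetric])
  qed (use wint_integrable_wt_scaled[OF b \<delta> w] integrable_conv[OF b f w] in auto)
  also have "\<dots> = C * wt \<beta> (\<delta> *\<^sub>R x) * (\<integral>y. wt \<beta> (\<delta> *\<^sub>R y) * norm (w y) \<partial>lborel)"
    by (rule integral_mult_right_zero)
  finally show ?thesis by (simp only: mult_ac)
qed

lemmas norm_conv_le = norm_conv_le_scaled[where \<delta>=1, unfolded scaleR_one, OF _ zero_le_one order_refl]

lemma conv_measurable [measurable]:
  assumes [measurable]: "f \<in> borel_measurable borel" "w \<in> borel_measurable borel"
  shows "conv f w \<in> borel_measurable borel"
  unfolding conv_def[abs_def] by measurable

lemma pbd_conv:
  assumes "\<beta> \<ge> 0" "pbd \<beta> f" "wint \<beta> w" shows "pbd \<beta> (conv f w)"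
proof -
  obtain C where "\<And>x. norm (f x) \<le> C * wt \<beta> x" using pbdE[OF assms(2)] by blast
  from norm_conv_le[OF assms this] show ?thesis
    using assms by (auto simp: pbd_def wint_def)
qed

text \<open>Writing z as (z - y) + y splits the weight between the two factors; Tonelli and
  translation invariance then give the product of two weighted norms. The same majorant justifies
  \<open>wint_conv\<close> and the Fubini step of \<open>conv_assoc\<close>.\<close>

lemma integrable_prod_conv:
  fixes w1 w2 :: "'a::euclidean_space \<Rightarrow> complex"
  assumes b: "\<beta> \<ge> 0" and w1: "wint \<beta> w1" and w2: "wint \<beta> w2"
  shows "integrable (lborel \<Otimes>\<^sub>M lborel) (\<lambda>(z, y). wt \<beta> z * norm (w1 (z - y) * w2 y))"
proof -
  note [measurable] = wint_measurable[OF w1] wint_measurable[OF w2]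
  have i1: "(\<integral>\<^sup>+y. ennreal (wt \<beta> y * norm (w1 y)) \<partial>lborel) < \<infinity>" (is "?I1 < _")
    and i2: "(\<integral>\<^sup>+y. ennreal (wt \<beta> y * norm (w2 y)) \<partial>lborel) < \<infinity>" (is "?I2 < _")
    using wint_integrable_wt[OF w1] wint_integrable_wt[OF w2] unfolding integrable_iff_bounded by auto
  have "(\<integral>\<^sup>+p. ennreal (norm (case p of (z, y) \<Rightarrow> wt \<beta> z * norm (w1 (z - y) * w2 y))) \<partial>(lborel \<Otimes>\<^sub>M lborel))
     = (\<integral>\<^sup>+y. \<integral>\<^sup>+z. ennreal (norm (wt \<beta> z * norm (w1 (z - y) * w2 y))) \<partial>lborel \<partial>lborel)"
    by (subst lborel_pair.nn_integral_snd[symmetric]) (auto simp: split_beta')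
  also have "\<dots> \<le> (\<integral>\<^sup>+y. \<integral>\<^sup>+z. ennreal (wt \<beta> (z - y) * norm (w1 (z - y))) * ennreal (wt \<beta> y * norm (w2 y)) \<partial>lborel \<partial>lborel)"
  proof (intro nn_integral_mono)
    fix y z :: 'a
    have "wt \<beta> z \<le> wt \<beta> (z - y) * wt \<beta> y" using wt_add[OF b, of "z - y" y] by simp
    then have "wt \<beta> z * (norm (w1 (z - y)) * norm (w2 y)) \<le> (wt \<beta> (z - y) * wt \<beta> y) * (norm (w1 (z - y)) * norm (w2 y))"
      by (intro mult_right_mono) auto
    then show "ennreal (norm (wt \<beta> z * norm (w1 (z - y) * w2 y))) \<le> ennreal (wt \<beta> (z - y) * norm (w1 (z - y))) * ennreal (wt \<beta> y * norm (w2 y))"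
      by (auto simp: ennreal_mult[symmetric] abs_mult norm_mult ac_simps intro!: ennreal_leI)
  qed
  also have "\<dots> = (\<integral>\<^sup>+y. ?I1 * ennreal (wt \<beta> y * norm (w2 y)) \<partial>lborel)"
    by (subst nn_integral_multc)
      (auto simp: nn_integral_lborel_translate[where f="\<lambda>x. ennreal (wt \<beta> x * norm (w1 x))"])
  also have "\<dots> = ?I1 * ?I2"
    by (subst nn_integral_cmult) auto
  also have "\<dots> < \<infinity>" using i1 i2 by (simp add: ennreal_mult_less_top)
  finally show ?thesis
    by (intro integrableI_bounded) (auto simp: split_beta')
qed

lemma wint_conv:
  fixes w1 w2 :: "'a::euclidean_space \<Rightarrow> complex"
  assumes b: "\<beta> \<ge> 0" and w1: "wint \<beta> w1" and w2: "wint \<beta> w2"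
  shows "wint \<beta> (conv w1 w2)"
proof -
  note [measurable] = wint_measurable[OF w1] wint_measurable[OF w2]
  have i: "integrable lborel (\<lambda>z. \<integral>y. wt \<beta> z * norm (w1 (z - y) * w2 y) \<partial>lborel)"
    by (rule lborel_pair.integrable_fst[OF integrable_prod_conv[OF assms]])
  have "integrable lborel (\<lambda>z. wt \<beta> z * norm (conv w1 w2 z))"
    by (rule integrable_boundI[OF i])
      (auto simp: abs_mult conv_def intro!: mult_left_mono integral_norm_bound)
  then show ?thesis by (simp add: wint_def)
qed

lemma conv_assoc:
  fixes w1 w2 :: "'a::euclidean_space \<Rightarrow> complex"
  assumes b: "\<beta> \<ge> 0" and f: "pbd \<beta> f" and w1: "wint \<beta> w1" and w2: "wint \<beta> w2"
  shows "conv (conv f w1) w2 = conv f (conv w1 w2)"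
proof
  fix x
  note [measurable] = wint_measurable[OF w1] wint_measurable[OF w2] pbd_measurable[OF f]
  obtain C where C: "C \<ge> 0" "\<And>x. norm (f x) \<le> C * wt \<beta> x" using pbdE[OF f] by blast
  have int: "integrable (lborel \<Otimes>\<^sub>M lborel) (\<lambda>(z, y). f (x - z) * (w1 (z - y) * w2 y))"
  proof (rule Bochner_Integration.integrable_bound[OF integrable_mult_right[OF integrable_prod_conv[OF b w1 w2], of "C * wt \<beta> x"] _ AE_I2])
    fix p :: "'a \<times> 'a"
    obtain z y where p: "p = (z, y)" by (cases p)
    \<comment> \<open>For fixed x the growth of \<open>f\<close> costs only the weight in z, which
      the integrable majorant already carries.\<close>
    have "norm (f (x - z)) \<le> C * (wt \<beta> x * wt \<beta> z)"
      using C wt_diff[OF assms(1), of x z] by (meson mult_left_mono order_trans)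
    from mult_right_mono[OF this, of "norm (w1 (z - y) * w2 y)"]
    show "norm (case p of (z, y) \<Rightarrow> f (x - z) * (w1 (z - y) * w2 y))
         \<le> norm (C * wt \<beta> x * (case p of (z, y) \<Rightarrow> wt \<beta> z * norm (w1 (z - y) * w2 y)))"
      using C by (simp add: p norm_mult abs_mult ac_simps)
  qed (auto simp: split_beta')
  have "conv (conv f w1) w2 x = (\<integral>y. (\<integral>z. f (x - y - z) * w1 z \<partial>lborel) * w2 y \<partial>lborel)"
    by (simp add: conv_def)
  also have "\<dots> = (\<integral>y. (\<integral>z. f (x - z) * w1 (z - y) \<partial>lborel) * w2 y \<partial>lborel)"
    by (subst (1) integral_lborel_translate[of "\<lambda>z. f (x - y - z) * w1 z" "-y" for y])
       (simp add: algebra_simps)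
  also have "\<dots> = (\<integral>y. (\<integral>z. f (x - z) * (w1 (z - y) * w2 y) \<partial>lborel) \<partial>lborel)"
    by (simp flip: mult.assoc)
  also have "\<dots> = (\<integral>z. (\<integral>y. f (x - z) * (w1 (z - y) * w2 y) \<partial>lborel) \<partial>lborel)"
    by (rule lborel_pair.Fubini_integral[OF int])
  also have "\<dots> = conv f (conv w1 w2) x"
    by (simp add: conv_def)
  finally show "conv (conv f w1) w2 x = conv f (conv w1 w2) x" .
qed

lemma conv_cong_AE:
  assumes [measurable]: "f \<in> borel_measurable borel" "w \<in> borel_measurable borel" "w' \<in> borel_measurable borel"
    and "AE y in lborel. w y = w' y"
  shows "conv f w = conv f w'"
  unfolding conv_def by (intro ext integral_cong_AE) (use assms(4) in auto)

lemma conv_diff_left: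
  assumes "\<beta> \<ge> 0" "pbd \<beta> f" "pbd \<beta> g" "wint \<beta> w"
  shows "conv (\<lambda>x. f x - g x) w x = conv f w x - conv g w x"
  using integrable_conv[of \<beta> f w x] integrable_conv[of \<beta> g w x] assms
  by (simp add: conv_def algebra_simps)

lemma conv_diff_right:
  assumes "\<beta> \<ge> 0" "pbd \<beta> f" "wint \<beta> w" "wint \<beta> u"
  shows "conv f (\<lambda>x. w x - u x) x = conv f w x - conv f u x"
  using integrable_conv[of \<beta> f w x] integrable_conv[of \<beta> f u x] assms
  by (simp add: conv_def algebra_simps)

lemma conv_cmult_right: "conv f (\<lambda>x. c * w x) x = c * conv f w x"
  by (simp add: conv_def mult.left_commute[of _ c])

lemma conv_0_left [simp]: "conv (\<lambda>_. 0) w = (\<lambda>_. 0)" and conv_0_right [simp]: "conv w (\<lambda>_. 0) = (\<lambda>_. 0)"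
  by (auto simp: conv_def)

section \<open>Fourier transform of integrable functions\<close>

text \<open>Characters are eigenfunctions of convolution and \<open>hat w \<xi>\<close> is the
  eigenvalue. This view makes \<open>hat_conv\<close> an instance of associativity and drives the
  estimate behind Wiener's trick.\<close>

lemma conv_character:
  "conv (\<lambda>x. exp (\<i> * of_real (x \<bullet> \<xi>))) w x = exp (\<i> * of_real (x \<bullet> \<xi>)) * hat w \<xi>"
proof -
  have "exp (\<i> * of_real ((x - y) \<bullet> \<xi>)) = exp (\<i> * of_real (x \<bullet> \<xi>)) * exp (- \<i> * of_real (y \<bullet> \<xi>))" for y
    by (simp add: inner_diff_left algebra_simps exp_diff exp_minus divide_inverse flip: of_real_mult)
  then have "conv (\<lambda>x. exp (\<i> * of_real (x \<bullet> \<xi>))) w x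
    = (\<integral>y. exp (\<i> * of_real (x \<bullet> \<xi>)) * (exp (- \<i> * of_real (y \<bullet> \<xi>)) * w y) \<partial>lborel)"
    unfolding conv_def by (simp only: mult.assoc)
  then show ?thesis unfolding hat_def by (simp only: integral_mult_right_zero)
qed

lemma hat_conv:
  fixes w1 w2 :: "'a::euclidean_space \<Rightarrow> complex"
  assumes w1: "integrable lborel w1" and w2: "integrable lborel w2"
  shows "hat (conv w1 w2) \<xi> = hat w1 \<xi> * hat w2 \<xi>"
proof -
  let ?e = "\<lambda>x::'a. exp (\<i> * of_real (x \<bullet> \<xi>))"
  have e: "pbd 0 ?e" by (auto simp: pbd_def intro!: exI[of _ 1])
  have "conv ?e (conv w1 w2) 0 = conv (conv ?e w1) w2 0"
    \<comment> \<open>Associativity applied to the bounded function \<open>?e\<close>: both sides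
      are eigenvalues, read off at the point 0.\<close>
    using conv_assoc[of 0 ?e w1 w2] e w1 w2 by (simp add: wint_0_iff)
  also have "conv ?e w1 = (\<lambda>x. hat w1 \<xi> * ?e x)"
    by (simp add: fun_eq_iff conv_character mult.commute)
  also have "conv (\<lambda>x. hat w1 \<xi> * ?e x) w2 0 = hat w1 \<xi> * conv ?e w2 0"
    by (simp add: conv_def mult.assoc)
  finally show ?thesis by (simp add: conv_character)
qed

lemma hat_cmult: "hat (\<lambda>x. c * w x) \<xi> = c * hat w \<xi>"
  by (simp add: hat_def mult.left_commute[of _ c])

lemma integrable_character_mult:
  fixes w :: "'a::euclidean_space \<Rightarrow> complex"
  assumes "integrable lborel w"
  shows "integrable lborel (\<lambda>x. exp (- \<i> * of_real (x \<bullet> \<xi>)) * w x)"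
  by (rule Bochner_Integration.integrable_bound[OF assms])
    (use borel_measurable_integrable[OF assms] in \<open>auto simp: norm_mult\<close>)

lemma hat_diff:
  fixes w :: "'a::euclidean_space \<Rightarrow> complex"
  assumes "integrable lborel w" "integrable lborel u"
  shows "hat (\<lambda>x. w x - u x) \<xi> = hat w \<xi> - hat u \<xi>"
  using integrable_character_mult[OF assms(1), of \<xi>] integrable_character_mult[OF assms(2), of \<xi>]
  by (simp add: hat_def algebra_simps)

lemma norm_hat_le: "norm (hat w \<xi>) \<le> (\<integral>x. norm (w x) \<partial>lborel)"
proof -
  have "norm (hat w \<xi>) \<le> (\<integral>x. norm (exp (- \<i> * of_real (x \<bullet> \<xi>)) * w x) \<partial>lborel)"
    unfolding hat_def by (rule integral_norm_bound)
  then show ?thesis by (simp add: norm_mult)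
qed

lemma hat_measurable [measurable]:
  assumes [measurable]: "w \<in> borel_measurable borel"
  shows "hat w \<in> borel_measurable borel"
  unfolding hat_def[abs_def] by measurable

lemma continuous_hat:
  fixes w :: "'a::euclidean_space \<Rightarrow> complex"
  assumes w: "integrable lborel w"
  shows "continuous_on UNIV (hat w)"
proof -
  note [measurable] = borel_measurable_integrable[OF w]
  have "(\<lambda>n. hat w (X n)) \<longlonglongrightarrow> hat w a" if "X \<longlonglongrightarrow> a" for X a
    unfolding hat_def
    by (rule integral_dominated_convergence[where w="\<lambda>x. norm (w x)"])
      (use w that in \<open>auto simp: norm_mult intro!: tendsto_intros AE_I2\<close>)
  then show ?thesis by (auto simp: continuous_on_sequentially o_def)
qed

subsection \<open>Injectivity and inversion of the Fourier transform\<close>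

lemma integrable_tensor:
  fixes f :: "'a::euclidean_space \<Rightarrow> complex" and g :: "'b::euclidean_space \<Rightarrow> complex"
  assumes f: "integrable lborel f" and g: "integrable lborel g"
  shows "integrable (lborel \<Otimes>\<^sub>M lborel) (\<lambda>(x, y). f x * g y)"
proof (rule lborel_pair.Fubini_integrable)
  note [measurable] = borel_measurable_integrable[OF f] borel_measurable_integrable[OF g]
  show "(\<lambda>(x, y). f x * g y) \<in> borel_measurable (lborel \<Otimes>\<^sub>M lborel)"
    by (simp add: split_beta')
  show "integrable lborel (\<lambda>x. \<integral>y. norm (case (x, y) of (x, y) \<Rightarrow> f x * g y) \<partial>lborel)"
    using f by (simp add: norm_mult)
qed (use g in simp)

text \<open>The multiplication formula, a Fubini exchange. Injectivity and inversion both come from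
  it by choosing \<open>g\<close> as a modulated dilate.\<close>

lemma integral_hat_mult:
  fixes f g :: "'a::euclidean_space \<Rightarrow> complex"
  assumes f: "integrable lborel f" and g: "integrable lborel g"
  shows "(\<integral>\<xi>. hat f \<xi> * g \<xi> \<partial>lborel) = (\<integral>x. f x * hat g x \<partial>lborel)"
proof -
  note [measurable] = borel_measurable_integrable[OF f] borel_measurable_integrable[OF g]
  have int: "integrable (lborel \<Otimes>\<^sub>M lborel) (\<lambda>(x, \<xi>). exp (- \<i> * of_real (x \<bullet> \<xi>)) * (f x * g \<xi>))"
    by (rule Bochner_Integration.integrable_bound[OF integrable_tensor[OF f g] _ AE_I2])
       (auto simp: split_beta' norm_mult)
  have "(\<integral>\<xi>. hat f \<xi> * g \<xi> \<partial>lborel) = (\<integral>\<xi>. \<integral>x. exp (- \<i> * of_real (x \<bullet> \<xi>)) * (f x * g \<xi>) \<partial>lborel \<partial>lborel)"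
    unfolding hat_def integral_mult_left_zero[symmetric] by (simp only: mult.assoc)
  also have "\<dots> = (\<integral>x. \<integral>\<xi>. exp (- \<i> * of_real (x \<bullet> \<xi>)) * (f x * g \<xi>) \<partial>lborel \<partial>lborel)"
    by (rule lborel_pair.Fubini_integral[OF int])
  also have "\<dots> = (\<integral>x. f x * hat g x \<partial>lborel)"
    unfolding hat_def integral_mult_right_zero[symmetric] by (simp only: mult.left_commute inner_commute)
  finally show ?thesis .
qed

lemma hat_modulate:
  "hat (\<lambda>x. exp (\<i> * of_real (x \<bullet> a)) * w x) \<xi> = hat w (\<xi> - a)"
proof -
  have "exp (- \<i> * of_real (x \<bullet> \<xi>)) * (exp (\<i> * of_real (x \<bullet> a)) * w x)
    = exp (- \<i> * of_real (x \<bullet> (\<xi> - a))) * w x" for x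
    by (simp add: inner_diff_right algebra_simps exp_diff exp_minus divide_inverse)
  then show ?thesis unfolding hat_def by (simp only:)
qed

lemma hat_scale:
  fixes w :: "'a::euclidean_space \<Rightarrow> complex"
  assumes c: "c > 0"
  shows "hat (\<lambda>x. w (c *\<^sub>R x)) \<xi> = complex_of_real ((1 / c) ^ DIM('a)) * hat w (\<xi> /\<^sub>R c)"
  using c unfolding hat_def
  by (subst integral_lborel_affine[of "1/c" _ 0]) (simp_all add: scaleR_conv_of_real divide_inverse ac_simps)

lemma hat_translate:
  fixes w :: "'a::euclidean_space \<Rightarrow> complex"
  shows "hat (\<lambda>x. w (a + x)) \<xi> = exp (\<i> * of_real (a \<bullet> \<xi>)) * hat w \<xi>"
proof -
  have "hat (\<lambda>x. w (a + x)) \<xi> = (\<integral>x. exp (- \<i> * of_real ((-a + x) \<bullet> \<xi>)) * w x \<partial>lborel)"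
    unfolding hat_def by (subst integral_lborel_translate[of _ "- a"]) simp
  also have "\<dots> = (\<integral>x. exp (\<i> * of_real (a \<bullet> \<xi>)) * (exp (- \<i> * of_real (x \<bullet> \<xi>)) * w x) \<partial>lborel)"
    by (simp add: inner_add_left algebra_simps exp_diff exp_minus divide_inverse)
  finally show ?thesis by (simp add: hat_def)
qed

lemma hat_reflect:
  fixes w :: "'a::euclidean_space \<Rightarrow> complex"
  shows "hat (\<lambda>x. w (- x)) \<xi> = hat w (- \<xi>)"
  unfolding hat_def by (subst integral_lborel_reflect[of _ 0]) simp

text \<open>The left side is the inversion integral of \<open>g\<close> regularised by the factor
  \<open>\<gamma> (t *\<^sub>R \<xi>)\<close>; the right side is an average of \<open>g\<close>
  around x at scale t. Letting t tend to 0 links \<open>g\<close> to its transform.\<close>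

lemma integral_hat_dilated:
  fixes g \<gamma> :: "'a::euclidean_space \<Rightarrow> complex"
  assumes g: "integrable lborel g" and \<gamma>: "integrable lborel \<gamma>" and t: "t > 0"
  shows "(\<integral>\<xi>. hat g \<xi> * (exp (\<i> * of_real (\<xi> \<bullet> x)) * \<gamma> (t *\<^sub>R \<xi>)) \<partial>lborel)
    = (\<integral>z. g (x + t *\<^sub>R z) * hat \<gamma> z \<partial>lborel)"
proof -
  have \<gamma>t: "integrable lborel (\<lambda>\<xi>. \<gamma> (t *\<^sub>R \<xi>))"
    using integrable_lborel_affine[OF \<gamma>, of t 0] t by simp
  have "integrable lborel (\<lambda>\<xi>. exp (\<i> * of_real (\<xi> \<bullet> x)) * \<gamma> (t *\<^sub>R \<xi>))"
    using integrable_character_mult[OF \<gamma>t, of "-x"] by simp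
  from integral_hat_mult[OF g this]
  have "(\<integral>\<xi>. hat g \<xi> * (exp (\<i> * of_real (\<xi> \<bullet> x)) * \<gamma> (t *\<^sub>R \<xi>)) \<partial>lborel)
    = (\<integral>y. g y * (complex_of_real ((1 / t) ^ DIM('a)) * hat \<gamma> ((y - x) /\<^sub>R t)) \<partial>lborel)"
    using t by (simp add: hat_modulate[where w="\<lambda>\<xi>. \<gamma> (t *\<^sub>R \<xi>)"] hat_scale)
  also have "\<dots> = (\<integral>y. complex_of_real ((1 / t) ^ DIM('a)) * (g y * hat \<gamma> ((y - x) /\<^sub>R t)) \<partial>lborel)"
    by (simp only: mult.left_commute)
  also have "\<dots> = (\<integral>z. g (x + t *\<^sub>R z) * hat \<gamma> z \<partial>lborel)"
    using t by (subst integral_lborel_affine[of t _ x])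
      (simp_all add: scaleR_conv_of_real power_one_over)
  finally show ?thesis .
qed

text \<open>An approximate identity without normalisation, by dominated convergence. It serves
  injectivity, inversion and the smallness of the modulus integral.\<close>

lemma integral_dilated_limit:
  fixes J k :: "'a::euclidean_space \<Rightarrow> complex"
  assumes k: "integrable lborel k" and [measurable]: "J \<in> borel_measurable borel"
    and bd: "\<And>x. norm (J x) \<le> M" and cont: "isCont J a"
  shows "(\<lambda>n. \<integral>z. J (a + (1 / real (Suc n)) *\<^sub>R z) * k z \<partial>lborel) \<longlonglongrightarrow> J a * (\<integral>z. k z \<partial>lborel)"
proof -
  note [measurable] = borel_measurable_integrable[OF k]
  have lim: "(\<lambda>n. J (a + (1 / real (Suc n)) *\<^sub>R z)) \<longlonglongrightarrow> J a" for z
  proof -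
    have "(\<lambda>n. a + (1 / real (Suc n)) *\<^sub>R z) \<longlonglongrightarrow> a + 0 *\<^sub>R z"
      by (intro tendsto_intros lim_1_over_n[THEN LIMSEQ_Suc])
    then show ?thesis using isCont_tendsto_compose[OF cont] by simp
  qed
  have "(\<lambda>n. \<integral>z. J (a + (1 / real (Suc n)) *\<^sub>R z) * k z \<partial>lborel) \<longlonglongrightarrow> (\<integral>z. J a * k z \<partial>lborel)"
  proof (rule integral_dominated_convergence[where w="\<lambda>z. M * norm (k z)"])
    show "AE z in lborel. (\<lambda>n. J (a + (1 / real (Suc n)) *\<^sub>R z) * k z) \<longlonglongrightarrow> J a * k z"
      by (intro AE_I2 tendsto_mult lim tendsto_const)
    show "AE z in lborel. norm (J (a + (1 / real (Suc n)) *\<^sub>R z) * k z) \<le> M * norm (k z)" for n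
      by (auto simp: norm_mult intro!: mult_right_mono bd)
  qed (use k in auto)
  then show ?thesis by simp
qed

section \<open>Functions determined by integrals against continuous functions\<close>

text \<open>Indicators of open sets are pointwise limits of continuous functions bounded by 1. Open
  sets form an intersection-stable generator, so the integral over every Borel set vanishes, and a
  density with this property is 0 almost everywhere.\<close>

lemma AE_eq_0_if_integrals_real:
  fixes g :: "'a::euclidean_space \<Rightarrow> real"
  assumes g: "integrable lborel g"
    and h: "\<And>h. continuous_on UNIV h \<Longrightarrow> (\<And>x. \<bar>h x\<bar> \<le> 1) \<Longrightarrow> (\<integral>x. h x * g x \<partial>lborel) = 0"
  shows "AE x in lborel. g x = 0"
proof -
  note [measurable] = borel_measurable_integrable[OF g]
  have op: "(\<integral>x. indicator A x * g x \<partial>lborel) = 0" if A: "open A" for A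
  \<comment> \<open>For \<open>A = UNIV\<close> the complement is empty, and \<open>infdist\<close>
    to the empty set is 0 by convention, so the cutoffs \<open>hk\<close> would vanish
    identically.\<close>
  proof (cases "A = UNIV")
    case True then show ?thesis using h[of "\<lambda>_. 1"] by simp
  next
    case False
    define hk where "hk k x = min 1 (real k * infdist x (- A))" for k x
    have hkb: "0 \<le> hk k x" "hk k x \<le> 1" for k x by (auto simp: hk_def infdist_nonneg)
    have cont: "continuous_on UNIV (hk k)" for k unfolding hk_def by (intro continuous_intros)
    then have [measurable]: "hk k \<in> borel_measurable borel" for k by (rule borel_measurable_continuous_onI)
    have [measurable]: "A \<in> sets borel" using A by simp
    have lim: "(\<lambda>k. hk k x) \<longlonglongrightarrow> indicator A x" for x
    proof (cases "x \<in> A")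
      case True
      then have "infdist x (- A) > 0" using A False
        by (metis Compl_UNIV_eq Compl_iff closed_Compl double_complement in_closed_iff_infdist_zero infdist_nonneg less_eq_real_def)
      then obtain N where N: "1 < real N * infdist x (- A)" using reals_Archimedean3 by blast
      have "eventually (\<lambda>k. hk k x = 1) sequentially"
        using eventually_ge_at_top[of N]
      proof eventually_elim
        case (elim k)
        then have "real N * infdist x (- A) \<le> real k * infdist x (- A)"
          by (intro mult_right_mono) (auto simp: infdist_nonneg)
        then show ?case using N by (simp add: hk_def)
      qed
      then show ?thesis using True by (simp add: tendsto_eventually)
    next
      case False then show ?thesis by (simp add: hk_def)
    qed
    have "(\<lambda>k. \<integral>x. hk k x * g x \<partial>lborel) \<longlonglongrightarrow> (\<integral>x. indicator A x * g x \<partial>lborel)"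
    proof (rule integral_dominated_convergence[where w="\<lambda>x. norm (g x)"])
      show "AE x in lborel. (\<lambda>k. hk k x * g x) \<longlonglongrightarrow> indicator A x * g x"
        by (intro AE_I2 tendsto_mult lim tendsto_const)
      show "AE x in lborel. norm (hk k x * g x) \<le> norm (g x)" for k
        using hkb by (auto simp: abs_mult mult_left_le_one_le)
    qed (use g in auto)
    moreover have "(\<integral>x. hk k x * g x \<partial>lborel) = 0" for k
      using h[OF cont] hkb by (simp add: abs_le_iff order_trans[OF _ hkb(1)])
    ultimately show ?thesis by (simp add: LIMSEQ_const_iff)
  qed
  have int: "integrable lborel (\<lambda>x. indicator A x * g x)" if "A \<in> sets borel" for A
    using integrable_mult_indicator[OF _ g, of A] that by simp
  have all: "(\<integral>x. indicator A x * g x \<partial>lborel) = 0" if A: "A \<in> sets borel" for A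
  proof -
    have "Int_stable {S::'a set. open S}" "{S::'a set. open S} \<subseteq> Pow UNIV" "A \<in> sigma_sets UNIV {S. open S}"
      using A by (auto simp: borel_def Int_stable_def)
    then show ?thesis
    proof (induction rule: sigma_sets_induct_disjoint)
      case (basic A) then show ?case using op by simp
    next
      case (compl A)
      then have A: "A \<in> sets borel" by (simp add: borel_def)
      have "(\<integral>x. indicator (UNIV - A) x * g x \<partial>lborel) = (\<integral>x. indicator UNIV x * g x - indicator A x * g x \<partial>lborel)"
        by (intro Bochner_Integration.integral_cong) (auto simp: indicator_def)
      also have "\<dots> = 0"
        by (subst Bochner_Integration.integral_diff[OF int int]) (use A compl op[of UNIV] in auto)
      finally show ?case .
    next
      case (union F)
      then have F: "F i \<in> sets lborel" for i by (auto simp: borel_def)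
      then have "(\<Union>i. F i) \<in> sets lborel" by blast
      then have "set_integrable lborel (\<Union>i. F i) g"
        using int by (simp add: set_integrable_def)
      from lebesgue_integral_countable_add[OF F _ this] union(1,3)
      show ?case by (simp add: set_lebesgue_integral_def disjoint_family_on_def)
    qed simp
  qed
  show ?thesis
    by (rule density_unique_real[OF g, of "\<lambda>_. 0"]) (use all in \<open>auto simp: set_lebesgue_integral_def\<close>)
qed

lemma AE_eq_0_if_integrals:
  fixes g :: "'a::euclidean_space \<Rightarrow> complex"
  assumes g: "integrable lborel g"
    and h: "\<And>h :: 'a \<Rightarrow> real. continuous_on UNIV h \<Longrightarrow> (\<And>x. \<bar>h x\<bar> \<le> 1) \<Longrightarrow> (\<integral>x. complex_of_real (h x) * g x \<partial>lborel) = 0"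
  shows "AE x in lborel. g x = 0"
proof -
  have 1: "integrable lborel (\<lambda>x. complex_of_real (h x) * g x)"
    if h: "continuous_on UNIV h" "\<And>x. \<bar>h x\<bar> \<le> 1" for h :: "'a \<Rightarrow> real"
  proof -
    have [measurable]: "h \<in> borel_measurable borel" "g \<in> borel_measurable borel"
      using h borel_measurable_continuous_onI g by auto
    show ?thesis using h
      by (intro Bochner_Integration.integrable_bound[OF g _ AE_I2]) (auto simp: norm_mult mult_left_le_one_le)
  qed
  have "AE x in lborel. Re (c * g x) = 0" for c
  proof (rule AE_eq_0_if_integrals_real)
    fix h :: "'a \<Rightarrow> real" assume h': "continuous_on UNIV h" "\<And>x. \<bar>h x\<bar> \<le> 1"
    have "(\<integral>x. h x * Re (c * g x) \<partial>lborel) = Re (\<integral>x. c * (complex_of_real (h x) * g x) \<partial>lborel)"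
      by (subst integral_Re[symmetric, OF integrable_mult_right[OF 1[OF h']]]) (simp add: algebra_simps)
    then show "(\<integral>x. h x * Re (c * g x) \<partial>lborel) = 0" using h[OF h'] by simp
  qed (use g in auto)
  \<comment> \<open>Multiplication by \<open>- \<i>\<close> turns the imaginary part into the real
    part.\<close>
  from this[of 1] this[of "- \<i>"] show ?thesis by eventually_elim (simp add: complex_eq_iff)
qed

section \<open>Injectivity and inversion\<close>

text \<open>The approximate identity requires continuity, which \<open>g\<close> may lack. It is
  therefore applied to the correlation \<open>J\<close> of \<open>h\<close> and \<open>g\<close>,
  which is bounded and continuous. After a Fubini exchange the inner integral is a regularised
  inversion integral of \<open>g\<close>, hence 0, and in the limit \<open>J 0\<close> vanishes,
  which is the integral of \<open>h\<close> against \<open>g\<close>.\<close>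

lemma hat_eq_0_imp_AE:
  fixes g \<gamma> :: "'a::euclidean_space \<Rightarrow> complex"
  assumes \<gamma>: "integrable lborel \<gamma>" and \<kappa>: "integrable lborel (hat \<gamma>)" and c: "(\<integral>z. hat \<gamma> z \<partial>lborel) \<noteq> 0"
    and g: "integrable lborel g" and 0: "\<And>\<xi>. hat g \<xi> = 0"
  shows "AE x in lborel. g x = 0"
proof (rule AE_eq_0_if_integrals[OF g])
  fix h :: "'a \<Rightarrow> real" assume h: "continuous_on UNIV h" "\<And>x. \<bar>h x\<bar> \<le> 1"
  have [measurable]: "h \<in> borel_measurable borel" "g \<in> borel_measurable borel" "\<gamma> \<in> borel_measurable borel"
    using h borel_measurable_continuous_onI g \<gamma> by auto
  define J where "J y = (\<integral>x. complex_of_real (h x) * g (x + y) \<partial>lborel)" for y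
  have [measurable]: "J \<in> borel_measurable borel" unfolding J_def by measurable
  have J: "J y = (\<integral>x. complex_of_real (h (x - y)) * g x \<partial>lborel)" for y
    unfolding J_def by (subst integral_lborel_translate[of _ "-y"]) simp
  have Jb: "norm (J y) \<le> (\<integral>x. norm (g x) \<partial>lborel)" for y
  proof -
    have "norm (J y) \<le> (\<integral>x. norm (complex_of_real (h (x - y)) * g x) \<partial>lborel)"
      unfolding J by (rule integral_norm_bound)
    also have "\<dots> \<le> (\<integral>x. norm (g x) \<partial>lborel)"
      by (intro integral_mono Bochner_Integration.integrable_bound[OF g _ AE_I2] integrable_norm)
        (use h g in \<open>auto simp: norm_mult mult_left_le_one_le\<close>)
    finally show ?thesis .
  qed
  have Jc: "isCont J a" for a
    unfolding continuous_at_sequentially o_def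
  proof safe
    fix X assume X: "X \<longlonglongrightarrow> a"
    show "(\<lambda>n. J (X n)) \<longlonglongrightarrow> J a" unfolding J
    proof (rule integral_dominated_convergence[where w="\<lambda>x. norm (g x)"])
      show "AE x in lborel. (\<lambda>n. complex_of_real (h (x - X n)) * g x) \<longlonglongrightarrow> complex_of_real (h (x - a)) * g x"
      proof (intro AE_I2 tendsto_intros)
        fix x
        have "isCont h (x - a)" using h(1) by (simp add: continuous_on_eq_continuous_at)
        then show "(\<lambda>n. h (x - X n)) \<longlonglongrightarrow> h (x - a)"
          by (rule isCont_tendsto_compose) (intro tendsto_intros X)
      qed
    qed (use h g in \<open>auto simp: norm_mult mult_left_le_one_le\<close>)
  qed
  have z: "(\<integral>z. J (t *\<^sub>R z) * hat \<gamma> z \<partial>lborel) = 0" if t: "t > 0" for t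
  proof -
    have int: "integrable (lborel \<Otimes>\<^sub>M lborel) (\<lambda>(z, x). complex_of_real (h x) * g (x + t *\<^sub>R z) * hat \<gamma> z)"
    proof (rule lborel_pair.Fubini_integrable)
      have "integrable lborel (\<lambda>x. complex_of_real (h x) * g (x + t *\<^sub>R z))" for z
      proof (rule Bochner_Integration.integrable_bound[OF _ _ AE_I2])
        show "integrable lborel (\<lambda>x. g (x + t *\<^sub>R z))"
          using g integrable_lborel_translate_iff[of g "t *\<^sub>R z"] by (simp add: add.commute)
      qed (use h in \<open>auto simp: norm_mult mult_left_le_one_le\<close>)
      then show "AE z in lborel. integrable lborel (\<lambda>x. case (z, x) of (z, x) \<Rightarrow> complex_of_real (h x) * g (x + t *\<^sub>R z) * hat \<gamma> z)"
        by simp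
      have le: "(\<integral>x. norm (complex_of_real (h x) * g (x + t *\<^sub>R z) * hat \<gamma> z) \<partial>lborel) \<le> (\<integral>x. norm (g x) \<partial>lborel) * norm (hat \<gamma> z)" for z
      proof -
        have "(\<integral>x. norm (complex_of_real (h x) * g (x + t *\<^sub>R z) * hat \<gamma> z) \<partial>lborel)
          = (\<integral>x. norm (complex_of_real (h (x - t *\<^sub>R z)) * g x) * norm (hat \<gamma> z) \<partial>lborel)"
          by (subst integral_lborel_translate[of _ "- t *\<^sub>R z"]) (simp add: norm_mult)
        also have "\<dots> \<le> (\<integral>x. norm (g x) * norm (hat \<gamma> z) \<partial>lborel)"
          by (intro integral_mono mult_right_mono integrable_mult_left integrable_norm Bochner_Integration.integrable_bound[OF g _ AE_I2])
             (use h g in \<open>auto simp: norm_mult mult_left_le_one_le\<close>)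
        finally show ?thesis by simp
      qed
      show "integrable lborel (\<lambda>z. \<integral>x. norm (case (z, x) of (z, x) \<Rightarrow> complex_of_real (h x) * g (x + t *\<^sub>R z) * hat \<gamma> z) \<partial>lborel)"
        by (rule integrable_boundI[where f="\<lambda>z. (\<integral>x. norm (g x) \<partial>lborel) * norm (hat \<gamma> z)"])
          (use \<kappa> le in \<open>auto simp: Bochner_Integration.integral_nonneg\<close>)
    qed (auto simp: split_beta')
    have "(\<integral>z. J (t *\<^sub>R z) * hat \<gamma> z \<partial>lborel) = (\<integral>z. \<integral>x. complex_of_real (h x) * g (x + t *\<^sub>R z) * hat \<gamma> z \<partial>lborel \<partial>lborel)"
      by (simp add: J_def)
    also have "\<dots> = (\<integral>x. \<integral>z. complex_of_real (h x) * g (x + t *\<^sub>R z) * hat \<gamma> z \<partial>lborel \<partial>lborel)"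
      using lborel_pair.Fubini_integral[OF int] by simp
    also have "\<dots> = (\<integral>x. complex_of_real (h x) * (\<integral>z. g (x + t *\<^sub>R z) * hat \<gamma> z \<partial>lborel) \<partial>lborel)"
      by (simp add: mult.assoc)
    also have "\<dots> = 0"
      by (simp add: integral_hat_dilated[OF g \<gamma> t, symmetric] 0)
    finally show ?thesis .
  qed
  have "(\<lambda>n. 0) \<longlonglongrightarrow> J 0 * (\<integral>z. hat \<gamma> z \<partial>lborel)"
    using integral_dilated_limit[OF \<kappa> _ Jb Jc, of 0] by (simp add: z del: of_nat_Suc)
  then have "J 0 = 0" using c by (simp add: LIMSEQ_const_iff)
  then show "(\<integral>x. complex_of_real (h x) * g x \<partial>lborel) = 0" by (simp add: J_def)
qed

text \<open>One sequence with two limits: as averages of \<open>u\<close> it tends to the right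
  side, as regularised inversion integrals to the left side. The constants of the pair \<gamma>,
  \<open>hat \<gamma>\<close> stay free, so no explicit transform has to be computed.\<close>

lemma hat_inversion:
  fixes u \<gamma> :: "'a::euclidean_space \<Rightarrow> complex"
  assumes \<gamma>: "integrable lborel \<gamma>" and \<kappa>: "integrable lborel (hat \<gamma>)"
    and \<gamma>c: "isCont \<gamma> 0" and \<gamma>b: "\<And>x. norm (\<gamma> x) \<le> M"
    and u: "integrable lborel u" "integrable lborel (hat u)" "isCont u x" "\<And>x. norm (u x) \<le> B"
  shows "\<gamma> 0 * (\<integral>\<xi>. exp (\<i> * of_real (\<xi> \<bullet> x)) * hat u \<xi> \<partial>lborel) = (\<integral>z. hat \<gamma> z \<partial>lborel) * u x"
proof (rule LIMSEQ_unique)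
  have [measurable]: "u \<in> borel_measurable borel" "\<gamma> \<in> borel_measurable borel"
    using u \<gamma> by auto
  let ?I = "\<lambda>n. \<integral>z. u (x + (1 / real (Suc n)) *\<^sub>R z) * hat \<gamma> z \<partial>lborel"
  show "?I \<longlonglongrightarrow> (\<integral>z. hat \<gamma> z \<partial>lborel) * u x"
    using integral_dilated_limit[OF \<kappa> _ u(4,3)] by (simp add: mult.commute)
  have "?I = (\<lambda>n. \<integral>\<xi>. \<gamma> (0 + (1 / real (Suc n)) *\<^sub>R \<xi>) * (exp (\<i> * of_real (\<xi> \<bullet> x)) * hat u \<xi>) \<partial>lborel)"
    by (rule ext, subst integral_hat_dilated[OF u(1) \<gamma>, symmetric]) (simp_all add: ac_simps)
  also have "\<dots> \<longlonglongrightarrow> \<gamma> 0 * (\<integral>\<xi>. exp (\<i> * of_real (\<xi> \<bullet> x)) * hat u \<xi> \<partial>lborel)"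
    by (rule integral_dilated_limit[OF _ _ \<gamma>b \<gamma>c])
       (use integrable_character_mult[OF u(2), of "-x"] in auto)
  finally show "?I \<longlonglongrightarrow> \<gamma> 0 * (\<integral>\<xi>. exp (\<i> * of_real (\<xi> \<bullet> x)) * hat u \<xi> \<partial>lborel)" .
qed

subsection \<open>Test functions and a smooth plateau\<close>

lemma Ck_SucI:
  assumes "\<And>x. (f has_derivative f' x) (at x)" "\<And>v. Ck k (\<lambda>x. f' x v)"
  shows "Ck (Suc k) f"
proof -
  have "frechet_derivative f (at x) = f' x" for x
    using frechet_derivative_at[OF assms(1)] by simp
  then show ?thesis using assms by (auto simp: differentiable_on_def differentiable_def)
qed

lemma Ck_SucD:
  assumes "Ck (Suc k) f"
  shows "(f has_derivative frechet_derivative f (at x)) (at x)" "Ck k (\<lambda>x. frechet_derivative f (at x) v)"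
  using assms frechet_derivative_works by (auto simp: differentiable_on_def)

lemma Ck_Suc_imp: "Ck (Suc k) f \<Longrightarrow> Ck k f"
proof (induction k arbitrary: f)
  case 0
  then show ?case by (auto intro: differentiable_imp_continuous_on)
next
  case (Suc k)
  show ?case
    using Suc.IH[OF Ck_SucD(2)[OF Suc.prems]] Ck_SucD(1)[OF Suc.prems] by (intro Ck_SucI)
qed

lemma Ck_continuous: "Ck k f \<Longrightarrow> continuous_on UNIV f"
  by (induction k) (auto intro: differentiable_imp_continuous_on)

lemma Ck_const [simp]: "Ck k (\<lambda>_. c)"
  by (induction k arbitrary: c) (auto intro!: Ck_SucI[where f'="\<lambda>_ _. 0"] simp del: Ck.simps(2))

lemma Ck_add: "Ck k f \<Longrightarrow> Ck k g \<Longrightarrow> Ck k (\<lambda>x. f x + g x)"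
proof (induction k arbitrary: f g)
  case 0 then show ?case by (auto intro: continuous_intros)
next
  case (Suc k)
  let ?f' = "\<lambda>x. frechet_derivative f (at x)"
  note f = Ck_SucD[OF Suc.prems(1)]
  let ?g' = "\<lambda>x. frechet_derivative g (at x)"
  note g = Ck_SucD[OF Suc.prems(2)]
  show ?case
    by (rule Ck_SucI[where f'="\<lambda>x v. ?f' x v + ?g' x v"]) (use f g Suc.IH in \<open>auto intro: derivative_intros\<close>)
qed

lemma Ck_mult: "Ck k f \<Longrightarrow> Ck k g \<Longrightarrow> Ck k (\<lambda>x. f x * g x)"
proof (induction k arbitrary: f g)
  case 0 then show ?case by (auto intro: continuous_intros)
next
  case (Suc k)
  let ?f' = "\<lambda>x. frechet_derivative f (at x)"
  note f = Ck_SucD[OF Suc.prems(1)]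
  let ?g' = "\<lambda>x. frechet_derivative g (at x)"
  note g = Ck_SucD[OF Suc.prems(2)]
  show ?case
  proof (rule Ck_SucI)
    show "((\<lambda>x. f x * g x) has_derivative (\<lambda>v. f x * ?g' x v + ?f' x v * g x)) (at x)" for x
      by (rule has_derivative_mult[OF f(1) g(1)])
    show "Ck k (\<lambda>x. f x * ?g' x v + ?f' x v * g x)" for v
      by (intro Ck_add Suc.IH[OF Ck_Suc_imp[OF Suc.prems(1)] g(2)] Suc.IH[OF f(2) Ck_Suc_imp[OF Suc.prems(2)]])
  qed
qed

lemma Ck_inverse: "Ck k f \<Longrightarrow> (\<And>x. f x \<noteq> 0) \<Longrightarrow> Ck k (\<lambda>x. inverse (f x))"
proof (induction k arbitrary: f)
  case 0 then show ?case by (auto intro: continuous_intros)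
next
  case (Suc k)
  let ?f' = "\<lambda>x. frechet_derivative f (at x)"
  note f = Ck_SucD[OF Suc.prems(1)]
  \<comment> \<open>The derivative of the inverse is built from the inverse itself and the
    derivative of \<open>f\<close>, so regularity of order k suffices to gain one more
    order.\<close>
  have i: "Ck k (\<lambda>x. inverse (f x))" using Suc Ck_Suc_imp by blast
  show ?case
  proof (rule Ck_SucI)
    show "((\<lambda>x. inverse (f x)) has_derivative (\<lambda>v. - (inverse (f x) * ?f' x v * inverse (f x)))) (at x)" for x
      by (rule Deriv.has_derivative_inverse) (use Suc.prems f in auto)
    have "Ck k (\<lambda>x. (- 1) * (inverse (f x) * ?f' x v * inverse (f x)))" for v
      by (intro Ck_mult Ck_const i f)
    then show "Ck k (\<lambda>x. - (inverse (f x) * ?f' x v * inverse (f x)))" for v by simp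
  qed
qed

lemma Ck_inner: "Ck k (\<lambda>x. complex_of_real (x \<bullet> v))"
proof (cases k)
  case (Suc j)
  show ?thesis unfolding Suc
    by (rule Ck_SucI[where f'="\<lambda>x h. complex_of_real (h \<bullet> v)"]) (auto intro!: derivative_eq_intros)
qed (auto intro: continuous_intros)

lemma Ck_affine: "Ck k f \<Longrightarrow> Ck k (\<lambda>x. f (a + c *\<^sub>R x))"
proof (induction k arbitrary: f)
  case 0
  show ?case using 0 by (auto intro!: continuous_intros intro: continuous_on_compose2[of UNIV f])
next
  case (Suc k)
  let ?f' = "\<lambda>x. frechet_derivative f (at x)"
  note f = Ck_SucD[OF Suc.prems(1)]
  show ?case
  proof (rule Ck_SucI)
    show "((\<lambda>x. f (a + c *\<^sub>R x)) has_derivative (\<lambda>v. ?f' (a + c *\<^sub>R x) (c *\<^sub>R v))) (at x)" for x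
      by (rule has_derivative_compose[OF _ f(1)]) (auto intro!: derivative_eq_intros)
  qed (use f Suc.IH in blast)
qed

section \<open>The smooth plateau\<close>

text \<open>The family p(1/t) exp(-1/t), extended by 0, is closed under differentiation. Carrying
  the polynomial along makes smoothness a plain induction without formulas for higher
  derivatives.\<close>

definition flat :: "real poly \<Rightarrow> real \<Rightarrow> real" where
  "flat p t = (if t > 0 then poly p (1 / t) * exp (- (1 / t)) else 0)"

lemma poly_div_exp_tendsto_0: "((\<lambda>s. poly p s / exp s) \<longlongrightarrow> (0::real)) at_top"
proof -
  have "((\<lambda>s. \<Sum>i\<le>degree p. coeff p i * (s ^ i / exp s)) \<longlongrightarrow> (\<Sum>i\<le>degree p. coeff p i * 0)) at_top"
    by (intro tendsto_intros tendsto_power_div_exp_0)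
  then show ?thesis by (simp add: poly_altdef sum_divide_distrib)
qed

text \<open>With s = 1/t, the derivative of p(s) exp(-s) in s is (p' - p)(s) exp(-s), and ds/dt =
  -s^2. At 0 the right difference quotient is s p(s) / exp(s), which tends to 0 as s grows.\<close>

lemma flat_has_derivative:
  "(flat p has_real_derivative flat ([:0, 0, 1:] * (p - pderiv p)) t) (at t)"
proof -
  consider "t > 0" | "t < 0" | "t = 0" by linarith
  then show ?thesis
  proof cases
    case 1
    have "((\<lambda>t. poly p (1 / t) * exp (- (1 / t))) has_real_derivative flat ([:0, 0, 1:] * (p - pderiv p)) t) (at t)"
      using 1 by (auto intro!: derivative_eq_intros DERIV_chain'[where g="poly p"] simp: flat_def field_simps power2_eq_square)
    then show ?thesis
      by (rule has_field_derivative_transform_within[where d=t]) (use 1 in \<open>auto simp: flat_def dist_real_def\<close>)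
  next
    case 2
    have "((\<lambda>t. 0) has_real_derivative flat ([:0, 0, 1:] * (p - pderiv p)) t) (at t)"
      using 2 by (auto simp: flat_def)
    then show ?thesis
      by (rule has_field_derivative_transform_within[where d="-t"]) (use 2 in \<open>auto simp: flat_def dist_real_def\<close>)
  next
    case 3
    have "((\<lambda>h. (1 / h) * poly p (1 / h) * exp (- (1 / h))) \<longlongrightarrow> 0) (at_right (0::real))"
    proof -
      have "((\<lambda>h. poly (pCons 0 p) (inverse h) / exp (inverse h)) \<longlongrightarrow> 0) (at_right (0::real))"
        by (rule filterlim_compose[OF poly_div_exp_tendsto_0 filterlim_inverse_at_top_right])
      then show ?thesis by (simp add: exp_minus field_simps)
    qed
    then have "((\<lambda>h. flat p h / h) \<longlongrightarrow> 0) (at_right 0)"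
      by (rule Lim_transform_eventually) (auto simp: flat_def eventually_at_right_less eventually_at_filter)
    moreover have "((\<lambda>h. flat p h / h) \<longlongrightarrow> 0) (at_left 0)"
      by (rule tendsto_eventually) (auto simp: flat_def eventually_at_filter)
    ultimately have "((\<lambda>h. flat p h / h) \<longlongrightarrow> 0) (at 0)" by (simp add: filterlim_split_at)
    then show ?thesis using 3 by (simp add: has_field_derivative_iff flat_def)
  qed
qed

text \<open>The argument uses \<open>x \<bullet> x\<close> because the norm is not differentiable at
  the origin. Each derivative is a linear factor times another \<open>flat\<close> of the same
  argument, hence the induction over all \<open>p\<close>.\<close>

lemma Ck_flat_quadratic: "Ck k (\<lambda>x. complex_of_real (flat p (a + b * (x \<bullet> x))))"
proof (induction k arbitrary: p)
  case 0
  have "continuous_on UNIV (flat p)" using flat_has_derivative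
    by (meson DERIV_isCont continuous_at_imp_continuous_on)
  then show ?case by (auto intro!: continuous_intros continuous_on_compose2[of UNIV "flat p"])
next
  case (Suc k)
  let ?q = "[:0, 0, 1:] * (p - pderiv p)"
  show ?case
  proof (rule Ck_SucI)
    fix x :: "real ^ 'a"
    have "((\<lambda>x::real^'a. flat p (a + b * (x \<bullet> x))) has_derivative (\<lambda>h. (b * (x \<bullet> h + h \<bullet> x)) * flat ?q (a + b * (x \<bullet> x)))) (at x)"
      by (rule has_derivative_compose[OF _ flat_has_derivative[unfolded has_field_derivative_def], THEN has_derivative_eq_rhs])
        (auto intro!: derivative_eq_intros simp: fun_eq_iff mult.commute)
    then have "((\<lambda>x. complex_of_real (flat p (a + b * (x \<bullet> x)))) has_derivative (\<lambda>h. complex_of_real ((b * (x \<bullet> h + h \<bullet> x)) * flat ?q (a + b * (x \<bullet> x))))) (at x)"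
      by (rule has_derivative_of_real)
    then show "((\<lambda>x. complex_of_real (flat p (a + b * (x \<bullet> x)))) has_derivative (\<lambda>h. complex_of_real (2 * b) * complex_of_real (x \<bullet> h) * complex_of_real (flat ?q (a + b * (x \<bullet> x))))) (at x)"
      by (simp add: inner_commute algebra_simps flip: mult_2)
  qed (intro Ck_mult Ck_const Ck_inner Suc)
qed

text \<open>One summand is positive exactly for norm below 2, the other exactly for norm above 1, so
  the sum never vanishes, and the quotient of the first summand by it is a smooth cutoff between the
  two radii.\<close>

definition plateau_den :: "real ^ 'n \<Rightarrow> real" where
  "plateau_den x = flat 1 (4 - x \<bullet> x) + flat 1 (x \<bullet> x - 1)"

definition plateau :: "real ^ 'n \<Rightarrow> real" where
  "plateau x = flat 1 (4 - x \<bullet> x) / plateau_den x"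

lemma flat_1_nonneg: "flat 1 t \<ge> 0" and flat_1_pos_iff: "flat 1 t > 0 \<longleftrightarrow> t > 0"
  by (auto simp: flat_def)

lemma plateau_den_pos: "plateau_den x > 0"
  using flat_1_nonneg[of "4 - x \<bullet> x"] flat_1_nonneg[of "x \<bullet> x - 1"] flat_1_pos_iff[of "4 - x \<bullet> x"] flat_1_pos_iff[of "x \<bullet> x - 1"]
  unfolding plateau_den_def by (smt (verit))

lemma plateau_eq_1: "norm x \<le> 1 \<Longrightarrow> plateau x = 1"
proof -
  assume "norm x \<le> 1"
  then have "x \<bullet> x \<le> 1" by (simp add: dot_square_norm power_le_one)
  then show ?thesis using plateau_den_pos[of x] by (simp add: plateau_def plateau_den_def flat_def)
qed

lemma plateau_eq_0: "norm x \<ge> 2 \<Longrightarrow> plateau x = 0"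
proof -
  assume "norm x \<ge> 2"
  then have "2^2 \<le> (norm x)^2" by (intro power_mono) auto
  then show ?thesis by (simp add: plateau_def flat_def dot_square_norm)
qed

lemma plateau_nonneg: "plateau x \<ge> 0" and plateau_le_1: "plateau x \<le> 1"
  using plateau_den_pos[of x] flat_1_nonneg[of "4 - x \<bullet> x"] flat_1_nonneg[of "x \<bullet> x - 1"]
  by (auto simp: plateau_def plateau_den_def divide_le_eq)

lemma plateau_minus [simp]: "plateau (- x) = plateau x"
  by (simp add: plateau_def plateau_den_def)

section \<open>Test functions and their derivatives\<close>

lemma test_fun_iff: "test_fun \<phi> \<longleftrightarrow> (\<forall>k. Ck k \<phi>) \<and> (\<exists>R. \<forall>x. norm x > R \<longrightarrow> \<phi> x = 0)"
proof -
  have "compact (closure {x. \<phi> x \<noteq> 0}) \<longleftrightarrow> bounded {x. \<phi> x \<noteq> 0}"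
    by (metis bounded_closure_image bounded_closure bounded_subset closure_subset compact_closure)
  also have "\<dots> \<longleftrightarrow> (\<exists>R. \<forall>x. norm x > R \<longrightarrow> \<phi> x = 0)"
    by (metis (mono_tags, lifting) bounded_iff linorder_not_less mem_Collect_eq)
  finally show ?thesis by (simp add: test_fun_def smooth_fun_def)
qed

lemma test_fun_Ck: "test_fun \<phi> \<Longrightarrow> Ck k \<phi>"
  by (simp add: test_fun_iff)

lemma test_fun_supportE:
  assumes "test_fun \<phi>" obtains R where "R > 0" "\<And>x. norm x > R \<Longrightarrow> \<phi> x = 0"
proof -
  obtain R where "\<And>x. norm x > R \<Longrightarrow> \<phi> x = 0" using assms by (auto simp: test_fun_iff)
  then have "\<And>x. norm x > max R 1 \<Longrightarrow> \<phi> x = 0" by simp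
  then show thesis using that[of "max R 1"] by auto
qed

lemma test_fun_plateau: "test_fun (\<lambda>x :: real ^ 'n. complex_of_real (plateau x))"
  unfolding test_fun_iff
proof (intro conjI allI exI[of _ 2] impI)
  fix k
  have 1: "Ck k (\<lambda>x::real^'n. complex_of_real (flat 1 (4 - x \<bullet> x)))" using Ck_flat_quadratic[of k 1 4 "-1"] by simp
  have 2: "Ck k (\<lambda>x::real^'n. complex_of_real (flat 1 (x \<bullet> x - 1)))" using Ck_flat_quadratic[of k 1 "-1" 1] by simp
  have "Ck k (\<lambda>x::real^'n. complex_of_real (flat 1 (4 - x \<bullet> x)) * inverse (complex_of_real (flat 1 (4 - x \<bullet> x)) + complex_of_real (flat 1 (x \<bullet> x - 1))))"
  proof (intro Ck_mult Ck_inverse Ck_add 1 2)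
    fix x :: "real ^ 'n"
    show "complex_of_real (flat 1 (4 - x \<bullet> x)) + complex_of_real (flat 1 (x \<bullet> x - 1)) \<noteq> 0"
      using plateau_den_pos[of x] unfolding plateau_den_def of_real_add[symmetric] by (metis of_real_eq_0_iff less_irrefl)
  qed
  then show "Ck k (\<lambda>x::real^'n. complex_of_real (plateau x))"
    by (simp add: plateau_def plateau_den_def divide_inverse)
qed (simp add: plateau_eq_0)

lemma test_fun_affine:
  assumes "test_fun \<phi>" "c \<noteq> 0" shows "test_fun (\<lambda>x. \<phi> (a + c *\<^sub>R x))"
proof -
  obtain R where R: "\<And>x. norm x > R \<Longrightarrow> \<phi> x = 0" using assms by (auto simp: test_fun_iff)
  have "\<phi> (a + c *\<^sub>R x) = 0" if x: "norm x > (R + norm a) / \<bar>c\<bar>" for x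
  proof (rule R)
    have "R + norm a < norm (c *\<^sub>R x)" using x assms(2) by (simp add: field_simps)
    also have "\<dots> \<le> norm (a + c *\<^sub>R x) + norm a" using norm_triangle_ineq4[of "a + c *\<^sub>R x" a] by simp
    finally show "R < norm (a + c *\<^sub>R x)" by simp
  qed
  then show ?thesis using assms(1) Ck_affine unfolding test_fun_iff by blast
qed

lemma test_fun_deriv:
  fixes \<phi> :: "real ^ 'n \<Rightarrow> complex"
  assumes "test_fun \<phi>" shows "test_fun (\<lambda>x. frechet_derivative \<phi> (at x) v)"
  unfolding test_fun_iff
proof -
  obtain R where R: "\<And>x. norm x > R \<Longrightarrow> \<phi> x = 0" using assms by (auto simp: test_fun_iff)
  have "Ck k (\<lambda>x. frechet_derivative \<phi> (at x) v)" for k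
    using Ck_SucD(2)[OF test_fun_Ck[OF assms]] .
  moreover have "frechet_derivative \<phi> (at x) v = 0" if x: "norm x > R" for x
  proof -
  have "((\<lambda>_. 0) has_derivative (\<lambda>_. 0)) (at x)" by simp
  then have "(\<phi> has_derivative (\<lambda>_. 0)) (at x)"
  proof (rule has_derivative_transform_within_open)
    show "open {x. norm x > R}" by (intro open_Collect_less continuous_intros)
  qed (use R x in auto)
  from frechet_derivative_at[OF this] show "frechet_derivative \<phi> (at x) v = 0" by metis
  qed
  ultimately show "(\<forall>k. Ck k (\<lambda>x. frechet_derivative \<phi> (at x) v)) \<and> (\<exists>R. \<forall>x. norm x > R \<longrightarrow> frechet_derivative \<phi> (at x) v = 0)" by blast
qed

lemma test_fun_continuous: "test_fun \<phi> \<Longrightarrow> continuous_on UNIV \<phi>"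
  using Ck_continuous test_fun_Ck by blast

lemma test_fun_measurable [measurable_dest]: "test_fun \<phi> \<Longrightarrow> \<phi> \<in> borel_measurable borel"
  by (intro borel_measurable_continuous_onI test_fun_continuous)

lemma test_fun_wint: assumes "test_fun \<phi>" shows "wint \<beta> \<phi>"
proof -
  obtain R where R: "\<And>x. norm x > R \<Longrightarrow> \<phi> x = 0" using assms by (auto simp: test_fun_iff)
  have "integrable lborel (\<lambda>x. indicator (cball 0 R) x *\<^sub>R (wt \<beta> x * norm (\<phi> x)))"
    by (intro borel_integrable_compact continuous_intros continuous_on_subset[OF test_fun_continuous[OF assms]]) auto
  also have "(\<lambda>x. indicator (cball 0 R) x *\<^sub>R (wt \<beta> x * norm (\<phi> x))) = (\<lambda>x. wt \<beta> x * norm (\<phi> x))"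
    using R by (force simp: indicator_def)
  finally show ?thesis using assms by (auto simp: wint_def)
qed

lemma test_fun_integrable: "test_fun \<phi> \<Longrightarrow> integrable lborel \<phi>"
  using test_fun_wint[of \<phi> 0] by (simp add: wint_0_iff)

lemma test_fun_boundedE:
  assumes "test_fun \<phi>" obtains M where "M > 0" "\<And>x. norm (\<phi> x) \<le> M"
proof -
  obtain R where R: "\<And>x. norm x > R \<Longrightarrow> \<phi> x = 0" using assms by (auto simp: test_fun_iff)
  have "compact (\<phi> ` cball 0 R)"
    by (intro compact_continuous_image continuous_on_subset[OF test_fun_continuous[OF assms]]) auto
  then obtain M where M: "M > 0" "\<And>x. x \<in> cball 0 R \<Longrightarrow> norm (\<phi> x) \<le> M"
    by (auto dest!: compact_imp_bounded simp: bounded_pos)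
  then have "norm (\<phi> x) \<le> M" for x using R[of x] by (cases "norm x \<le> R") auto
  then show thesis using that M by blast
qed

lemma has_vector_derivative_bound:
  fixes f :: "real \<Rightarrow> complex"
  assumes "\<And>t. (f has_vector_derivative g t) (at t)" "\<And>t. norm (g t) \<le> B"
  shows "norm (f b - f a) \<le> B * \<bar>b - a\<bar>"
proof -
  have "norm (f b - f a) \<le> B * norm (b - a)"
  proof (rule differentiable_bound[OF convex_UNIV, where f'="\<lambda>t h. h *\<^sub>R g t"])
    show "(f has_derivative (\<lambda>h. h *\<^sub>R g t)) (at t)" for t
      using assms(1) by (simp add: has_vector_derivative_def)
    show "onorm (\<lambda>h. h *\<^sub>R g t) \<le> B" for t
      by (intro onorm_le) (simp add: mult.commute[of B] mult_left_mono assms(2))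
  qed auto
  then show ?thesis by simp
qed

lemma Ck_has_vector_derivative:
  assumes "Ck (Suc k) f"
  shows "((\<lambda>t. f (x + t *\<^sub>R v)) has_vector_derivative frechet_derivative f (at (x + t *\<^sub>R v)) v) (at t)"
proof -
  have l: "linear (frechet_derivative f (at (x + t *\<^sub>R v)))"
    using Ck_SucD(1)[OF assms] has_derivative_linear by blast
  have "((\<lambda>t. f (x + t *\<^sub>R v)) has_derivative (\<lambda>h. frechet_derivative f (at (x + t *\<^sub>R v)) (h *\<^sub>R v))) (at t)"
    by (rule has_derivative_compose[OF _ Ck_SucD(1)[OF assms]]) (auto intro!: derivative_eq_intros)
  then show ?thesis by (simp add: has_vector_derivative_def linear_cmul[OF l])
qed

text \<open>Difference quotients replace integration by parts: their transforms are known exactly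
  from translation, and they converge under an integrable bound.\<close>

lemma hat_deriv:
  assumes \<phi>: "test_fun \<phi>"
  shows "hat (\<lambda>x. frechet_derivative \<phi> (at x) v) \<xi> = \<i> * of_real (v \<bullet> \<xi>) * hat \<phi> \<xi>"
proof (rule LIMSEQ_unique)
  let ?d = "\<lambda>x. frechet_derivative \<phi> (at x) v"
  note d = test_fun_deriv[OF \<phi>, of v]
  note [measurable] = test_fun_measurable[OF \<phi>] test_fun_measurable[OF d]
  obtain M where M: "M > 0" "\<And>x. norm (?d x) \<le> M" using test_fun_boundedE[OF d] by blast
  obtain R where R: "R > 0" "\<And>x. norm x > R \<Longrightarrow> \<phi> x = 0" using test_fun_supportE[OF \<phi>] by blast
  define s where "s n = 1 / real (Suc n)" for n
  have s: "s n > 0" "s n \<le> 1" for n by (auto simp: s_def)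
  have s0: "s \<longlonglongrightarrow> 0" unfolding s_def by (rule lim_1_over_n[THEN LIMSEQ_Suc])
  have s0': "filterlim s (at 0) sequentially" using s0 s(1) by (auto simp: filterlim_at less_imp_neq[THEN not_sym])
  define D where "D n x = (\<phi> (x + s n *\<^sub>R v) - \<phi> x) / complex_of_real (s n)" for n x
  have der: "((\<lambda>t. \<phi> (x + t *\<^sub>R v)) has_vector_derivative ?d (x + t *\<^sub>R v)) (at t)" for x t
    by (rule Ck_has_vector_derivative[OF test_fun_Ck[OF \<phi>]])
  have Dlim: "(\<lambda>n. D n x) \<longlonglongrightarrow> ?d x" for x
  proof -
    have "((\<lambda>t. (\<phi> (x + t *\<^sub>R v) - \<phi> x) /\<^sub>R t) \<longlongrightarrow> ?d x) (at 0)"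
    proof (rule LIM_zero_cancel, rule tendsto_norm_zero_cancel)
      have "((\<lambda>t. norm (\<phi> (x + t *\<^sub>R v) - \<phi> x - t *\<^sub>R ?d x) / norm t) \<longlongrightarrow> 0) (at 0)"
        using der[of x 0] by (simp add: has_vector_derivative_def has_derivative_at)
      then show "((\<lambda>t. norm ((\<phi> (x + t *\<^sub>R v) - \<phi> x) /\<^sub>R t - ?d x)) \<longlongrightarrow> 0) (at 0)"
      proof (rule Lim_transform_eventually)
        have "norm (\<phi> (x + t *\<^sub>R v) - \<phi> x - t *\<^sub>R ?d x) / norm t = norm ((\<phi> (x + t *\<^sub>R v) - \<phi> x) /\<^sub>R t - ?d x)" if "t \<noteq> 0" for t
        proof -
          have "(\<phi> (x + t *\<^sub>R v) - \<phi> x) /\<^sub>R t - ?d x = (\<phi> (x + t *\<^sub>R v) - \<phi> x - t *\<^sub>R ?d x) /\<^sub>R t"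
            using that by (simp add: scaleR_diff_right)
          then show ?thesis by (simp add: divide_inverse mult.commute)
        qed
        then show "\<forall>\<^sub>F t in at 0. norm (\<phi> (x + t *\<^sub>R v) - \<phi> x - t *\<^sub>R ?d x) / norm t = norm ((\<phi> (x + t *\<^sub>R v) - \<phi> x) /\<^sub>R t - ?d x)"
          by (auto simp: eventually_at_filter)
      qed
    qed
    from filterlim_compose[OF this s0'] show ?thesis
      by (simp add: D_def scaleR_conv_of_real divide_inverse mult.commute)
  qed
  \<comment> \<open>The mean value inequality supplies \<open>M\<close>. Since the steps
    \<open>s n\<close> are at most 1, both \<open>x\<close> and the shifted point leave the support
    once the norm exceeds \<open>R + norm v\<close>.\<close>
  have Db: "norm (D n x) \<le> M * indicator (cball 0 (R + norm v)) x" for n x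
  proof (cases "norm x \<le> R + norm v")
    case True
    have "norm (\<phi> (x + s n *\<^sub>R v) - \<phi> (x + 0 *\<^sub>R v)) \<le> M * \<bar>s n - 0\<bar>"
      by (rule has_vector_derivative_bound[OF der M(2)])
    then show ?thesis using True s[of n] by (simp add: D_def norm_divide divide_le_eq)
  next
    case False
    then have 1: "\<phi> x = 0" by (intro R) (use norm_ge_zero[of v] in linarith)
    have "norm x \<le> norm (x + s n *\<^sub>R v) + norm (s n *\<^sub>R v)" using norm_triangle_ineq4[of "x + s n *\<^sub>R v" "s n *\<^sub>R v"] by simp
    also have "norm (s n *\<^sub>R v) \<le> norm v" using s[of n] by (simp add: mult_left_le_one_le)
    finally have 2: "\<phi> (x + s n *\<^sub>R v) = 0" using False by (intro R) linarith
    show ?thesis using M 1 2 by (simp add: D_def indicator_def)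
  qed
  have [measurable]: "D n \<in> borel_measurable borel" for n unfolding D_def by measurable
  show "(\<lambda>n. hat (D n) \<xi>) \<longlonglongrightarrow> hat ?d \<xi>"
    unfolding hat_def
  proof (rule integral_dominated_convergence[where w="\<lambda>x. M * indicator (cball 0 (R + norm v)) x"])
    show "integrable lborel (\<lambda>x. M * indicator (cball 0 (R + norm v)) x)"
      by (intro integrable_mult_right integrable_real_indicator) (use emeasure_bounded_finite[OF bounded_cball] in auto)
    show "AE x in lborel. (\<lambda>n. exp (- \<i> * of_real (x \<bullet> \<xi>)) * D n x) \<longlonglongrightarrow> exp (- \<i> * of_real (x \<bullet> \<xi>)) * ?d x"
      by (intro AE_I2 tendsto_mult Dlim tendsto_const)
  qed (use Db in \<open>auto simp: norm_mult\<close>)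
  have "hat (D n) \<xi> = (exp (\<i> * of_real (v \<bullet> \<xi>) * complex_of_real (s n)) - 1) / complex_of_real (s n) * hat \<phi> \<xi>" for n
  proof -
    have i: "integrable lborel (\<lambda>x. \<phi> (s n *\<^sub>R v + x))"
      using test_fun_integrable[OF \<phi>] by (simp add: integrable_lborel_translate_iff)
    have "hat (D n) \<xi> = hat (\<lambda>x. inverse (complex_of_real (s n)) * (\<phi> (s n *\<^sub>R v + x) - \<phi> x)) \<xi>"
      by (simp add: D_def[abs_def] divide_inverse ac_simps)
    also have "\<dots> = inverse (complex_of_real (s n)) * (exp (\<i> * of_real ((s n *\<^sub>R v) \<bullet> \<xi>)) * hat \<phi> \<xi> - hat \<phi> \<xi>)"
      by (simp only: hat_cmult hat_diff[OF i test_fun_integrable[OF \<phi>]] hat_translate)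
    finally show ?thesis by (simp add: field_simps)
  qed
  moreover have "(\<lambda>n. (exp (\<i> * of_real (v \<bullet> \<xi>) * complex_of_real (s n)) - 1) / complex_of_real (s n)) \<longlonglongrightarrow> \<i> * of_real (v \<bullet> \<xi>)"
  proof -
    have "((\<lambda>z. exp (\<i> * of_real (v \<bullet> \<xi>) * z)) has_field_derivative \<i> * of_real (v \<bullet> \<xi>)) (at 0)"
      by (auto intro!: derivative_eq_intros)
    then have "((\<lambda>z. (exp (\<i> * of_real (v \<bullet> \<xi>) * z) - 1) / z) \<longlongrightarrow> \<i> * of_real (v \<bullet> \<xi>)) (at 0)"
      by (simp add: has_field_derivative_iff)
    moreover have "filterlim (\<lambda>n. complex_of_real (s n)) (at 0) sequentially"
      using tendsto_of_real[OF s0, where 'a=complex] s(1) by (auto simp: filterlim_at less_imp_neq[THEN not_sym])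
    ultimately show ?thesis by (rule filterlim_compose)
  qed
  ultimately show "(\<lambda>n. hat (D n) \<xi>) \<longlonglongrightarrow> \<i> * of_real (v \<bullet> \<xi>) * hat \<phi> \<xi>"
    by (simp only: tendsto_mult tendsto_const)
qed

subsection \<open>A rapidly decreasing kernel with compactly supported Fourier transform\<close>

definition rapid :: "('a::euclidean_space \<Rightarrow> complex) \<Rightarrow> bool" where
  "rapid w \<longleftrightarrow> continuous_on UNIV w \<and> (\<forall>N. \<exists>C. \<forall>x. (1 + norm x) ^ N * norm (w x) \<le> C)"

text \<open>Where the integer part of the norm is k, the weight is at most (k+1)^(-n-2), and this is
  charged to a whole ball of volume proportional to (k+1)^n instead of a shell. The exponent n + 2
  leaves the convergent series of inverse squares.\<close>

lemma integrable_wt_neg: "integrable lborel (wt (- real (DIM('a) + 2)) :: 'a::euclidean_space \<Rightarrow> real)"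
proof (rule integrableI_bounded)
  let ?n = "DIM('a)" and ?w = "wt (- real (DIM('a) + 2)) :: 'a \<Rightarrow> real"
  let ?V = "measure lborel (ball (0::'a) 1)"
  have [measurable]: "ball (0::'a) r \<in> sets borel" for r by simp
  have le: "ennreal (?w x) \<le> (\<Sum>k. ennreal (1 / real (Suc k) ^ (?n + 2)) * indicator (ball (0::'a) (2 * real (Suc k))) x)" for x
  proof -
    define k where "k = nat \<lfloor>norm x\<rfloor>"
    have k: "real k \<le> norm x" "norm x < real (Suc k)" unfolding k_def by (auto simp: of_nat_nat) linarith
    have "?w x = inverse ((1 + norm x) ^ (?n + 2))"
      using wt_of_nat[of "?n + 2" x] by (simp only: wt_def powr_minus)
    also have "\<dots> \<le> 1 / real (Suc k) ^ (?n + 2)"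
      unfolding inverse_eq_divide[symmetric] by (intro le_imp_inverse_le power_mono zero_less_power) (use k in auto)
    finally have "ennreal (?w x) \<le> ennreal (1 / real (Suc k) ^ (?n + 2)) * indicator (ball (0::'a) (2 * real (Suc k))) x"
      using k by (auto simp: indicator_def intro!: ennreal_leI)
    also have "\<dots> \<le> (\<Sum>k. ennreal (1 / real (Suc k) ^ (?n + 2)) * indicator (ball (0::'a) (2 * real (Suc k))) x)" (is "?F k \<le> suminf ?F")
    proof -
      have "sum ?F {k} \<le> suminf ?F" by (intro sum_le_suminf summableI) auto
      then show ?thesis by (simp only: sum.insert[OF finite.emptyI] sum.empty empty_iff not_False_eq_True add_0_right)
    qed
    finally show ?thesis .
  qed
  have "(\<integral>\<^sup>+x. ennreal (norm (?w x)) \<partial>lborel) \<le> (\<integral>\<^sup>+x. (\<Sum>k. ennreal (1 / real (Suc k) ^ (?n + 2)) * indicator (ball (0::'a) (2 * real (Suc k))) x) \<partial>lborel)"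
    using le by (intro nn_integral_mono) simp
  also have "\<dots> = (\<Sum>k. ennreal (1 / real (Suc k) ^ (?n + 2)) * emeasure lborel (ball (0::'a) (2 * real (Suc k))))"
  proof (subst nn_integral_suminf)
    show "(\<Sum>i. \<integral>\<^sup>+x. ennreal (1 / real (Suc i) ^ (?n + 2)) * indicator (ball (0::'a) (2 * real (Suc i))) x \<partial>lborel)
      = (\<Sum>k. ennreal (1 / real (Suc k) ^ (?n + 2)) * emeasure lborel (ball (0::'a) (2 * real (Suc k))))"
      by (subst nn_integral_cmult_indicator) (rule sets_lborel[THEN equalityD2, THEN subsetD], rule borel_open, rule open_ball, rule refl)
  qed simp
  also have "\<dots> = (\<Sum>k. ennreal (?V * 2 ^ ?n * inverse (real (Suc k) ^ 2)))"
  proof (rule suminf_cong)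
    fix k
    have "emeasure lborel (ball (0::'a) (2 * real (Suc k))) = ennreal (measure lborel (ball (0::'a) (2 * real (Suc k))))"
      using emeasure_bounded_finite[OF bounded_ball[of "0::'a" "2 * real (Suc k)"]] by (intro emeasure_eq_ennreal_measure) simp
    also have "measure lborel (ball (0::'a) (2 * real (Suc k))) = (2 * real (Suc k)) ^ ?n * ?V"
      using content_ball_conv_unit_ball[of "2 * real (Suc k)" "0::'a"] by simp
    finally have "ennreal (1 / real (Suc k) ^ (?n + 2)) * emeasure lborel (ball (0::'a) (2 * real (Suc k)))
      = ennreal (1 / real (Suc k) ^ (?n + 2) * ((2 * real (Suc k)) ^ ?n * ?V))"
      by (subst ennreal_mult) auto
    also have "1 / real (Suc k) ^ (?n + 2) * ((2 * real (Suc k)) ^ ?n * ?V) = ?V * 2 ^ ?n * inverse (real (Suc k) ^ 2)"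
      by (simp add: power_mult_distrib power_add power2_eq_square field_simps del: of_nat_Suc)
    finally show "ennreal (1 / real (Suc k) ^ (?n + 2)) * emeasure lborel (ball (0::'a) (2 * real (Suc k)))
      = ennreal (?V * 2 ^ ?n * inverse (real (Suc k) ^ 2))" .
  qed
  also have "\<dots> < \<infinity>"
  proof -
    have "summable (\<lambda>k. inverse (real k ^ 2))" by (rule inverse_power_summable) simp
    then have "summable (\<lambda>k. ?V * 2 ^ ?n * inverse (real (Suc k) ^ 2))"
      by (intro summable_mult) (subst summable_Suc_iff)
    then show ?thesis by (subst suminf_ennreal2) auto
  qed
  finally show "(\<integral>\<^sup>+x. ennreal (norm (?w x)) \<partial>lborel) < \<infinity>" .
qed measurable

lemma rapid_bound_wt:
  assumes "rapid w"
  obtains C where "\<And>x. norm (w x) \<le> C * wt (- r) x"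
proof -
  define N where "N = nat \<lceil>r\<rceil>"
  obtain C where C: "\<And>x. (1 + norm x) ^ N * norm (w x) \<le> C" using assms unfolding rapid_def by blast
  have "norm (w x) \<le> C * wt (- r) x" for x
  proof -
    have "wt r x \<le> (1 + norm x) ^ N"
      unfolding wt_of_nat[symmetric] by (intro wt_mono_exp) (auto simp: N_def of_nat_nat real_nat_ceiling_ge)
    then have "wt r x * norm (w x) \<le> C" using C[of x] by (meson mult_right_mono norm_ge_zero order_trans)
    then show ?thesis using wt_pos[of r x] by (simp add: wt_def powr_minus field_simps)
  qed
  then show thesis using that by blast
qed

lemma rapid_wint: assumes "rapid w" shows "wint \<beta> w"
proof -
  have [measurable]: "w \<in> borel_measurable borel"
    using assms by (auto simp: rapid_def intro: borel_measurable_continuous_onI)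
  obtain C where C: "\<And>x. norm (w x) \<le> C * wt (- (\<beta> + (DIM('a) + 2))) x"
    using rapid_bound_wt[OF assms] by blast
  have "integrable lborel (\<lambda>x. wt \<beta> x * norm (w x))"
  proof (rule integrable_boundI[where f="\<lambda>x. C * wt (- real (DIM('a) + 2)) x"])
    fix x
    have "wt \<beta> x * norm (w x) \<le> wt \<beta> x * (C * wt (- (\<beta> + (DIM('a) + 2))) x)"
      by (intro mult_left_mono C) simp
    also have "\<dots> = C * (wt \<beta> x * wt (- (\<beta> + (DIM('a) + 2))) x)" by simp
    also have "wt \<beta> x * wt (- (\<beta> + (DIM('a) + 2))) x = wt (- real (DIM('a) + 2)) x"
      by (simp add: wt_def flip: powr_add)
    finally show "norm (wt \<beta> x * norm (w x)) \<le> C * wt (- real (DIM('a) + 2)) x" by simp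
  qed (use integrable_wt_neg in auto)
  then show ?thesis by (simp add: wint_def)
qed

section \<open>Decay and regularity of transforms of test functions\<close>

lemma norm_hat_le_derivs:
  fixes \<phi> :: "real ^ 'n \<Rightarrow> complex"
  assumes "test_fun \<phi>"
  shows "(1 + norm x) * norm (hat \<phi> x) \<le> norm (hat \<phi> x) + (\<Sum>b\<in>Basis. norm (hat (\<lambda>x. frechet_derivative \<phi> (at x) b) x))"
proof -
  have "(1 + norm x) * norm (hat \<phi> x) \<le> (1 + (\<Sum>b\<in>Basis. \<bar>x \<bullet> b\<bar>)) * norm (hat \<phi> x)"
    using norm_le_l1[of x] by (intro mult_right_mono) auto
  then show ?thesis
    by (simp add: hat_deriv[OF assms] norm_mult distrib_right sum_distrib_right inner_commute)
qed

text \<open>Each factor \<open>1 + norm x\<close> is bounded by the sum of the coordinates and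
  traded for first derivatives by \<open>hat_deriv\<close>. These are test functions again, so the
  induction runs over all test functions.\<close>

lemma hat_test_fun_decay:
  fixes \<phi> :: "real ^ 'n \<Rightarrow> complex"
  assumes "test_fun \<phi>"
  shows "\<exists>C. \<forall>x. (1 + norm x) ^ N * norm (hat \<phi> x) \<le> C"
  using assms
proof (induction N arbitrary: \<phi>)
  case 0
  then show ?case using norm_hat_le by auto
next
  case (Suc N)
  obtain C where C: "\<And>x. (1 + norm x) ^ N * norm (hat \<phi> x) \<le> C" using Suc by blast
  have "\<forall>b. \<exists>C. \<forall>x. (1 + norm x) ^ N * norm (hat (\<lambda>x. frechet_derivative \<phi> (at x) b) x) \<le> C"
    using Suc.IH[OF test_fun_deriv[OF Suc.prems]] by blast
  then obtain D where D: "\<And>b x. (1 + norm x) ^ N * norm (hat (\<lambda>x. frechet_derivative \<phi> (at x) b) x) \<le> D b" by metis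
  have "(1 + norm x) ^ Suc N * norm (hat \<phi> x) \<le> C + (\<Sum>b\<in>Basis. D b)" for x
  proof -
    have "(1 + norm x) ^ Suc N * norm (hat \<phi> x) = (1 + norm x) ^ N * ((1 + norm x) * norm (hat \<phi> x))" by simp
    also have "\<dots> \<le> (1 + norm x) ^ N * (norm (hat \<phi> x) + (\<Sum>b\<in>Basis. norm (hat (\<lambda>x. frechet_derivative \<phi> (at x) b) x)))"
      by (intro mult_left_mono norm_hat_le_derivs Suc.prems) auto
    also have "\<dots> \<le> C + (\<Sum>b\<in>Basis. D b)"
      unfolding distrib_left sum_distrib_left by (intro add_mono sum_mono C D)
    finally show ?thesis .
  qed
  then show ?case by blast
qed

lemma rapid_hat_test_fun: "test_fun \<phi> \<Longrightarrow> rapid (hat \<phi>)"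
  using hat_test_fun_decay continuous_hat[OF test_fun_integrable] by (auto simp: rapid_def)

text \<open>Proved without differentiating under the integral: multiplying the increment of \<open>hat \<phi>\<close> by \<open>b \<bullet> x\<close>
  turns it into the increment of the transform of a derivative of \<open>\<phi>\<close>, up to \<open>(b \<bullet> h) hat \<phi> (x + h)\<close>.\<close>

lemma hat_test_fun_lipschitz:
  fixes \<phi> :: "real ^ 'n \<Rightarrow> complex"
  assumes "test_fun \<phi>"
  shows "\<exists>C. \<forall>x h. norm h \<le> 1 \<longrightarrow> (1 + norm x) ^ N * norm (hat \<phi> (x + h) - hat \<phi> x) \<le> C * norm h"
  using assms
proof (induction N arbitrary: \<phi>)
  case 0
  note [measurable] = test_fun_measurable[OF 0]
  have i: "integrable lborel (\<lambda>y. norm y * norm (\<phi> y))"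
    by (rule integrable_boundI[OF wint_integrable_wt[OF test_fun_wint[OF 0, of 1]]])
       (auto simp: wt_def intro!: mult_right_mono)
  have "norm (hat \<phi> (x + h) - hat \<phi> x) \<le> (\<integral>y. norm y * norm (\<phi> y) \<partial>lborel) * norm h" for x h
  proof -
    have ei: "integrable lborel (\<lambda>y. exp (- \<i> * of_real (y \<bullet> \<xi>)) * \<phi> y)" for \<xi>
      by (rule integrable_character_mult[OF test_fun_integrable[OF 0]])
    have "norm (hat \<phi> (x + h) - hat \<phi> x) \<le> (\<integral>y. norm (exp (- \<i> * of_real (y \<bullet> (x + h))) * \<phi> y - exp (- \<i> * of_real (y \<bullet> x)) * \<phi> y) \<partial>lborel)"
      unfolding hat_def Bochner_Integration.integral_diff[OF ei ei, symmetric] by (rule integral_norm_bound)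
    also have "\<dots> \<le> (\<integral>y. norm y * norm (\<phi> y) * norm h \<partial>lborel)"
    proof (intro integral_mono)
      fix y
      have "exp (- \<i> * of_real (y \<bullet> (x + h))) * \<phi> y - exp (- \<i> * of_real (y \<bullet> x)) * \<phi> y
        = exp (- \<i> * of_real (y \<bullet> x)) * (exp (\<i> * of_real (- (y \<bullet> h))) - 1) * \<phi> y"
        by (simp add: inner_add_right algebra_simps exp_diff exp_minus divide_inverse)
      also have "norm \<dots> = 2 * \<bar>sin (- (y \<bullet> h) / 2)\<bar> * norm (\<phi> y)"
        by (simp only: norm_mult dist_exp_i_1) simp
      also have "\<dots> \<le> 2 * \<bar>- (y \<bullet> h) / 2\<bar> * norm (\<phi> y)"
        by (intro mult_right_mono mult_left_mono abs_sin_x_le_abs_x) auto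
      also have "\<dots> \<le> (norm y * norm h) * norm (\<phi> y)"
        using Cauchy_Schwarz_ineq2[of y h] by (intro mult_right_mono) auto
      finally show "norm (exp (- \<i> * of_real (y \<bullet> (x + h))) * \<phi> y - exp (- \<i> * of_real (y \<bullet> x)) * \<phi> y)
         \<le> norm y * norm (\<phi> y) * norm h" by (simp add: ac_simps)
    qed (use ei i in auto)
    finally show ?thesis by simp
  qed
  then show ?case by auto
next
  case (Suc N)
  let ?d = "\<lambda>b x. frechet_derivative \<phi> (at x) b"
  let ?D = "\<lambda>f x h. hat f (x + h) - hat f x"
  obtain C where C: "\<And>x h. norm h \<le> 1 \<Longrightarrow> (1 + norm x) ^ N * norm (?D \<phi> x h) \<le> C * norm h" using Suc by blast
  have "\<forall>b. \<exists>C. \<forall>x h. norm h \<le> 1 \<longrightarrow> (1 + norm x) ^ N * norm (?D (?d b) x h) \<le> C * norm h"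
    using Suc.IH[OF test_fun_deriv[OF Suc.prems]] by blast
  then obtain D where D: "\<And>b x h. norm h \<le> 1 \<Longrightarrow> (1 + norm x) ^ N * norm (?D (?d b) x h) \<le> D b * norm h" by metis
  obtain E where E: "\<And>x. (1 + norm x) ^ N * norm (hat \<phi> x) \<le> E" using hat_test_fun_decay[OF Suc.prems] by blast
  \<comment> \<open>An increment of length at most 1 changes \<open>1 + norm x\<close> by at most
    the factor 2.\<close>
  have E': "(1 + norm x) ^ N * norm (hat \<phi> (x + h)) \<le> 2 ^ N * E" if "norm h \<le> 1" for x h
  proof -
    have "norm x \<le> norm (x + h) + norm h" using norm_triangle_ineq4[of "x + h" h] by simp
    then have "1 + norm x \<le> 2 * (1 + norm (x + h))" using that norm_ge_zero[of "x + h"] by argo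
    then have "(1 + norm x) ^ N \<le> (2 * (1 + norm (x + h))) ^ N" by (intro power_mono) auto
    then have "(1 + norm x) ^ N * norm (hat \<phi> (x + h)) \<le> (2 * (1 + norm (x + h))) ^ N * norm (hat \<phi> (x + h))"
      by (intro mult_right_mono) auto
    also have "\<dots> = 2 ^ N * ((1 + norm (x + h)) ^ N * norm (hat \<phi> (x + h)))" by (simp only: power_mult_distrib mult.assoc)
    also have "\<dots> \<le> 2 ^ N * E" by (intro mult_left_mono E) auto
    finally show ?thesis .
  qed
  have "(1 + norm x) ^ Suc N * norm (?D \<phi> x h) \<le> (C + (\<Sum>b::real^'n\<in>Basis. (D b + 2 ^ N * E))) * norm h" if h: "norm h \<le> 1" for x h
  proof -
    have *: "\<bar>x \<bullet> b\<bar> * norm (?D \<phi> x h) \<le> norm (?D (?d b) x h) + norm h * norm (hat \<phi> (x + h))" if b: "b \<in> Basis" for b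
    proof -
      have "\<i> * of_real (b \<bullet> x) * ?D \<phi> x h = ?D (?d b) x h - \<i> * of_real (b \<bullet> h) * hat \<phi> (x + h)"
        by (simp add: hat_deriv[OF Suc.prems] inner_add_right algebra_simps)
      then have "\<bar>x \<bullet> b\<bar> * norm (?D \<phi> x h) = norm (?D (?d b) x h - \<i> * of_real (b \<bullet> h) * hat \<phi> (x + h))"
        by (metis inner_commute mult.left_neutral norm_ii norm_mult norm_of_real)
      also have "\<dots> \<le> norm (?D (?d b) x h) + \<bar>b \<bullet> h\<bar> * norm (hat \<phi> (x + h))"
        using norm_triangle_ineq4 by (metis (no_types, lifting) mult.left_neutral norm_ii norm_mult norm_of_real)
      also have "\<dots> \<le> norm (?D (?d b) x h) + norm h * norm (hat \<phi> (x + h))"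
        using Basis_le_norm[OF b, of h] by (intro add_left_mono mult_right_mono) (auto simp: inner_commute)
      finally show ?thesis .
    qed
    have "(1 + norm x) * norm (?D \<phi> x h) \<le> (1 + (\<Sum>b\<in>Basis. \<bar>x \<bullet> b\<bar>)) * norm (?D \<phi> x h)"
      using norm_le_l1[of x] by (intro mult_right_mono) auto
    also have "\<dots> \<le> norm (?D \<phi> x h) + (\<Sum>b\<in>Basis. norm (?D (?d b) x h) + norm h * norm (hat \<phi> (x + h)))"
      unfolding distrib_right sum_distrib_right by (intro add_mono sum_mono *) auto
    finally have "(1 + norm x) ^ N * ((1 + norm x) * norm (?D \<phi> x h)) \<le> (1 + norm x) ^ N * \<dots>"
      by (intro mult_left_mono) auto
    also have "\<dots> = (1 + norm x) ^ N * norm (?D \<phi> x h) + (\<Sum>b\<in>Basis. (1 + norm x) ^ N * norm (?D (?d b) x h) + norm h * ((1 + norm x) ^ N * norm (hat \<phi> (x + h))))"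
      by (simp add: distrib_left sum_distrib_left ac_simps)
    also have "\<dots> \<le> C * norm h + (\<Sum>b::real^'n\<in>Basis. D b * norm h + norm h * (2 ^ N * E))"
      by (intro add_mono sum_mono C[OF h] D[OF h] mult_left_mono E'[OF h]) auto
    also have "\<dots> = (C + (\<Sum>b::real^'n\<in>Basis. (D b + 2 ^ N * E))) * norm h"
      by (simp only: distrib_right sum_distrib_right mult.commute[of "norm h"])
    finally show ?thesis by (simp only: power_Suc mult.assoc mult.left_commute)
  qed
  then show ?case by blast
qed

section \<open>Construction of the kernel\<close>

lemma continuous_AE_imp_eq:
  fixes f g :: "'a::euclidean_space \<Rightarrow> 'b::real_normed_vector"
  assumes "continuous_on UNIV f" "continuous_on UNIV g" "AE x in lborel. f x = g x"
  shows "f = g"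
proof -
  have op: "open {x. f x \<noteq> g x}" by (intro open_Collect_neq assms)
  have "{x. f x \<noteq> g x} \<in> null_sets lborel"
    using assms(3) op by (subst AE_iff_null_sets) auto
  then have "negligible {x. f x \<noteq> g x}"
    using negligible_iff_null_sets null_sets_completionI by blast
  then have "{x. f x \<noteq> g x} = {}" using op open_not_negligible by blast
  then show ?thesis by auto
qed

lemma integral_pos_if_continuous:
  fixes f :: "'a::euclidean_space \<Rightarrow> real"
  assumes f: "integrable lborel f" "continuous_on UNIV f" "\<And>x. f x \<ge> 0" and a: "f a > 0"
  shows "(\<integral>x. f x \<partial>lborel) > 0"
proof (rule ccontr)
  assume "\<not> ?thesis"
  moreover have "(\<integral>x. f x \<partial>lborel) \<ge> 0" using f by simp
  ultimately have "(\<integral>x. f x \<partial>lborel) = 0" by simp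
  then have "AE x in lborel. f x = 0" using f by (subst (asm) integral_nonneg_eq_0_iff_AE) auto
  then have "f = (\<lambda>_. 0)" using continuous_AE_imp_eq[of f "\<lambda>_. 0"] f by simp
  then show False using a by simp
qed

lemma conv_commute: "conv f w x = conv w f x"
  unfolding conv_def by (subst integral_lborel_reflect[of _ x]) (simp add: mult.commute)

abbreviation plc :: "real ^ 'n \<Rightarrow> complex" where
  "plc x \<equiv> complex_of_real (plateau x)"

text \<open>The plateau is real and even. Hence \<open>(hat plc \<xi>)\<^sup>2\<close> is real and
  nonnegative, which is what makes its integral nonzero.\<close>

lemma hat_plc_real: "hat plc \<xi> = complex_of_real (Re (hat plc \<xi>))" for \<xi> :: "real ^ 'n"
proof -
  have "cnj (hat plc \<xi>) = (\<integral>x. cnj (exp (- \<i> * of_real (x \<bullet> \<xi>)) * plc x) \<partial>lborel)"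
    unfolding hat_def by (rule Bochner_Integration.integral_cnj[symmetric])
  also have "\<dots> = hat plc (- \<xi>)"
    by (simp add: hat_def exp_cnj)
  also have "\<dots> = hat plc \<xi>"
    using hat_reflect[of plc \<xi>] by simp
  finally show ?thesis by (metis Reals_cnj_iff complex_is_Real_iff of_real_Re)
qed

lemma hat_plc_0: "Re (hat plc (0::real^'n)) > 0"
proof -
  have "hat (plc :: real ^ 'n \<Rightarrow> complex) 0 = complex_of_real (integral\<^sup>L lborel (\<lambda>x::real^'n. plateau x))"
    by (simp add: hat_def)
  moreover have "(integral\<^sup>L lborel (\<lambda>x::real^'n. plateau x)) > 0"
  proof (rule integral_pos_if_continuous[where a=0])
    show "integrable lborel (plateau :: real^'n \<Rightarrow> real)" "continuous_on UNIV (plateau :: real^'n \<Rightarrow> real)"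
      using integrable_Re[OF test_fun_integrable[OF test_fun_plateau]] continuous_on_Re[OF test_fun_continuous[OF test_fun_plateau]] by simp_all
  qed (auto simp: plateau_nonneg plateau_eq_1)
  ultimately show ?thesis by simp
qed

lemma integrable_hat_plc_sq: "integrable lborel (\<lambda>\<xi>::real^'n. (hat plc \<xi>)\<^sup>2)"
proof -
  have r: "rapid (hat (plc :: real^'n \<Rightarrow> _))" by (rule rapid_hat_test_fun[OF test_fun_plateau])
  then have i: "integrable lborel (hat (plc :: real^'n \<Rightarrow> _))"
    using rapid_wint wint_0_iff by blast
  have m: "hat (plc :: real^'n \<Rightarrow> _) \<in> borel_measurable borel" using i by auto
  show ?thesis
    by (rule integrable_boundI[OF integrable_mult_right[OF integrable_norm[OF i], of "\<integral>x. norm (plc (x::real^'n)) \<partial>lborel"]])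
       (use m norm_hat_le[of plc] in \<open>auto simp: power2_eq_square norm_mult intro!: mult_right_mono\<close>)
qed

lemma integral_hat_plc_sq: "(integral\<^sup>L lborel (\<lambda>\<xi>::real^'n. (hat plc \<xi>)\<^sup>2)) \<noteq> 0"
proof -
  let ?r = "\<lambda>\<xi>::real^'n. Re (hat plc \<xi>)"
  have eq: "(hat plc \<xi>)\<^sup>2 = complex_of_real ((?r \<xi>)\<^sup>2)" for \<xi> :: "real^'n"
    by (subst hat_plc_real) simp
  have "(\<integral>\<xi>. (?r \<xi>)\<^sup>2 \<partial>lborel) > 0"
  proof (rule integral_pos_if_continuous[where a=0])
    show "integrable lborel (\<lambda>\<xi>. (?r \<xi>)\<^sup>2)" using integrable_Re[OF integrable_hat_plc_sq[where 'n='n]] unfolding eq by simp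
    show "continuous_on UNIV (\<lambda>\<xi>. (?r \<xi>)\<^sup>2)"
      by (intro continuous_intros continuous_hat test_fun_integrable test_fun_plateau)
  qed (use hat_plc_0[where 'n='n] in auto)
  then show ?thesis by (simp only: eq integral_complex_of_real of_real_eq_0_iff)
qed

lemma continuous_conv_bounded:
  fixes f w :: "'a::euclidean_space \<Rightarrow> complex"
  assumes f: "continuous_on UNIV f" "\<And>x. norm (f x) \<le> M" and w: "integrable lborel w"
  shows "continuous_on UNIV (conv f w)"
proof -
  have [measurable]: "f \<in> borel_measurable borel" "w \<in> borel_measurable borel"
    using f w borel_measurable_continuous_onI by auto
  have "(\<lambda>n. \<integral>y. f (X n - y) * w y \<partial>lborel) \<longlonglongrightarrow> (\<integral>y. f (a - y) * w y \<partial>lborel)" if X: "X \<longlonglongrightarrow> a" for X a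
  proof (rule integral_dominated_convergence[where w="\<lambda>y. M * norm (w y)"])
    show "AE y in lborel. (\<lambda>n. f (X n - y) * w y) \<longlonglongrightarrow> f (a - y) * w y"
    proof (intro AE_I2 tendsto_mult tendsto_const)
      fix y
      have "isCont f (a - y)" using f(1) by (simp add: continuous_on_eq_continuous_at)
      then show "(\<lambda>n. f (X n - y)) \<longlonglongrightarrow> f (a - y)"
        by (rule isCont_tendsto_compose) (intro tendsto_intros X)
    qed
    show "AE y in lborel. norm (f (X n - y) * w y) \<le> M * norm (w y)" for n
      unfolding norm_mult by (intro AE_I2 mult_right_mono f norm_ge_zero)
  qed (use w in auto)
  then show ?thesis unfolding continuous_on_sequentially o_def conv_def by blast
qed

text \<open>The conditions that injectivity and inversion impose on \<gamma>, met by
  \<open>conv plc plc\<close>. Its value at 0 is, by evenness, the squared L2 norm of the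
  plateau.\<close>

lemma conv_plc:
  shows "integrable lborel (conv plc (plc :: real^'n \<Rightarrow> _))"
    and "hat (conv plc (plc :: real^'n \<Rightarrow> _)) = (\<lambda>\<xi>. (hat plc \<xi>)\<^sup>2)"
    and "isCont (conv plc (plc :: real^'n \<Rightarrow> _)) 0"
    and "\<exists>M. \<forall>x. norm (conv plc (plc :: real^'n \<Rightarrow> _) x) \<le> M"
    and "conv plc (plc :: real^'n \<Rightarrow> _) 0 \<noteq> 0"
proof -
  note t = test_fun_plateau[where 'n='n]
  note i = test_fun_integrable[OF t]
  have [measurable]: "(plateau :: real^'n \<Rightarrow> real) \<in> borel_measurable borel"
    using continuous_on_Re[OF test_fun_continuous[OF t]] by (intro borel_measurable_continuous_onI) simp
  have w: "wint 0 (plc :: real^'n \<Rightarrow> _)" by (rule test_fun_wint[OF t])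
  have p: "norm (plc x) \<le> 1" for x :: "real^'n" by (simp add: plateau_le_1 plateau_nonneg)
  have pb: "pbd 0 (plc :: real^'n \<Rightarrow> _)" using p by (auto simp: pbd_def)
  show "integrable lborel (conv plc (plc :: real^'n \<Rightarrow> _))"
    using wint_conv[OF _ w w] by (simp add: wint_0_iff)
  show "hat (conv plc (plc :: real^'n \<Rightarrow> _)) = (\<lambda>\<xi>. (hat plc \<xi>)\<^sup>2)"
    by (simp add: fun_eq_iff hat_conv[OF i i] power2_eq_square)
  show "\<exists>M. \<forall>x. norm (conv plc (plc :: real^'n \<Rightarrow> _) x) \<le> M"
    using norm_conv_le[OF _ pb w, of 1] p by auto
  show "isCont (conv plc (plc :: real^'n \<Rightarrow> _)) 0"
    using continuous_conv_bounded[OF test_fun_continuous[OF t] p i] by (simp add: continuous_on_eq_continuous_at)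
  have "(integral\<^sup>L lborel (\<lambda>x::real^'n. (plateau x)\<^sup>2)) > 0"
  proof (rule integral_pos_if_continuous[where a=0])
    show "integrable lborel (\<lambda>x::real^'n. (plateau x)\<^sup>2)"
      by (rule integrable_boundI[OF integrable_norm[OF i]])
        (use integrable_Re[OF i] in \<open>auto simp: power2_eq_square plateau_nonneg plateau_le_1 mult_left_le_one_le\<close>)
    show "continuous_on UNIV (\<lambda>x::real^'n. (plateau x)\<^sup>2)"
      using continuous_on_Re[OF test_fun_continuous[OF t]] by (intro continuous_intros) simp
  qed (auto simp: plateau_nonneg plateau_eq_1)
  moreover have "conv plc (plc :: real^'n \<Rightarrow> _) 0 = complex_of_real (integral\<^sup>L lborel (\<lambda>x::real^'n. (plateau x)\<^sup>2))"
    by (simp add: conv_def power2_eq_square flip: of_real_mult)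
  ultimately show "conv plc (plc :: real^'n \<Rightarrow> _) 0 \<noteq> 0" by simp
qed

lemma hat_inject_AE:
  fixes f g :: "real^'n \<Rightarrow> complex"
  assumes f: "integrable lborel f" and g: "integrable lborel g" and eq: "\<And>\<xi>. hat f \<xi> = hat g \<xi>"
  shows "AE x in lborel. f x = g x"
proof -
  have "AE x in lborel. f x - g x = 0"
    by (rule hat_eq_0_imp_AE[of "conv plc plc"])
      (use f g eq integrable_hat_plc_sq integral_hat_plc_sq in \<open>auto simp: conv_plc hat_diff\<close>)
  then show ?thesis by simp
qed

text \<open>The constant normalises Fourier inversion, so that \<open>hat kern\<close> is exactly \<open>plc\<close>. It comes from the
  summability pair \<open>plc * plc\<close> and \<open>(hat plc)\<^sup>2 \<ge> 0\<close>, which replaces the usual Gaussian.\<close>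

definition kern :: "real^'n \<Rightarrow> complex" where
  "kern x = (conv plc plc (0::real^'n) / (integral\<^sup>L lborel (\<lambda>\<xi>::real^'n. (hat plc \<xi>)\<^sup>2))) * hat plc x"

lemma hat_kern: "hat kern \<xi> = plc \<xi>" for \<xi> :: "real^'n"
proof -
  note t = test_fun_plateau[where 'n='n]
  obtain M where M: "\<And>x. norm (conv plc (plc :: real^'n \<Rightarrow> _) x) \<le> M" using conv_plc(4) by blast
  \<comment> \<open>Inversion is evaluated at \<open>- \<xi>\<close>, because a second forward
    transform carries the opposite sign in its exponent; evenness of the plateau removes the sign
    afterwards.\<close>
  have "conv plc plc (0::real^'n) * (\<integral>x. exp (\<i> * of_real (x \<bullet> (-\<xi>))) * hat plc x \<partial>lborel)
    = integral\<^sup>L lborel (hat (conv plc (plc :: real^'n \<Rightarrow> _))) * plc (- \<xi>)"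
  proof (rule hat_inversion[where \<gamma>="conv plc (plc :: real^'n \<Rightarrow> _)" and u="plc::real^'n \<Rightarrow> complex" and B=1, OF conv_plc(1) _ conv_plc(3) M])
    show "integrable lborel (hat (conv plc (plc :: real^'n \<Rightarrow> _)))"
      using integrable_hat_plc_sq by (simp add: conv_plc)
    show "integrable lborel (hat (plc :: real^'n \<Rightarrow> _))"
      using rapid_wint[OF rapid_hat_test_fun[OF t]] wint_0_iff by blast
    show "isCont plc (- \<xi>)" using test_fun_continuous[OF t] by (metis UNIV_I continuous_on_eq_continuous_at open_UNIV)
  qed (auto simp: plateau_le_1 plateau_nonneg test_fun_integrable[OF t])
  then have "conv plc plc (0::real^'n) * hat (hat plc) \<xi> = (integral\<^sup>L lborel (\<lambda>z::real^'n. (hat plc z)\<^sup>2)) * plc \<xi>"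
    by (simp add: hat_def[of "hat plc"] conv_plc)
  then show ?thesis using integral_hat_plc_sq[where 'n='n]
    unfolding kern_def[abs_def] hat_cmult by simp
qed

lemma rapid_kern: "rapid (kern :: real^'n \<Rightarrow> complex)"
proof -
  define K where "K = conv plc plc (0::real^'n) / (integral\<^sup>L lborel (\<lambda>\<xi>::real^'n. (hat plc \<xi>)\<^sup>2))"
  have r: "rapid (hat (plc :: real^'n \<Rightarrow> _))" by (rule rapid_hat_test_fun[OF test_fun_plateau])
  have "\<exists>C. \<forall>x::real^'n. (1 + norm x) ^ N * norm (kern x) \<le> C" for N
  proof -
    obtain C where "\<And>x::real^'n. (1 + norm x) ^ N * norm (hat plc x) \<le> C" using r unfolding rapid_def by blast
    then have "norm K * ((1 + norm x) ^ N * norm (hat plc x)) \<le> norm K * C" for x :: "real^'n"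
      by (rule mult_left_mono) auto
    then have "(1 + norm x) ^ N * norm (kern x) \<le> norm K * C" for x :: "real^'n"
      by (simp add: kern_def K_def norm_mult norm_divide ac_simps)
    then show ?thesis by blast
  qed
  moreover have "continuous_on UNIV (kern :: real^'n \<Rightarrow> complex)"
    using r unfolding kern_def rapid_def by (intro continuous_intros) auto
  ultimately show ?thesis by (simp add: rapid_def)
qed

lemma kern_lipschitz:
  "\<exists>C. \<forall>x h::real^'n. norm h \<le> 1 \<longrightarrow> (1 + norm x) ^ N * norm (kern (x + h) - kern x) \<le> C * norm h"
proof -
  define K where "K = conv plc plc (0::real^'n) / (integral\<^sup>L lborel (\<lambda>\<xi>::real^'n. (hat plc \<xi>)\<^sup>2))"
  obtain C where C: "\<And>x h::real^'n. norm h \<le> 1 \<Longrightarrow> (1 + norm x) ^ N * norm (hat plc (x + h) - hat plc x) \<le> C * norm h"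
    using hat_test_fun_lipschitz[OF test_fun_plateau[where 'n='n], of N] by auto
  have "(1 + norm x) ^ N * norm (kern (x + h) - kern x) \<le> (norm K * C) * norm h" if h: "norm h \<le> 1" for x h :: "real^'n"
  proof -
    have "kern (x + h) - kern x = K * (hat plc (x + h) - hat plc x)"
      by (simp add: kern_def K_def right_diff_distrib)
    then have "(1 + norm x) ^ N * norm (kern (x + h) - kern x) = norm K * ((1 + norm x) ^ N * norm (hat plc (x + h) - hat plc x))"
      by (simp add: norm_mult)
    also have "\<dots> \<le> norm K * (C * norm h)" by (intro mult_left_mono C h) auto
    finally show ?thesis by (simp add: mult.assoc)
  qed
  then show ?thesis by blast
qed

lemma kern_0: "kern (0::real^'n) \<noteq> 0"
  using conv_plc(5)[where 'n='n] integral_hat_plc_sq[where 'n='n] hat_plc_0[where 'n='n]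
  by (auto simp: kern_def)

subsection \<open>Local inversion of Wiener type\<close>

text \<open>The price of passing to a dilated weight. In the contraction argument it is paid once
  and then beaten by a geometric factor; in the finite difference argument it is the loss
  \<open>ep powr (- \<beta>)\<close>.\<close>

lemma wt_le_scaled:
  assumes "\<beta> \<ge> 0" "0 < \<delta>" "\<delta> \<le> 1"
  shows "wt \<beta> x \<le> \<delta> powr (- \<beta>) * wt \<beta> (\<delta> *\<^sub>R x)"
proof -
  have "1 + norm x \<le> (1 / \<delta>) * (1 + norm (\<delta> *\<^sub>R x))"
    using assms by (simp add: field_simps)
  then have "wt \<beta> x \<le> ((1 / \<delta>) * (1 + norm (\<delta> *\<^sub>R x))) powr \<beta>"
    unfolding wt_def using assms by (intro powr_mono2) auto
  also have "\<dots> = (1 / \<delta>) powr \<beta> * wt \<beta> (\<delta> *\<^sub>R x)"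
    unfolding wt_def using assms by (subst powr_mult) auto
  also have "(1 / \<delta>) powr \<beta> = \<delta> powr (- \<beta>)"
    using assms by (simp add: powr_minus powr_divide inverse_eq_divide)
  finally show ?thesis .
qed

text \<open>The weighted norm of \<open>u\<close> may exceed 1, but its \<delta>-dilated weighted
  norms tend to the unweighted one by dominated convergence, so some \<delta> makes
  \<open>q n\<close> smaller than 1. With this \<delta> fixed, every use of the fixed point equation
  multiplies the bound on \<open>F\<close> by \<open>q n\<close>.\<close>

lemma conv_fixpoint_eq_0:
  fixes F u :: "'a::euclidean_space \<Rightarrow> complex"
  assumes b: "\<beta> \<ge> 0" and F: "pbd \<beta> F" and u: "wint \<beta> u" and lt: "(\<integral>y. norm (u y) \<partial>lborel) < 1"
    and fp: "\<And>x. F x = conv F u x"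
  shows "F = (\<lambda>_. 0)"
proof -
  note [measurable] = wint_measurable[OF u]
  define q where "q n = (\<integral>y. wt \<beta> ((1 / real (Suc n)) *\<^sub>R y) * norm (u y) \<partial>lborel)" for n
  have "q \<longlonglongrightarrow> (\<integral>y. norm (u y) \<partial>lborel)" unfolding q_def
  proof (rule integral_dominated_convergence[where w="\<lambda>y. wt \<beta> y * norm (u y)"])
    show "AE y in lborel. (\<lambda>n. wt \<beta> ((1 / real (Suc n)) *\<^sub>R y) * norm (u y)) \<longlonglongrightarrow> norm (u y)"
    proof (rule AE_I2)
      fix y
      have "(\<lambda>n. (1 + norm ((1 / real (Suc n)) *\<^sub>R y)) powr \<beta> * norm (u y)) \<longlonglongrightarrow> (1 + norm (0 *\<^sub>R y)) powr \<beta> * norm (u y)"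
        by (intro tendsto_intros lim_1_over_n[THEN LIMSEQ_Suc]) auto
      then show "(\<lambda>n. wt \<beta> ((1 / real (Suc n)) *\<^sub>R y) * norm (u y)) \<longlonglongrightarrow> norm (u y)"
        by (simp only: wt_def[symmetric]) simp
    qed
    show "AE y in lborel. norm (wt \<beta> ((1 / real (Suc n)) *\<^sub>R y) * norm (u y)) \<le> wt \<beta> y * norm (u y)" for n
      using b wt_scaled_le[of \<beta> "1 / real (Suc n)"] by (intro AE_I2) (auto intro!: mult_right_mono)
  qed (use wint_integrable_wt[OF u] in auto)
  then have "\<forall>\<^sub>F n in sequentially. q n < 1" using lt by (rule order_tendstoD)
  then obtain n where n: "q n < 1" by (auto simp: eventually_sequentially)
  define \<delta> where "\<delta> = 1 / real (Suc n)"
  have \<delta>: "0 < \<delta>" "\<delta> \<le> 1" by (auto simp: \<delta>_def)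
  have q0: "q n \<ge> 0" unfolding q_def by (intro Bochner_Integration.integral_nonneg) auto
  obtain C where C: "C \<ge> 0" "\<And>x. norm (F x) \<le> C * wt \<beta> x" using pbdE[OF F] by blast
  have ind: "norm (F x) \<le> (C * \<delta> powr (- \<beta>) * q n ^ j) * wt \<beta> (\<delta> *\<^sub>R x)" for j x
  proof (induction j arbitrary: x)
    case 0
    have "norm (F x) \<le> C * (\<delta> powr (- \<beta>) * wt \<beta> (\<delta> *\<^sub>R x))"
      using C wt_le_scaled[OF b \<delta>, of x] by (meson mult_left_mono order_trans)
    then show ?case by (simp add: mult.assoc)
  next
    case (Suc j)
    show ?case
      using norm_conv_le_scaled[OF b _ \<delta>(2) F u Suc.IH, of x] \<delta>
      by (simp add: fp[symmetric] q_def \<delta>_def ac_simps)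
  qed
  have "F x = 0" for x
  proof -
    have "(\<lambda>j. (C * \<delta> powr (- \<beta>) * q n ^ j) * wt \<beta> (\<delta> *\<^sub>R x)) \<longlonglongrightarrow> (C * \<delta> powr (- \<beta>) * 0) * wt \<beta> (\<delta> *\<^sub>R x)"
      by (intro tendsto_intros LIMSEQ_power_zero) (use n q0 in auto)
    then have "norm (F x) \<le> (C * \<delta> powr (- \<beta>) * 0) * wt \<beta> (\<delta> *\<^sub>R x)"
      by (rule LIMSEQ_le_const) (use ind in blast)
    then show ?thesis by simp
  qed
  then show ?thesis by auto
qed

text \<open>\<open>L\<^sup>1\<close>-dilate of \<open>kern\<close>: its transform is 1 on the ball of radius \<open>ep\<close> around \<open>\<eta>\<close> and 0 off the ball of radius \<open>2 ep\<close>.\<close>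

definition kerns :: "real \<Rightarrow> real^'n \<Rightarrow> real^'n \<Rightarrow> complex" where
  "kerns ep \<eta> x = exp (\<i> * of_real (x \<bullet> \<eta>)) * (complex_of_real (ep ^ CARD('n)) * kern (ep *\<^sub>R x))"

lemma continuous_kern: "continuous_on UNIV kern"
  by (rule rapid_kern[unfolded rapid_def, THEN conjunct1])

lemma kern_measurable [measurable]: "kern \<in> borel_measurable borel"
  by (rule borel_measurable_continuous_onI[OF continuous_kern])

lemma rapid_kerns:
  assumes e: "ep > 0" shows "rapid (kerns ep \<eta> :: real^'n \<Rightarrow> complex)"
  unfolding rapid_def
proof (intro conjI allI)
  show "continuous_on UNIV (kerns ep \<eta> :: real^'n \<Rightarrow> complex)"
    unfolding kerns_def by (intro continuous_intros continuous_on_compose2[OF continuous_kern]) auto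
  fix N
  obtain C where C: "\<And>x::real^'n. (1 + norm x) ^ N * norm (kern x) \<le> C" using rapid_kern unfolding rapid_def by blast
  \<comment> \<open>The entry 1/ep undoes the dilation of the norm, the entry 1 takes care of the
    summand 1 in the weight.\<close>
  define M where "M = max 1 (1 / ep)"
  have "(1 + norm x) ^ N * norm (kerns ep \<eta> x) \<le> ep ^ CARD('n) * (M ^ N * C)" for x :: "real^'n"
  proof -
    have "norm x = (1 / ep) * norm (ep *\<^sub>R x)" using e by simp
    also have "\<dots> \<le> M * norm (ep *\<^sub>R x)" unfolding M_def by (intro mult_right_mono) auto
    finally have "1 + norm x \<le> M * (1 + norm (ep *\<^sub>R x))" by (simp add: M_def distrib_left)
    then have "(1 + norm x) ^ N \<le> (M * (1 + norm (ep *\<^sub>R x))) ^ N" by (intro power_mono) auto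
    then have "(1 + norm x) ^ N * norm (kern (ep *\<^sub>R x)) \<le> (M * (1 + norm (ep *\<^sub>R x))) ^ N * norm (kern (ep *\<^sub>R x))"
      by (intro mult_right_mono) auto
    also have "\<dots> = M ^ N * ((1 + norm (ep *\<^sub>R x)) ^ N * norm (kern (ep *\<^sub>R x)))"
      by (simp only: power_mult_distrib mult.assoc)
    also have "\<dots> \<le> M ^ N * C" by (intro mult_left_mono C) (auto simp: M_def)
    finally have "ep ^ CARD('n) * ((1 + norm x) ^ N * norm (kern (ep *\<^sub>R x))) \<le> ep ^ CARD('n) * (M ^ N * C)"
      using e by (intro mult_left_mono) auto
    then show ?thesis using e by (simp add: kerns_def norm_mult norm_power ac_simps)
  qed
  then show "\<exists>C. \<forall>x. (1 + norm x) ^ N * norm (kerns ep \<eta> x) \<le> C" by blast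
qed

lemma wint_kerns: "ep > 0 \<Longrightarrow> wint \<beta> (kerns ep \<eta>)"
  by (intro rapid_wint rapid_kerns)

lemma integrable_kerns: "ep > 0 \<Longrightarrow> integrable lborel (kerns ep \<eta>)"
  using wint_kerns[of ep 0 \<eta>] by (simp add: wint_0_iff)

lemma integrable_kern: "integrable lborel kern"
  using rapid_wint[OF rapid_kern] wint_0_iff by blast

lemma hat_kerns: "ep > 0 \<Longrightarrow> hat (kerns ep \<eta>) \<xi> = plc ((\<xi> - \<eta>) /\<^sub>R ep)" for \<eta> :: "real^'n"
  unfolding kerns_def[abs_def] hat_modulate hat_cmult
  by (simp add: hat_scale hat_kern power_one_over)

lemma hat_kerns_eq_1: "ep > 0 \<Longrightarrow> norm (\<xi> - \<eta>) \<le> ep \<Longrightarrow> hat (kerns ep \<eta>) \<xi> = 1"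
  by (subst hat_kerns) (simp_all add: plateau_eq_1 divide_inverse[symmetric] mult.commute[of "inverse _"])

lemma hat_kerns_eq_0: "ep > 0 \<Longrightarrow> norm (\<xi> - \<eta>) \<ge> 2 * ep \<Longrightarrow> hat (kerns ep \<eta>) \<xi> = 0"
  by (subst hat_kerns) (simp_all add: plateau_eq_0 pos_le_divide_eq divide_inverse[symmetric] mult.commute[of "inverse _"])

section \<open>Convolution identities read off from transforms\<close>

text \<open>Only kernels are transformed, never \<open>f\<close>: associativity moves the identity
  onto the kernels, where injectivity decides it. This is how statements about supports and plateaus
  reach a function that grows.\<close>

lemma conv_conv_eq_if_hat:
  fixes f :: "real^'n \<Rightarrow> complex"
  assumes b: "\<beta> \<ge> 0" and f: "pbd \<beta> f" and w: "wint \<beta> w1" "wint \<beta> w2" "wint \<beta> w3"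
    and eq: "\<And>\<xi>. hat w1 \<xi> * hat w2 \<xi> = hat w3 \<xi>"
  shows "conv (conv f w1) w2 = conv f w3"
proof -
  note i = wint_integrable[OF w(1) b] wint_integrable[OF w(2) b] wint_integrable[OF w(3) b]
  have w12: "wint \<beta> (conv w1 w2)" by (rule wint_conv[OF b w(1,2)])
  have "AE x in lborel. conv w1 w2 x = w3 x"
    by (rule hat_inject_AE) (use i wint_integrable[OF w12 b] eq in \<open>auto simp: hat_conv\<close>)
  then show ?thesis
    unfolding conv_assoc[OF b f w(1,2)]
    by (intro conv_cong_AE) (use w12 w f in \<open>auto simp: pbd_def wint_def\<close>)
qed

lemma conv_conv_commute:
  fixes f :: "real^'n \<Rightarrow> complex"
  assumes b: "\<beta> \<ge> 0" and f: "pbd \<beta> f" and w: "wint \<beta> w1" "wint \<beta> w2"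
  shows "conv (conv f w1) w2 = conv (conv f w2) w1"
  unfolding conv_assoc[OF b f w(2,1)]
proof (rule conv_conv_eq_if_hat[OF b f w wint_conv[OF b w(2,1)]])
  show "hat w1 \<xi> * hat w2 \<xi> = hat (conv w2 w1) \<xi>" for \<xi>
    by (simp add: hat_conv[OF wint_integrable[OF w(2) b] wint_integrable[OF w(1) b]])
qed

lemma continuous_conv_rapid:
  fixes f :: "'a::euclidean_space \<Rightarrow> complex"
  assumes b: "\<beta> \<ge> 0" and f: "pbd \<beta> f" and w: "rapid w"
  shows "continuous_on UNIV (conv f w)"
proof -
  have cw: "continuous_on UNIV w" using w by (simp add: rapid_def)
  have [measurable]: "f \<in> borel_measurable borel" "w \<in> borel_measurable borel"
    using f cw borel_measurable_continuous_onI by auto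
  \<comment> \<open>The kernel decay must absorb the growth \<beta> of \<open>f\<close> and still
    leave the integrable weight of exponent -(n + 2). The bounded sequence \<open>X\<close> changes
    the weight of order r only by a constant factor.\<close>
  define r where "r = \<beta> + real (DIM('a) + 2)"
  have r: "r \<ge> 0" using b by (simp add: r_def)
  obtain C where C: "\<And>x. norm (w x) \<le> C * wt (- r) x" using rapid_bound_wt[OF w] by blast
  have C0: "C \<ge> 0" using order_trans[OF norm_ge_zero C[of 0]] by simp
  obtain D where D: "D \<ge> 0" "\<And>x. norm (f x) \<le> D * wt \<beta> x" using pbdE[OF f] by blast
  have "(\<lambda>n. \<integral>z. w (X n - z) * f z \<partial>lborel) \<longlonglongrightarrow> (\<integral>z. w (a - z) * f z \<partial>lborel)" if X: "X \<longlonglongrightarrow> a" for X a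
  proof -
    obtain B where B: "\<And>n. norm (X n) \<le> B" using X convergent_imp_Bseq convergentI BseqE by metis
    show ?thesis
    proof (rule integral_dominated_convergence[where w="\<lambda>z. (C * (1 + B) powr r * D) * wt (- real (DIM('a) + 2)) z"])
      show "AE z in lborel. (\<lambda>n. w (X n - z) * f z) \<longlonglongrightarrow> w (a - z) * f z"
      proof (intro AE_I2 tendsto_mult tendsto_const)
        fix z
        have "isCont w (a - z)" using cw by (simp add: continuous_on_eq_continuous_at)
        then show "(\<lambda>n. w (X n - z)) \<longlonglongrightarrow> w (a - z)"
          by (rule isCont_tendsto_compose) (intro tendsto_intros X)
      qed
      show "AE z in lborel. norm (w (X n - z) * f z) \<le> (C * (1 + B) powr r * D) * wt (- real (DIM('a) + 2)) z" for n
      proof (rule AE_I2)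
        fix z
        have "wt r z \<le> wt r (X n) * wt r (X n - z)" using wt_diff[OF r, of "X n" "X n - z"] by simp
        also have "\<dots> \<le> (1 + B) powr r * wt r (X n - z)"
          unfolding wt_def using B[of n] r by (intro mult_right_mono powr_mono2) auto
        finally have "inverse (wt r (X n - z)) \<le> (1 + B) powr r * inverse (wt r z)"
          using wt_pos[of r z] wt_pos[of r "X n - z"] by (simp add: field_simps)
        then have "wt (- r) (X n - z) \<le> (1 + B) powr r * wt (- r) z" by (simp add: wt_def powr_minus)
        then have "norm (w (X n - z)) \<le> C * ((1 + B) powr r * wt (- r) z)"
          using C C0 by (meson mult_left_mono order_trans)
        then have "norm (w (X n - z)) * norm (f z) \<le> (C * ((1 + B) powr r * wt (- r) z)) * (D * wt \<beta> z)"
          by (intro mult_mono D) (use C0 in auto)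
        also have "\<dots> = (C * (1 + B) powr r * D) * (wt (- r) z * wt \<beta> z)" by simp
        also have "wt (- r) z * wt \<beta> z = wt (- real (DIM('a) + 2)) z"
          by (simp add: wt_def r_def flip: powr_add)
        finally show "norm (w (X n - z) * f z) \<le> (C * (1 + B) powr r * D) * wt (- real (DIM('a) + 2)) z"
          by (simp add: norm_mult)
      qed
    qed (use integrable_wt_neg in auto)
  qed
  then have "continuous_on UNIV (conv w f)" unfolding continuous_on_sequentially o_def conv_def by blast
  then show ?thesis by (simp add: conv_commute[of f w, abs_def])
qed

text \<open>For fixed \<open>x\<close>, the values \<open>conv F (kerns ep \<eta>) x\<close> form the Fourier transform of
  \<open>z \<mapsto> F z * kerns ep 0 (x - z)\<close>, and the kernel does not vanish near \<open>z = x\<close>.\<close>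

lemma AE_eq_0_if_conv_kerns:
  fixes F :: "real^'n \<Rightarrow> complex"
  assumes b: "\<beta> \<ge> 0" and F: "pbd \<beta> F" and e: "ep > 0" and 0: "\<And>\<eta>. conv F (kerns ep \<eta>) = (\<lambda>_. 0)"
  shows "AE x in lborel. F x = 0"
proof -
  note [measurable] = pbd_measurable[OF F]
  have "isCont kern (0::real^'n)" using continuous_kern[where 'a='n] by (simp add: continuous_on_eq_continuous_at)
  then obtain r where r: "r > 0" "\<And>x::real^'n. norm x < r \<Longrightarrow> kern x \<noteq> 0"
    using continuous_at_avoid[of 0 kern 0] kern_0 by (auto simp: dist_norm)
  have loc: "AE z in lborel. z \<in> ball x (r / ep) \<longrightarrow> F z = 0" for x
  proof -
    let ?g = "\<lambda>z. F z * kerns ep 0 (x - z)"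
    have gi: "integrable lborel ?g"
    proof -
      have "integrable lborel (\<lambda>y. F (x - y) * kerns ep 0 y)"
        by (rule integrable_conv[OF b F wint_kerns[OF e]])
      then show ?thesis using integrable_lborel_reflect_iff[of ?g x] by simp
    qed
    have hz: "hat ?g \<eta> = 0" for \<eta>
    proof -
      have "exp (\<i> * of_real (x \<bullet> \<eta>)) * hat ?g \<eta> = (\<integral>z. exp (\<i> * of_real (x \<bullet> \<eta>)) * (exp (- \<i> * of_real (z \<bullet> \<eta>)) * ?g z) \<partial>lborel)"
        unfolding hat_def by (rule integral_mult_right_zero[symmetric])
      also have "\<dots> = conv (kerns ep \<eta>) F x"
        unfolding conv_def kerns_def by (intro Bochner_Integration.integral_cong refl)
          (simp add: inner_diff_left algebra_simps exp_diff exp_minus divide_inverse)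
      also have "\<dots> = 0" using 0[of \<eta>] conv_commute[of F "kerns ep \<eta>" x] by simp
      finally show ?thesis by simp
    qed
    have "AE z in lborel. ?g z = 0"
      using hat_inject_AE[of ?g "\<lambda>_. 0"] gi hz by (simp add: hat_def)
    then show ?thesis
    proof eventually_elim
      case (elim z)
      have "kerns ep 0 (x - z) \<noteq> 0" if "z \<in> ball x (r / ep)"
      proof -
        have "norm (ep *\<^sub>R (x - z)) < r" using that e by (simp add: dist_norm pos_less_divide_eq mult.commute)
        then show ?thesis using r(2) e by (simp add: kerns_def)
      qed
      then show ?case using elim by auto
    qed
  qed
  \<comment> \<open>The exceptional null set in \<open>loc\<close> depends on the centre, so only
    countably many centres may be combined; balls of fixed radius around a dense set still cover the
    space.\<close>
  obtain D :: "(real^'n) set" where D: "countable D" "\<And>X. open X \<Longrightarrow> X \<noteq> {} \<Longrightarrow> \<exists>d\<in>D. d \<in> X"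
    using countable_dense_exists by metis
  have "AE z in lborel. \<forall>x\<in>D. z \<in> ball x (r / ep) \<longrightarrow> F z = 0"
    by (subst AE_ball_countable[OF D(1)]) (use loc in blast)
  then show ?thesis
  proof eventually_elim
    case (elim z)
    obtain d where "d \<in> D" "d \<in> ball z (r / ep)" using D(2)[of "ball z (r / ep)"] divide_pos_pos[OF r(1) e] by (auto simp: not_le)
    then show ?case using elim by (auto simp: dist_commute)
  qed
qed

section \<open>The L1 modulus of continuity of the kernel\<close>

text \<open>After dilation the kernel of width \<open>ep\<close> has this modulus at
  \<open>ep *\<^sub>R y\<close>, which makes a narrow plateau in frequency nearly translation
  invariant in L1.\<close>

definition modulus :: "real^'n \<Rightarrow> real" where
  "modulus y = (\<integral>x. norm (kern x - kern (x - y)) \<partial>lborel)"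

lemma integrable_kern_shift: "integrable lborel (\<lambda>x. kern (x - y))"
  using integrable_kern integrable_lborel_translate_iff[of kern "-y"] by simp

lemma modulus_le: "modulus y \<le> 2 * (integral\<^sup>L lborel (\<lambda>x::real^'n. norm (kern x)))" for y :: "real^'n"
proof -
  have "modulus y \<le> (\<integral>x. norm (kern x) + norm (kern (x - y)) \<partial>lborel)"
    unfolding modulus_def
    by (intro integral_mono norm_triangle_ineq4 Bochner_Integration.integrable_add integrable_norm
      Bochner_Integration.integrable_diff integrable_kern integrable_kern_shift)
  also have "\<dots> = (integral\<^sup>L lborel (\<lambda>x::real^'n. norm (kern x))) + (\<integral>x. norm (kern (x - y)) \<partial>lborel)"
    by (intro Bochner_Integration.integral_add integrable_norm integrable_kern integrable_kern_shift)
  also have "(\<integral>x. norm (kern (x - y)) \<partial>lborel) = (integral\<^sup>L lborel (\<lambda>x::real^'n. norm (kern x)))"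
    using integral_lborel_translate[of "\<lambda>x. norm (kern x)" "-y"] by simp
  finally show ?thesis by simp
qed

lemma modulus_nonneg: "modulus y \<ge> 0"
  by (simp add: modulus_def)

lemma modulus_measurable [measurable]: "modulus \<in> borel_measurable borel"
  unfolding modulus_def[abs_def] by measurable

text \<open>The pointwise Lipschitz bound has arbitrary polynomial decay; the order \<open>N\<close>
  is taken large enough to cover \<beta> and leave the integrable weight. Exponent 0 yields
  continuity of \<open>modulus\<close>, exponent \<beta> controls finite differences.\<close>

lemma kern_weighted_lipschitz:
  assumes b: "\<beta> \<ge> 0"
  shows "\<exists>C\<ge>0. \<forall>h::real^'n. norm h \<le> 1 \<longrightarrow> (\<integral>x. wt \<beta> x * norm (kern (x + h) - kern x) \<partial>lborel) \<le> C * norm h"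
proof -
  let ?n = "DIM(real^'n)"
  define N where "N = nat \<lceil>\<beta>\<rceil> + (?n + 2)"
  obtain C where C: "\<And>x h::real^'n. norm h \<le> 1 \<Longrightarrow> (1 + norm x) ^ N * norm (kern (x + h) - kern x) \<le> C * norm h"
    using kern_lipschitz[of N] by auto
  let ?w = "wt (- real (?n + 2)) :: real^'n \<Rightarrow> real"
  have le: "wt \<beta> x * norm (kern (x + h) - kern x) \<le> (C * norm h) * ?w x" if h: "norm h \<le> 1" for x h :: "real^'n"
  proof -
    have "wt (\<beta> + real (?n + 2)) x \<le> (1 + norm x) ^ N"
      unfolding wt_of_nat[symmetric] by (intro wt_mono_exp) (auto simp: N_def of_nat_nat real_nat_ceiling_ge)
    then have "wt (\<beta> + real (?n + 2)) x * norm (kern (x + h) - kern x) \<le> C * norm h"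
      using C[OF h, of x] by (meson mult_right_mono norm_ge_zero order_trans)
    then have le': "(wt (\<beta> + real (?n + 2)) x * norm (kern (x + h) - kern x)) * ?w x \<le> (C * norm h) * ?w x"
      by (rule mult_right_mono) simp
    have "wt \<beta> x = wt (\<beta> + real (?n + 2)) x * ?w x"
      by (simp add: wt_def flip: powr_add)
    then have eq: "wt \<beta> x * norm (kern (x + h) - kern x) = (wt (\<beta> + real (?n + 2)) x * norm (kern (x + h) - kern x)) * ?w x"
      by (simp only: mult_ac)
    show ?thesis unfolding eq by (rule le')
  qed
  have int: "integrable lborel (\<lambda>x. wt \<beta> x * norm (kern (x + h) - kern x))" if h: "norm h \<le> 1" for h :: "real^'n"
    by (rule integrable_boundI[OF integrable_mult_right[OF integrable_wt_neg, of "C * norm h"]])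
      (use le[OF h] in simp_all)
  have bd: "(\<integral>x. wt \<beta> x * norm (kern (x + h) - kern x) \<partial>lborel) \<le> (\<integral>x. \<bar>C\<bar> * norm h * ?w x \<partial>lborel)" if h: "norm h \<le> 1" for h :: "real^'n"
  proof (intro integral_mono int[OF h] integrable_mult_right integrable_wt_neg)
    fix x show "wt \<beta> x * norm (kern (x + h) - kern x) \<le> \<bar>C\<bar> * norm h * ?w x"
      by (rule order_trans[OF le[OF h]]) (intro mult_right_mono, auto)
  qed
  then have "(\<integral>x. wt \<beta> x * norm (kern (x + h) - kern x) \<partial>lborel) \<le> (\<bar>C\<bar> * integral\<^sup>L lborel ?w) * norm h" if h: "norm h \<le> 1" for h :: "real^'n"
    using bd[OF h] unfolding integral_mult_right_zero by (simp only: mult_ac)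
  moreover have "\<bar>C\<bar> * integral\<^sup>L lborel ?w \<ge> 0" by simp
  ultimately show ?thesis by (intro exI[of _ "\<bar>C\<bar> * integral\<^sup>L lborel ?w"]) simp
qed

lemma isCont_modulus: "isCont modulus (0::real^'n)"
proof -
  obtain C where C: "\<And>h::real^'n. norm h \<le> 1 \<Longrightarrow> (\<integral>x. wt 0 x * norm (kern (x + h) - kern x) \<partial>lborel) \<le> C * norm h"
    using kern_weighted_lipschitz[OF order_refl, where 'n='n] by auto
  have le: "modulus y \<le> C * norm y" if y: "norm y \<le> 1" for y :: "real^'n"
    using C[of "-y"] y unfolding modulus_def by (simp add: norm_minus_commute)
  have "(modulus \<longlongrightarrow> 0) (at (0::real^'n))"
  proof (rule tendsto_sandwich[of "\<lambda>_. 0"])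
    show "\<forall>\<^sub>F y in at (0::real^'n). modulus y \<le> C * norm y"
      unfolding eventually_at using le by (intro exI[of _ 1]) auto
    have "((\<lambda>y::real^'n. C * norm y) \<longlongrightarrow> C * norm (0::real^'n)) (at 0)" by (intro tendsto_intros)
    then show "((\<lambda>y::real^'n. C * norm y) \<longlongrightarrow> 0) (at 0)" by simp
  qed (auto simp: modulus_nonneg)
  then show ?thesis by (simp add: isCont_def modulus_def)
qed

lemma nn_integral_kerns_shift:
  fixes y :: "real^'n"
  assumes e: "ep > 0"
  shows "(\<integral>\<^sup>+x. ennreal (norm (kerns ep 0 x - kerns ep 0 (x - y))) \<partial>lborel) = ennreal (modulus (ep *\<^sub>R y))"
proof -
  have i: "integrable lborel (\<lambda>x. norm (kern x - kern (x - ep *\<^sub>R y)))"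
    by (intro integrable_norm Bochner_Integration.integrable_diff integrable_kern integrable_kern_shift)
  have "ennreal (modulus (ep *\<^sub>R y)) = (\<integral>\<^sup>+x. ennreal (norm (kern x - kern (x - ep *\<^sub>R y))) \<partial>lborel)"
    unfolding modulus_def by (rule nn_integral_eq_integral[symmetric, OF i]) auto
  also have "\<dots> = ennreal (\<bar>ep\<bar> ^ DIM(real^'n)) * (\<integral>\<^sup>+x. ennreal (norm (kern (0 + ep *\<^sub>R x) - kern (0 + ep *\<^sub>R x - ep *\<^sub>R y))) \<partial>lborel)"
    using e by (subst nn_integral_lborel_affine[of _ ep 0]) (auto simp: ennreal_power)
  also have "\<dots> = (\<integral>\<^sup>+x. ennreal (\<bar>ep\<bar> ^ DIM(real^'n)) * ennreal (norm (kern (0 + ep *\<^sub>R x) - kern (0 + ep *\<^sub>R x - ep *\<^sub>R y))) \<partial>lborel)"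
    by (subst nn_integral_cmult) auto
  also have "\<dots> = (\<integral>\<^sup>+x. ennreal (norm (kerns ep 0 x - kerns ep 0 (x - y))) \<partial>lborel)"
    using e by (intro nn_integral_cong)
      (simp add: kerns_def scaleR_diff_right norm_mult norm_power flip: right_diff_distrib ennreal_mult')
  finally show ?thesis by simp
qed

text \<open>Since \<open>hat k \<eta>\<close> is the eigenvalue on the character, the difference is
  the integral over y of \<open>?e (x - y) * k y\<close> times the increment of the unmodulated
  kernel between \<open>x - y\<close> and \<open>x\<close>. The character has modulus 1, so the
  bound does not depend on \<eta>.\<close>

lemma norm_conv_kerns_diff:
  fixes k :: "real^'n \<Rightarrow> complex"
  assumes k: "integrable lborel k" and e: "ep > 0"
  shows "(\<integral>x. norm (hat k \<eta> * kerns ep \<eta> x - conv k (kerns ep \<eta>) x) \<partial>lborel)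
    \<le> (\<integral>y. norm (k y) * modulus (ep *\<^sub>R y) \<partial>lborel)"
proof -
  note [measurable] = borel_measurable_integrable[OF k] borel_measurable_integrable[OF integrable_kerns[OF e]]
  let ?e = "\<lambda>x::real^'n. exp (\<i> * of_real (x \<bullet> \<eta>))"
  have w: "wint 0 k" using k by (simp add: wint_0_iff)
  have b: "pbd 0 (kerns ep \<eta>)"
  proof -
    obtain C where "\<And>x. norm (kerns ep \<eta> x) \<le> C * wt (- 0) x" using rapid_bound_wt[OF rapid_kerns[OF e]] by blast
    then show ?thesis by (auto simp: pbd_def)
  qed
  have eb: "pbd 0 (\<lambda>x. ?e x)" by (auto simp: pbd_def intro!: exI[of _ 1])
  have le: "norm (hat k \<eta> * kerns ep \<eta> x - conv k (kerns ep \<eta>) x) \<le> (\<integral>y. norm (k y) * norm (kerns ep 0 x - kerns ep 0 (x - y)) \<partial>lborel)" for x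
  proof -
    have i1: "integrable lborel (\<lambda>y. ?e (x - y) * k y)" by (rule integrable_conv[OF _ eb w]) simp
    have i2: "integrable lborel (\<lambda>y. kerns ep \<eta> (x - y) * k y)" by (rule integrable_conv[OF _ b w]) simp
    have "hat k \<eta> * kerns ep \<eta> x - conv k (kerns ep \<eta>) x = conv ?e k x * kerns ep 0 x - conv (kerns ep \<eta>) k x"
      unfolding conv_character conv_commute[of k] by (simp add: kerns_def)
    also have "\<dots> = (\<integral>y. (?e (x - y) * k y) * kerns ep 0 x - kerns ep \<eta> (x - y) * k y \<partial>lborel)"
      unfolding conv_def using i1 i2 by simp
    finally have "norm (hat k \<eta> * kerns ep \<eta> x - conv k (kerns ep \<eta>) x)
      = norm (\<integral>y. (?e (x - y) * k y) * kerns ep 0 x - kerns ep \<eta> (x - y) * k y \<partial>lborel)"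
      by (rule arg_cong)
    also have "\<dots> \<le> (\<integral>y. norm ((?e (x - y) * k y) * kerns ep 0 x - kerns ep \<eta> (x - y) * k y) \<partial>lborel)"
      by (rule integral_norm_bound)
    also have "\<dots> = (\<integral>y. norm (k y) * norm (kerns ep 0 x - kerns ep 0 (x - y)) \<partial>lborel)"
    proof (intro Bochner_Integration.integral_cong refl)
      fix y
      have "(?e (x - y) * k y) * kerns ep 0 x - kerns ep \<eta> (x - y) * k y = ?e (x - y) * (k y * (kerns ep 0 x - kerns ep 0 (x - y)))"
        by (simp add: kerns_def algebra_simps)
      then show "norm ((?e (x - y) * k y) * kerns ep 0 x - kerns ep \<eta> (x - y) * k y) = norm (k y) * norm (kerns ep 0 x - kerns ep 0 (x - y))"
        by (simp add: norm_mult)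
    qed
    finally show ?thesis .
  qed
  have mi: "integrable lborel (\<lambda>y. norm (k y) * modulus (ep *\<^sub>R y))"
    by (rule integrable_boundI[where f="\<lambda>y. norm (k y) * (2 * (integral\<^sup>L lborel (\<lambda>x::real^'n. norm (kern x))))"])
      (use k modulus_le in \<open>auto simp: modulus_nonneg abs_mult intro!: mult_left_mono\<close>)
  \<comment> \<open>Working in \<open>ennreal\<close> lets Tonelli apply without joint
    integrability. The passage to it is stated as an inequality, because a divergent integral has
    Bochner value 0.\<close>
  have "ennreal (\<integral>x. norm (hat k \<eta> * kerns ep \<eta> x - conv k (kerns ep \<eta>) x) \<partial>lborel)
     \<le> (\<integral>\<^sup>+x. ennreal (norm (hat k \<eta> * kerns ep \<eta> x - conv k (kerns ep \<eta>) x)) \<partial>lborel)"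
    by (rule integral_eq_nn_integral[THEN eq_refl, THEN ennreal_leI, THEN order_trans]) (auto simp: ennreal_enn2real_if)
  also have "\<dots> \<le> (\<integral>\<^sup>+x. \<integral>\<^sup>+y. ennreal (norm (k y) * norm (kerns ep 0 x - kerns ep 0 (x - y))) \<partial>lborel \<partial>lborel)"
  proof (intro nn_integral_mono)
    fix x
    have "ennreal (norm (hat k \<eta> * kerns ep \<eta> x - conv k (kerns ep \<eta>) x)) \<le> ennreal (\<integral>y. norm (k y) * norm (kerns ep 0 x - kerns ep 0 (x - y)) \<partial>lborel)"
      by (intro ennreal_leI le)
    also have "\<dots> \<le> (\<integral>\<^sup>+y. ennreal (norm (k y) * norm (kerns ep 0 x - kerns ep 0 (x - y))) \<partial>lborel)"
      by (rule integral_eq_nn_integral[THEN eq_refl, THEN ennreal_leI, THEN order_trans]) (auto simp: ennreal_enn2real_if)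
    finally show "ennreal (norm (hat k \<eta> * kerns ep \<eta> x - conv k (kerns ep \<eta>) x)) \<le> (\<integral>\<^sup>+y. ennreal (norm (k y) * norm (kerns ep 0 x - kerns ep 0 (x - y))) \<partial>lborel)" .
  qed
  also have "\<dots> = (\<integral>\<^sup>+y. \<integral>\<^sup>+x. ennreal (norm (k y) * norm (kerns ep 0 x - kerns ep 0 (x - y))) \<partial>lborel \<partial>lborel)"
    by (rule lborel_pair.Fubini') measurable
  also have "\<dots> = (\<integral>\<^sup>+y. ennreal (norm (k y) * modulus (ep *\<^sub>R y)) \<partial>lborel)"
    by (simp add: ennreal_mult' nn_integral_cmult nn_integral_kerns_shift[OF e] modulus_nonneg)
  also have "\<dots> = ennreal (\<integral>y. norm (k y) * modulus (ep *\<^sub>R y) \<partial>lborel)"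
    by (rule nn_integral_eq_integral[OF mi]) (auto simp: modulus_nonneg)
  finally show ?thesis
    by (subst (asm) ennreal_le_iff) (auto simp: modulus_nonneg intro!: Bochner_Integration.integral_nonneg)
qed

lemma integral_modulus_small:
  fixes k :: "real^'n \<Rightarrow> complex"
  assumes k: "integrable lborel k" and c: "c > 0"
  obtains ep where "ep > 0" "(\<integral>y. norm (k y) * modulus (ep *\<^sub>R y) \<partial>lborel) < c"
proof -
  have "(\<lambda>n. \<integral>y. complex_of_real (modulus (0 + (1 / real (Suc n)) *\<^sub>R y)) * complex_of_real (norm (k y)) \<partial>lborel)
    \<longlonglongrightarrow> complex_of_real (modulus (0::real^'n)) * (\<integral>y. complex_of_real (norm (k y)) \<partial>lborel)"
  proof (rule integral_dilated_limit)
    show "norm (complex_of_real (modulus x)) \<le> 2 * (integral\<^sup>L lborel (\<lambda>x::real^'n. norm (kern x)))" for x :: "real^'n"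
      using modulus_le[of x] modulus_nonneg[of x] by simp
    show "isCont (\<lambda>x. complex_of_real (modulus x)) (0::real^'n)"
      using isCont_modulus by (intro continuous_intros)
  qed (use k in auto)
  then have "(\<lambda>n. complex_of_real (\<integral>y. norm (k y) * modulus ((1 / real (Suc n)) *\<^sub>R y) \<partial>lborel)) \<longlonglongrightarrow> complex_of_real 0"
    by (simp add: modulus_def[of 0] mult.commute flip: of_real_mult)
  then have "(\<lambda>n. (\<integral>y. norm (k y) * modulus ((1 / real (Suc n)) *\<^sub>R y) \<partial>lborel)) \<longlonglongrightarrow> 0"
    by (simp only: tendsto_of_real_iff)
  then have "\<forall>\<^sub>F n in sequentially. (\<integral>y. norm (k y) * modulus ((1 / real (Suc n)) *\<^sub>R y) \<partial>lborel) < c"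
    using c by (rule order_tendstoD)
  then obtain n where "(\<integral>y. norm (k y) * modulus ((1 / real (Suc n)) *\<^sub>R y) \<partial>lborel) < c"
    by (auto simp: eventually_sequentially)
  then show thesis using that[of "1 / real (Suc n)"] by simp
qed

text \<open>\<open>K\<close> has width \<open>ep'\<close>, chosen from \<open>c\<close> alone so
  that \<open>u\<close> is a contraction for every admissible \<eta>. Width at most
  \<open>ep' / 2\<close> for the outer kernel puts its frequencies inside the plateau of
  \<open>K\<close>, so \<open>F\<close> is reproduced by \<open>K\<close>; and \<open>F\<close> is
  annihilated by \<open>k\<close>, hence by \<open>conv k K\<close>. Together these say that
  \<open>F\<close> is a fixed point of convolution with \<open>u\<close>.\<close>

lemma conv_kerns_eq_0_locally:
  fixes f :: "real^'n \<Rightarrow> complex"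
  assumes b: "\<beta> \<ge> 0" and f: "pbd \<beta> f" and k: "wint \<beta> k" and 0: "conv f k = (\<lambda>_. 0)" and c: "c > 0"
  obtains ep0 where "ep0 > 0"
    "\<And>ep \<eta>. 0 < ep \<Longrightarrow> ep \<le> ep0 \<Longrightarrow> c \<le> norm (hat k \<eta>) \<Longrightarrow> conv f (kerns ep \<eta>) = (\<lambda>_. 0)"
proof -
  note ki = wint_integrable[OF k b]
  obtain ep' where e': "ep' > 0" "(\<integral>y. norm (k y) * modulus (ep' *\<^sub>R y) \<partial>lborel) < c"
    using integral_modulus_small[OF ki c] by blast
  have "conv f (kerns ep \<eta>) = (\<lambda>_. 0)" if e: "0 < ep" "ep \<le> ep' / 2" and \<eta>: "c \<le> norm (hat k \<eta>)" for ep \<eta>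
  proof -
    have h0: "hat k \<eta> \<noteq> 0" using \<eta> c by auto
    define K where "K = kerns ep' \<eta>"
    define F where "F = conv f (kerns ep \<eta>)"
    define u where "u x = inverse (hat k \<eta>) * (hat k \<eta> * K x - conv k K x)" for x
    have K: "wint \<beta> K" unfolding K_def by (rule wint_kerns[OF e'(1)])
    have Ke: "wint \<beta> (kerns ep \<eta>)" by (rule wint_kerns[OF e(1)])
    have kK: "wint \<beta> (conv k K)" by (rule wint_conv[OF b k K])
    have F: "pbd \<beta> F" unfolding F_def by (rule pbd_conv[OF b f Ke])
    have u: "wint \<beta> u" unfolding u_def by (intro wint_cmult wint_diff K kK)
    have "(\<integral>x. norm (u x) \<partial>lborel) = inverse (norm (hat k \<eta>)) * (\<integral>x. norm (hat k \<eta> * K x - conv k K x) \<partial>lborel)"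
      by (simp add: u_def norm_mult norm_inverse)
    also have "\<dots> \<le> inverse (norm (hat k \<eta>)) * (\<integral>y. norm (k y) * modulus (ep' *\<^sub>R y) \<partial>lborel)"
      unfolding K_def by (intro mult_left_mono norm_conv_kerns_diff ki e') auto
    also have "\<dots> < inverse (norm (hat k \<eta>)) * norm (hat k \<eta>)"
      by (intro mult_strict_left_mono order.strict_trans2[OF e'(2) \<eta>]) (use h0 in auto)
    finally have lt: "(\<integral>x. norm (u x) \<partial>lborel) < 1" using h0 by simp
    have FK: "conv F K = F"
      unfolding F_def
    proof (rule conv_conv_eq_if_hat[OF b f Ke K Ke])
      fix \<xi>
      show "hat (kerns ep \<eta>) \<xi> * hat K \<xi> = hat (kerns ep \<eta>) \<xi>"
      proof (cases "norm (\<xi> - \<eta>) \<ge> 2 * ep")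
        case True then show ?thesis using e by (simp add: hat_kerns_eq_0)
      next
        case False
        then have "norm (\<xi> - \<eta>) \<le> ep'" using e by simp
        then show ?thesis using e' by (simp add: K_def hat_kerns_eq_1)
      qed
    qed
    have "conv F (conv k K) = conv (conv F k) K" by (rule conv_assoc[OF b F k K, symmetric])
    also have "conv F k = conv (conv f k) (kerns ep \<eta>)" unfolding F_def by (rule conv_conv_commute[OF b f Ke k])
    finally have FkK: "conv F (conv k K) = (\<lambda>_. 0)" by (simp add: 0)
    have "F x = conv F u x" for x
    proof -
      have "conv F u x = inverse (hat k \<eta>) * conv F (\<lambda>x. hat k \<eta> * K x - conv k K x) x"
        unfolding u_def by (rule conv_cmult_right)
      also have "conv F (\<lambda>x. hat k \<eta> * K x - conv k K x) x = conv F (\<lambda>x. hat k \<eta> * K x) x - conv F (conv k K) x"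
        by (rule conv_diff_right[OF b F wint_cmult[OF K] kK])
      finally show ?thesis using h0 by (simp add: FkK conv_cmult_right FK)
    qed
    then have "F = (\<lambda>_. 0)" by (rule conv_fixpoint_eq_0[OF b F u lt])
    then show ?thesis by (simp add: F_def)
  qed
  then show thesis using that[of "ep' / 2"] e' by simp
qed

section \<open>Functions with spectrum at the origin\<close>

text \<open>A form of "the distributional Fourier transform is supported in {0}" that mentions only
  convolutions. One \<delta> has to serve a whole annulus, since
  \<open>AE_eq_0_if_conv_kerns\<close> works with a common width.\<close>

definition spectrum_at_0 :: "(real^'n \<Rightarrow> complex) \<Rightarrow> bool" where
  "spectrum_at_0 f \<longleftrightarrow> (\<forall>r>0. \<forall>R. \<exists>\<delta>>0. \<forall>ep \<eta>. 0 < ep \<longrightarrow> ep \<le> \<delta> \<longrightarrow> r \<le> norm \<eta> \<longrightarrow> norm \<eta> \<le> R \<longrightarrow>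
    conv f (kerns ep \<eta>) = (\<lambda>_. 0))"

text \<open>Both transforms are 1 near 0 and 0 far out, so the difference \<open>d\<close> lives on
  an annulus, where \<open>f\<close> has no spectrum. Convolution with narrow kernels at all
  frequencies detects this, and continuity upgrades the almost everywhere equality.\<close>

lemma conv_kerns_independent:
  fixes f :: "real^'n \<Rightarrow> complex"
  assumes b: "\<beta> \<ge> 0" and f: "pbd \<beta> f" and sp: "spectrum_at_0 f" and e: "0 < ep" "2 * ep \<le> L"
  shows "conv f (kerns L 0) = conv f (kerns ep 0)"
proof -
  have L: "L > 0" using e by simp
  define d where "d x = kerns L 0 x - kerns ep 0 x" for x :: "real^'n"
  define F where "F = conv f d"
  note KL = wint_kerns[OF L, of \<beta> "0::real^'n"] and Ke = wint_kerns[OF e(1), of \<beta> "0::real^'n"]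
  have d: "wint \<beta> d" unfolding d_def by (intro wint_diff KL Ke)
  have F: "pbd \<beta> F" unfolding F_def by (rule pbd_conv[OF b f d])
  have hd: "hat d \<xi> = hat (kerns L 0) \<xi> - hat (kerns ep 0) \<xi>" for \<xi>
    unfolding d_def by (rule hat_diff[OF integrable_kerns[OF L] integrable_kerns[OF e(1)]])
  obtain \<delta> where \<delta>: "\<delta> > 0" "\<And>ep' \<eta>. 0 < ep' \<Longrightarrow> ep' \<le> \<delta> \<Longrightarrow> ep / 2 \<le> norm \<eta> \<Longrightarrow> norm \<eta> \<le> 3 * L \<Longrightarrow> conv f (kerns ep' \<eta>) = (\<lambda>_. 0)"
    using sp[unfolded spectrum_at_0_def, rule_format, of "ep / 2" "3 * L"] e(1) by auto
  \<comment> \<open>The bound ep/4 keeps the support radius 2\<delta>' at most ep/2. Thus \<eta>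
    inside radius ep/2 only sees frequencies up to ep, where both plateaus are 1, and \<eta> beyond
    3L only sees frequencies from 2L on, where both are 0.\<close>
  define \<delta>' where "\<delta>' = min \<delta> (ep / 4)"
  have \<delta>': "\<delta>' > 0" "\<delta>' \<le> \<delta>" "\<delta>' \<le> ep / 4" using \<delta>(1) e(1) by (simp_all add: \<delta>'_def)
  note K = wint_kerns[OF \<delta>'(1), of \<beta>]
  have "conv F (kerns \<delta>' \<eta>) = (\<lambda>_. 0)" for \<eta>
  proof (cases "ep / 2 \<le> norm \<eta> \<and> norm \<eta> \<le> 3 * L")
    case True
    then show ?thesis unfolding F_def conv_conv_commute[OF b f d K] using \<delta>(2) \<delta>' by simp
  next
    case False
    have "conv F (kerns \<delta>' \<eta>) = conv f (\<lambda>_. 0)"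
      unfolding F_def
    proof (rule conv_conv_eq_if_hat[OF b f d K])
      show "wint \<beta> (\<lambda>_::real^'n. 0)" by (simp add: wint_def)
      fix \<xi>
      show "hat d \<xi> * hat (kerns \<delta>' \<eta>) \<xi> = hat (\<lambda>_. 0) \<xi>"
      proof (cases "norm (\<xi> - \<eta>) \<ge> 2 * \<delta>'")
        case True then show ?thesis by (simp add: hat_kerns_eq_0[OF \<delta>'(1)] hat_def[of "\<lambda>_. 0"])
      next
        case n: False
        have "hat d \<xi> = 0"
        proof (cases "norm \<eta> < ep / 2")
          case True
          have "norm \<xi> \<le> norm (\<xi> - \<eta>) + norm \<eta>" using norm_triangle_ineq[of "\<xi> - \<eta>" \<eta>] by simp
          then have "norm \<xi> \<le> ep" using n True \<delta>' by simp
          then show ?thesis unfolding hd using hat_kerns_eq_1[OF L, of \<xi> 0] hat_kerns_eq_1[OF e(1), of \<xi> 0] e by simp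
        next
          case f: False
          have "norm \<eta> \<le> norm \<xi> + norm (\<xi> - \<eta>)" using norm_triangle_ineq4[of \<xi> "\<xi> - \<eta>"] by simp
          then have "norm \<xi> \<ge> 2 * L" using n f False \<delta>' e by simp
          then show ?thesis unfolding hd using hat_kerns_eq_0[OF L, of \<xi> 0] hat_kerns_eq_0[OF e(1), of \<xi> 0] e by simp
        qed
        then show ?thesis by (simp add: hat_def[of "\<lambda>_. 0"])
      qed
    qed
    then show ?thesis by simp
  qed
  then have "AE x in lborel. F x = 0" by (rule AE_eq_0_if_conv_kerns[OF b F \<delta>'(1)])
  moreover have Feq: "F x = conv f (kerns L 0) x - conv f (kerns ep 0) x" for x
    unfolding F_def d_def by (rule conv_diff_right[OF b f KL Ke])
  ultimately have "AE x in lborel. conv f (kerns L 0) x = conv f (kerns ep 0) x" by simp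
  then show ?thesis
    by (intro continuous_AE_imp_eq continuous_conv_rapid[OF b f] rapid_kerns L e)
qed

lemma spectrum_at_0_AE_eq:
  fixes f :: "real^'n \<Rightarrow> complex"
  assumes b: "\<beta> \<ge> 0" and f: "pbd \<beta> f" and sp: "spectrum_at_0 f"
  shows "AE x in lborel. f x = conv f (kerns 1 0) x"
proof -
  let ?f0 = "conv f (kerns 1 0)"
  have f0: "pbd \<beta> ?f0" by (intro pbd_conv[OF b f] wint_kerns) simp
  have "conv (\<lambda>x. f x - ?f0 x) (kerns 1 \<eta>) = (\<lambda>_. 0)" for \<eta>
  proof -
    \<comment> \<open>The plateau of width \<open>L\<close> contains the ball of radius 2 around
      \<eta> that carries the transform of \<open>kerns 1 \<eta>\<close>; replacing the low-pass
      width 1 by \<open>L\<close> is free by independence of the width.\<close>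
    define L where "L = norm \<eta> + 2"
    have L: "L > 0" "2 * 1 \<le> L" by (auto simp: L_def add_nonneg_pos)
    have "conv ?f0 (kerns 1 \<eta>) = conv (conv f (kerns L 0)) (kerns 1 \<eta>)"
      using conv_kerns_independent[OF b f sp _ L(2)] by simp
    also have "\<dots> = conv f (kerns 1 \<eta>)"
    proof (rule conv_conv_eq_if_hat[OF b f wint_kerns[OF L(1)] wint_kerns wint_kerns])
      fix \<xi>
      show "hat (kerns L 0) \<xi> * hat (kerns 1 \<eta>) \<xi> = hat (kerns 1 \<eta>) \<xi>"
      proof (cases "norm (\<xi> - \<eta>) \<ge> 2")
        case True then show ?thesis by (simp add: hat_kerns_eq_0)
      next
        case False
        have "norm \<xi> \<le> norm (\<xi> - \<eta>) + norm \<eta>" using norm_triangle_ineq[of "\<xi> - \<eta>" \<eta>] by simp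
        then have "norm \<xi> \<le> L" using False by (simp add: L_def)
        then show ?thesis using hat_kerns_eq_1[OF L(1), of \<xi> 0] by simp
      qed
    qed auto
    finally have "conv ?f0 (kerns 1 \<eta>) = conv f (kerns 1 \<eta>)" .
    then show ?thesis
      using conv_diff_left[OF b f f0 wint_kerns[of 1]] by (simp add: fun_eq_iff)
  qed
  then have "AE x in lborel. f x - ?f0 x = 0"
    by (rule AE_eq_0_if_conv_kerns[OF b pbd_diff[OF f f0] zero_less_one])
  then show ?thesis by simp
qed

text \<open>With \<open>ep\<close> at most 1/2 the narrow transform sits inside the wide plateau, so
  the double convolution reduces to the narrow one, which equals the wide one by independence of the
  width.\<close>

lemma conv_kerns_reproducing:
  fixes f :: "real^'n \<Rightarrow> complex"
  assumes b: "\<beta> \<ge> 0" and f: "pbd \<beta> f" and sp: "spectrum_at_0 f" and e: "0 < ep" "ep \<le> 1 / 2"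
  shows "conv (conv f (kerns 1 0)) (kerns ep 0) = conv f (kerns 1 0)"
proof -
  have "conv (conv f (kerns 1 0)) (kerns ep 0) = conv f (kerns ep 0)"
  proof (rule conv_conv_eq_if_hat[OF b f wint_kerns wint_kerns[OF e(1)] wint_kerns[OF e(1)]])
    fix \<xi> :: "real^'n"
    show "hat (kerns 1 0) \<xi> * hat (kerns ep 0) \<xi> = hat (kerns ep 0) \<xi>"
    proof (cases "norm \<xi> \<ge> 2 * ep")
      case True then show ?thesis using hat_kerns_eq_0[OF e(1), of \<xi> 0] by simp
    next
      case False then show ?thesis using hat_kerns_eq_1[of 1 \<xi> 0] e by simp
    qed
  qed auto
  also have "\<dots> = conv f (kerns 1 0)"
    using conv_kerns_independent[OF b f sp e(1), of 1] e by simp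
  finally show ?thesis .
qed

subsection \<open>Vanishing finite differences and polynomials\<close>

text \<open>The innermost difference is split off, so an induction can hand the hypotheses on a
  function over to its first difference. The type asks only for an addition, as the operator is used
  on vectors, reals and naturals.\<close>

fun fdiff :: "'a::plus \<Rightarrow> nat \<Rightarrow> ('a \<Rightarrow> complex) \<Rightarrow> 'a \<Rightarrow> complex" where
  "fdiff h 0 f = f"
| "fdiff h (Suc n) f = fdiff h n (\<lambda>x. f (x + h) - f x)"

lemma fdiff_pullback:
  assumes "\<And>s. g (s + t) = g s + h"
  shows "fdiff t n (\<lambda>s. f (g s)) s = fdiff h n f (g s)"
  by (induction n arbitrary: f) (simp_all add: assms)

lemma wint_shift:
  assumes b: "\<beta> \<ge> 0" and w: "wint \<beta> w" shows "wint \<beta> (\<lambda>y. w (h + y))"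
proof -
  note [measurable] = wint_measurable[OF w]
  have i: "integrable lborel (\<lambda>y. wt \<beta> (h + y) * norm (w (h + y)))"
    using wint_integrable_wt[OF w] by (subst integrable_lborel_translate_iff)
  have "integrable lborel (\<lambda>y. wt \<beta> y * norm (w (h + y)))"
  proof (rule integrable_boundI[OF integrable_mult_right[OF i, of "wt \<beta> h"]])
    fix y
    have "wt \<beta> y \<le> wt \<beta> h * wt \<beta> (h + y)" using wt_diff[OF b, of "h + y" h] by (simp add: mult.commute)
    then show "norm (wt \<beta> y * norm (w (h + y))) \<le> wt \<beta> h * (wt \<beta> (h + y) * norm (w (h + y)))"
      by (simp add: mult_right_mono flip: mult.assoc)
  qed measurable
  then show ?thesis by (simp add: wint_def)
qed

lemma pbd_shift:
  assumes b: "\<beta> \<ge> 0" and f: "pbd \<beta> f" shows "pbd \<beta> (\<lambda>x. f (x + h))"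
proof -
  note [measurable] = pbd_measurable[OF f]
  obtain C where C: "C \<ge> 0" "\<And>x. norm (f x) \<le> C * wt \<beta> x" using pbdE[OF f] by blast
  have "norm (f (x + h)) \<le> (C * wt \<beta> h) * wt \<beta> x" for x
  proof -
    have "norm (f (x + h)) \<le> C * (wt \<beta> x * wt \<beta> h)"
      using C wt_add[OF b, of x h] by (meson mult_left_mono order_trans)
    then show ?thesis by (simp add: mult_ac)
  qed
  then show ?thesis unfolding pbd_def by auto
qed

lemma conv_shift_right: "conv f w (x + h) = conv f (\<lambda>y. w (h + y)) x"
  unfolding conv_def by (subst integral_lborel_translate[of _ h]) (simp add: algebra_simps)

lemma conv_shift_left: "conv (\<lambda>x. f (x + h)) w x = conv f w (x + h)"
  unfolding conv_def by (simp add: algebra_simps)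

text \<open>The difference of a reproduced function is the convolution of that function with the
  difference of the kernel, and it is again reproduced. Each step therefore gains a factor
  proportional to \<open>ep * norm h\<close>.\<close>

lemma fdiff_reproducing_bound:
  fixes F :: "real^'n \<Rightarrow> complex"
  assumes b: "\<beta> \<ge> 0" and e: "0 < ep" "ep \<le> 1" and h: "ep * norm h \<le> 1"
    and C: "C \<ge> 0" "\<And>h::real^'n. norm h \<le> 1 \<Longrightarrow> (\<integral>x. wt \<beta> x * norm (kern (x + h) - kern x) \<partial>lborel) \<le> C * norm h"
    and F: "pbd \<beta> F" "conv F (kerns ep 0) = F" and A: "\<And>x. norm (F x) \<le> A * wt \<beta> (ep *\<^sub>R x)"
  shows "norm (fdiff h n F x) \<le> A * (C * (ep * norm h)) ^ n * wt \<beta> (ep *\<^sub>R x)"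
  using F A
proof (induction n arbitrary: F A)
  case 0 then show ?case by simp
next
  case (Suc n)
  note F = Suc.prems(1,2) and A = Suc.prems(3)
  have A0: "A \<ge> 0" using order_trans[OF norm_ge_zero A[of 0]] by simp
  let ?G = "\<lambda>x. F (x + h) - F x"
  let ?w = "\<lambda>y. kerns ep 0 (h + y) - kerns ep 0 y"
  note K = wint_kerns[OF e(1), of \<beta> "0::real^'n"]
  have w: "wint \<beta> ?w" by (intro wint_diff wint_shift b K)
  have G: "pbd \<beta> ?G" by (intro pbd_diff pbd_shift b F)
  have Gr: "conv ?G (kerns ep 0) = ?G"
    by (rule ext) (simp add: conv_diff_left[OF b pbd_shift[OF b F(1)] F(1) K] conv_shift_left F(2))
  have Gc: "?G x = conv F ?w x" for x
  proof -
    have "conv F ?w x = conv F (kerns ep 0) (x + h) - conv F (kerns ep 0) x"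
      unfolding conv_shift_right by (rule conv_diff_right[OF b F(1) wint_shift[OF b K] K])
    then show ?thesis by (simp add: F(2))
  qed
  have "(\<integral>y. wt \<beta> (ep *\<^sub>R y) * norm (?w y) \<partial>lborel)
    = (\<integral>y. ep ^ CARD('n) * (wt \<beta> (ep *\<^sub>R y) * norm (kern (ep *\<^sub>R y + ep *\<^sub>R h) - kern (ep *\<^sub>R y))) \<partial>lborel)"
    using e by (intro Bochner_Integration.integral_cong refl)
      (simp add: kerns_def scaleR_add_right add.commute norm_mult norm_power flip: right_diff_distrib)
  also have "\<dots> = ep ^ CARD('n) * (\<integral>y. wt \<beta> (ep *\<^sub>R y) * norm (kern (ep *\<^sub>R y + ep *\<^sub>R h) - kern (ep *\<^sub>R y)) \<partial>lborel)"
    by (rule integral_mult_right_zero)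
  \<comment> \<open>Substituting x for \<open>ep *\<^sub>R y\<close> undoes the dilation in kernel
    and weight at once; this is why the weight is dilated by exactly \<open>ep\<close>.\<close>
  also have "\<dots> = (\<integral>x. wt \<beta> x * norm (kern (x + ep *\<^sub>R h) - kern x) \<partial>lborel)"
    using e by (subst (2) integral_lborel_affine[of ep _ 0]) simp_all
  also have "\<dots> \<le> C * norm (ep *\<^sub>R h)"
    using h e by (intro C) simp
  finally have I: "(\<integral>y. wt \<beta> (ep *\<^sub>R y) * norm (?w y) \<partial>lborel) \<le> C * (ep * norm h)" using e by simp
  have "norm (?G x) \<le> (A * (C * (ep * norm h))) * wt \<beta> (ep *\<^sub>R x)" for x
    unfolding Gc
    by (rule order_trans[OF norm_conv_le_scaled[OF b less_imp_le[OF e(1)] e(2) F(1) w A]])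
      (intro mult_right_mono mult_left_mono I A0, simp)
  from Suc.IH[OF G Gr this] show ?case by (simp add: mult.assoc)
qed

text \<open>The dilated weight costs \<open>ep powr (- \<beta>)\<close>, the K differences gain
  \<open>ep ^ K\<close>, and everything else is bounded for fixed \<open>h\<close> and
  \<open>x\<close>, so \<open>ep\<close> may tend to 0.\<close>

lemma fdiff_eq_0:
  fixes F :: "real^'n \<Rightarrow> complex"
  assumes b: "\<beta> \<ge> 0" and F: "pbd \<beta> F" and rep: "\<And>ep. 0 < ep \<Longrightarrow> ep \<le> 1 / 2 \<Longrightarrow> conv F (kerns ep 0) = F"
    and K: "real K > \<beta>"
  shows "fdiff h K F x = 0"
proof -
  obtain C where C: "C \<ge> 0" "\<And>h::real^'n. norm h \<le> 1 \<Longrightarrow> (\<integral>x. wt \<beta> x * norm (kern (x + h) - kern x) \<partial>lborel) \<le> C * norm h"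
    using kern_weighted_lipschitz[OF b, where 'n='n] by auto
  obtain A where A: "A \<ge> 0" "\<And>x. norm (F x) \<le> A * wt \<beta> x" using pbdE[OF F] by blast
  have le: "norm (fdiff h K F x) \<le> (A * (C * norm h) ^ K * wt \<beta> x) * ep powr (real K - \<beta>)"
    if e: "0 < ep" "ep \<le> 1 / 2" "ep * norm h \<le> 1" for ep
  proof -
    have A': "norm (F x) \<le> (A * ep powr (- \<beta>)) * wt \<beta> (ep *\<^sub>R x)" for x
    proof -
      have "norm (F x) \<le> A * (ep powr (- \<beta>) * wt \<beta> (ep *\<^sub>R x))"
        using A wt_le_scaled[OF b e(1), of x] e by (intro order_trans[OF A(2)] mult_left_mono) auto
      then show ?thesis by (simp add: mult.assoc)
    qed
    have "norm (fdiff h K F x) \<le> (A * ep powr (- \<beta>)) * (C * (ep * norm h)) ^ K * wt \<beta> (ep *\<^sub>R x)"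
      by (rule fdiff_reproducing_bound[OF b e(1) _ e(3) C F rep[OF e(1,2)] A']) (use e in auto)
    also have "\<dots> \<le> (A * ep powr (- \<beta>)) * (C * (ep * norm h)) ^ K * wt \<beta> x"
      using e A C by (intro mult_left_mono wt_scaled_le b) auto
    also have "\<dots> = (A * (C * norm h) ^ K * wt \<beta> x) * (ep powr (- \<beta>) * ep powr real K)"
      using e by (simp add: power_mult_distrib powr_realpow)
    also have "ep powr (- \<beta>) * ep powr real K = ep powr (real K - \<beta>)"
      by (simp flip: powr_add)
    finally show ?thesis .
  qed
  let ?e = "\<lambda>j. 1 / real (Suc j)"
  have e0: "?e \<longlonglongrightarrow> 0" by (rule lim_1_over_n[THEN LIMSEQ_Suc])
  have "\<forall>\<^sub>F j in sequentially. ?e j < 1 / 2" using e0 by (rule order_tendstoD) simp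
  moreover have "\<forall>\<^sub>F j in sequentially. ?e j * norm h < 1"
    by (rule order_tendstoD[OF tendsto_mult_left_zero[OF e0]]) simp
  ultimately have ev: "\<forall>\<^sub>F j in sequentially. norm (fdiff h K F x) \<le> (A * (C * norm h) ^ K * wt \<beta> x) * ?e j powr (real K - \<beta>)"
    by eventually_elim (rule le, auto)
  have "(\<lambda>j. (A * (C * norm h) ^ K * wt \<beta> x) * ?e j powr (real K - \<beta>)) \<longlonglongrightarrow> (A * (C * norm h) ^ K * wt \<beta> x) * 0"
    by (intro tendsto_mult tendsto_const tendsto_zero_powrI[OF e0 tendsto_const]) (use K in auto)
  from tendsto_lowerbound[OF this ev] have "norm (fdiff h K F x) \<le> 0" by simp
  then show ?thesis by simp
qed

section \<open>One variable: vanishing differences force a polynomial\<close>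

text \<open>Newton's forward difference formula: summing the expansion of the first difference
  raises each lower binomial index by one, by Pascal's rule.\<close>

lemma fdiff_nat_eq_0_imp_binomial_sum:
  fixes a :: "nat \<Rightarrow> complex"
  assumes "\<And>k. fdiff 1 n a k = 0"
  shows "\<exists>c. \<forall>k. a k = (\<Sum>j<n. c j * of_nat (k choose j))"
  using assms
proof (induction n arbitrary: a)
  case 0 then show ?case by simp
next
  case (Suc n)
  have "fdiff 1 n (\<lambda>k. a (k + 1) - a k) k = 0" for k using Suc.prems by simp
  from Suc.IH[OF this] obtain c where c: "\<And>k. a (k + 1) - a k = (\<Sum>j<n. c j * of_nat (k choose j))" by blast
  have A: "a k = a 0 + (\<Sum>j<n. c j * of_nat (k choose Suc j))" for k
  proof (induction k)
    case (Suc k)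
    have "a (Suc k) = a k + (\<Sum>j<n. c j * of_nat (k choose j))" using c[of k] by (simp add: algebra_simps)
    then show ?case by (simp add: Suc sum.distrib distrib_left)
  qed simp
  have "a k = (\<Sum>j<Suc n. (case j of 0 \<Rightarrow> a 0 | Suc i \<Rightarrow> c i) * of_nat (k choose j))" for k
    using A[of k] by (subst sum.lessThan_Suc_shift) simp
  then show ?case by (intro exI[of _ "case_nat (a 0) c"] allI)
qed

lemma binomial_poly:
  "\<exists>p :: complex poly. degree p \<le> j \<and> (\<forall>k. poly p (of_nat k) = of_nat (k choose j))"
proof (intro exI conjI allI)
  let ?p = "smult (1 / fact j) (\<Prod>i<j. [:- of_nat i, 1:]) :: complex poly"
  have "degree (\<Prod>i<j. [:- of_nat i, 1:] :: complex poly) \<le> (\<Sum>i<j. degree ([:- of_nat i, 1:] :: complex poly))"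
    using degree_prod_sum_le[of "{..<j}" "\<lambda>i. [:- of_nat i, 1:] :: complex poly"] by (simp add: o_def)
  then show "degree ?p \<le> j" by simp
  show "poly ?p (of_nat k) = of_nat (k choose j)" for k
    by (simp add: poly_prod binomial_gbinomial gbinomial_prod_rev lessThan_atLeast0)
qed

lemma fdiff_nat_eq_0_imp_poly:
  fixes a :: "nat \<Rightarrow> complex"
  assumes "\<And>k. fdiff 1 n a k = 0"
  obtains p :: "complex poly" where "degree p \<le> n" "\<And>k. a k = poly p (of_nat k)"
proof -
  obtain c where c: "\<And>k. a k = (\<Sum>j<n. c j * of_nat (k choose j))"
    using fdiff_nat_eq_0_imp_binomial_sum[OF assms] by blast
  obtain B :: "nat \<Rightarrow> complex poly" where B: "\<And>j. degree (B j) \<le> j" "\<And>j k. poly (B j) (of_nat k) = of_nat (k choose j)"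
    using binomial_poly by metis
  show thesis
  proof (rule that)
    show "degree (\<Sum>j<n. smult (c j) (B j)) \<le> n"
      by (intro degree_sum_le order_trans[OF degree_smult_le] order_trans[OF B(1)]) auto
    show "a k = poly (\<Sum>j<n. smult (c j) (B j)) (of_nat k)" for k
      by (simp add: c poly_sum B)
  qed
qed

text \<open>The Lagrange basis polynomial for the nodes 0 to n. In this basis the coefficients are
  values of the interpolated function, which is what allows an induction over coordinates
  later.\<close>

definition lagrange :: "nat \<Rightarrow> nat \<Rightarrow> complex poly" where
  "lagrange n j = (\<Prod>i\<in>{..n} - {j}. smult (1 / (of_nat j - of_nat i)) [:- of_nat i, 1:])"

lemma degree_lagrange: "j \<le> n \<Longrightarrow> degree (lagrange n j) \<le> n"
proof -
  assume "j \<le> n"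
  have "degree (lagrange n j) \<le> (\<Sum>i\<in>{..n} - {j}. degree (smult (1 / (of_nat j - of_nat i)) [:- of_nat i, 1:] :: complex poly))"
    unfolding lagrange_def
    using degree_prod_sum_le[of "{..n} - {j}" "\<lambda>i. smult (1 / (of_nat j - of_nat i)) [:- of_nat i, 1:] :: complex poly"]
    by (simp add: o_def)
  also have "\<dots> \<le> (\<Sum>i\<in>{..n} - {j}. 1)"
    by (intro sum_mono order_trans[OF degree_smult_le]) simp
  also have "\<dots> = n" using \<open>j \<le> n\<close> by simp
  finally show ?thesis .
qed

lemma poly_lagrange: "j \<le> n \<Longrightarrow> k \<le> n \<Longrightarrow> poly (lagrange n j) (of_nat k) = (if k = j then 1 else 0)"
proof (cases "k = j")
  case True
  have "poly (smult (1 / (of_nat j - of_nat i)) [:- of_nat i, 1:]) (of_nat j) = (1::complex)" if "i \<noteq> j" for i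
    using that by (simp flip: diff_divide_distrib)
  then show ?thesis using True unfolding lagrange_def poly_prod by (auto intro!: prod.neutral)
next
  case False
  assume "k \<le> n"
  then show ?thesis using False unfolding lagrange_def poly_prod by (auto intro!: prod_zero)
qed

text \<open>On every grid of mesh 1/M the function agrees with some polynomial of degree at most n.
  All these grids contain the nodes 0 to n, so that polynomial must be the interpolant
  \<open>I\<close>; density of the grids and continuity finish.\<close>

lemma continuous_fdiff_eq_0_imp_lagrange:
  fixes f :: "real \<Rightarrow> complex"
  assumes cont: "continuous_on UNIV f" and fd: "\<And>h x. fdiff h n f x = 0"
  shows "f t = (\<Sum>j\<le>n. f (real j) * poly (lagrange n j) (of_real t))"
proof -
  define I where "I = (\<Sum>j\<le>n. smult (f (real j)) (lagrange n j))"
  have dI: "degree I \<le> n" unfolding I_def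
    by (intro degree_sum_le order_trans[OF degree_smult_le] degree_lagrange) auto
  have I: "poly I (of_nat k) = f (real k)" if "k \<le> n" for k
    using that by (simp add: I_def poly_sum poly_lagrange if_distrib[of "\<lambda>t. _ * t"] cong: if_cong)
  have grid: "f (- real A + real k / real M) = poly I (of_real (- real A + real k / real M))" if M: "M > 0" for A k M :: nat
  proof -
    have "fdiff 1 n (\<lambda>k. f (- real A + real k / real M)) k = 0" for k
      using fdiff_pullback[of "\<lambda>k. - real A + real k / real M" 1 "1 / real M" n f k] fd by (simp add: add_divide_distrib)
    then obtain p where p: "degree p \<le> n" "\<And>k. f (- real A + real k / real M) = poly p (of_nat k)"
      by (rule fdiff_nat_eq_0_imp_poly) blast
    define q where "q = pcompose I [:- of_nat A, 1 / of_nat M:]"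
    have q: "poly q (of_nat k) = poly I (of_real (- real A + real k / real M))" for k
      by (simp add: q_def poly_pcompose)
    \<comment> \<open>In the grid starting at -A with mesh 1/M, the node j has index M(A + j). These
      n + 1 indices determine a polynomial of degree at most n.\<close>
    have "p = q"
    proof (rule poly_eqI_degree[where A="(\<lambda>j. of_nat (M * (A + j))) ` {..n}"])
      have c: "card ((\<lambda>j. of_nat (M * (A + j))) ` {..n} :: complex set) = Suc n"
        using M by (subst card_image) (auto simp: inj_on_def simp del: of_nat_mult of_nat_add)
      show "degree p < card ((\<lambda>j. of_nat (M * (A + j))) ` {..n} :: complex set)" using p c by simp
      have "degree q \<le> degree I * degree [:- of_nat A, 1 / of_nat M :: complex:]"
        unfolding q_def by (rule degree_pcompose_le)
      also have "\<dots> \<le> n" using dI by (simp split: if_splits)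
      finally show "degree q < card ((\<lambda>j. of_nat (M * (A + j))) ` {..n} :: complex set)" using c by simp
      fix x :: complex assume "x \<in> (\<lambda>j. of_nat (M * (A + j))) ` {..n}"
      then obtain j where j: "j \<le> n" "x = of_nat (M * (A + j))" by auto
      have *: "- real A + real (M * (A + j)) / real M = real j" using M by simp
      show "poly p x = poly q x" unfolding j(2) q p(2)[symmetric] * using I[OF j(1)] by simp
    qed
    then show ?thesis using p(2) q by simp
  qed
  define A where "A = nat \<lceil>\<bar>t\<bar>\<rceil>"
  \<comment> \<open>The grid points of mesh 1/(m+1) just below t. Choosing \<open>A\<close> at least
    the absolute value of t keeps the index nonnegative, so \<open>nat\<close> does not truncate
    it.\<close>
  define X where "X m = - real A + real (nat \<lfloor>(t + real A) * real (Suc m)\<rfloor>) / real (Suc m)" for m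
  have tA: "t + real A \<ge> 0" unfolding A_def by linarith
  have Xt: "X \<longlonglongrightarrow> t"
  proof (rule LIMSEQ_I)
    fix r :: real assume "r > 0"
    then obtain N where N: "1 / real (Suc N) < r" by (metis nat_approx_posE)
    have "norm (X m - t) < r" if "m \<ge> N" for m
    proof -
      let ?y = "(t + real A) * real (Suc m)"
      have y: "?y \<ge> 0" using tA by simp
      then have f: "real (nat \<lfloor>?y\<rfloor>) \<le> ?y" "?y < real (nat \<lfloor>?y\<rfloor>) + 1" by linarith+
      have "X m - t = (real (nat \<lfloor>?y\<rfloor>) - ?y) / real (Suc m)" by (simp add: X_def field_simps)
      then have "norm (X m - t) = \<bar>real (nat \<lfloor>?y\<rfloor>) - ?y\<bar> / real (Suc m)" by (simp only: real_norm_def abs_divide abs_of_nat)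
      also have "\<dots> \<le> 1 / real (Suc m)" using f by (intro divide_right_mono) linarith+
      also have "\<dots> \<le> 1 / real (Suc N)" using that by (simp add: frac_le)
      finally show ?thesis using N by simp
    qed
    then show "\<exists>N. \<forall>m\<ge>N. norm (X m - t) < r" by (intro exI[of _ N]) simp
  qed
  have "isCont f t" using cont by (simp add: continuous_on_eq_continuous_at)
  then have "(\<lambda>m. f (X m)) \<longlonglongrightarrow> f t" using Xt by (rule isCont_tendsto_compose)
  moreover have "(\<lambda>m. poly I (of_real (X m))) \<longlonglongrightarrow> poly I (of_real t)"
    by (intro tendsto_intros Xt)
  moreover have "f (X m) = poly I (of_real (X m))" for m
    unfolding X_def by (rule grid) simp
  ultimately have "f t = poly I (of_real t)" by (simp add: LIMSEQ_unique)
  then show ?thesis by (simp add: I_def poly_sum)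
qed

section \<open>Polynomials in several variables\<close>

lemma finite_multi_index: "finite {\<alpha> :: 'n::finite \<Rightarrow> nat. sum \<alpha> UNIV \<le> d}"
proof (rule finite_subset)
  show "{\<alpha> :: 'n \<Rightarrow> nat. sum \<alpha> UNIV \<le> d} \<subseteq> PiE UNIV (\<lambda>_. {..d})"
  proof
    fix \<alpha> :: "'n \<Rightarrow> nat" assume "\<alpha> \<in> {\<alpha>. sum \<alpha> UNIV \<le> d}"
    moreover have "\<alpha> i \<le> sum \<alpha> UNIV" for i by (rule member_le_sum) auto
    ultimately show "\<alpha> \<in> PiE UNIV (\<lambda>_. {..d})" by (auto intro: order_trans)
  qed
qed (intro finite_PiE finite finite_atMost)

lemma poly_deg_le_mono:
  assumes "poly_deg_le d p" "d \<le> e" shows "poly_deg_le e p"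
proof -
  obtain c where c: "p = (\<lambda>x. \<Sum>\<alpha>\<in>{\<alpha>. sum \<alpha> UNIV \<le> d}. c \<alpha> * (\<Prod>i\<in>UNIV. of_real (x $ i) ^ \<alpha> i))"
    using assms(1) unfolding poly_deg_le_def by blast
  have "p x = (\<Sum>\<alpha>\<in>{\<alpha>. sum \<alpha> UNIV \<le> e}. (if sum \<alpha> UNIV \<le> d then c \<alpha> else 0) * (\<Prod>i\<in>UNIV. of_real (x $ i) ^ \<alpha> i))" for x
    unfolding c by (rule sum.mono_neutral_cong_left) (use assms(2) finite_multi_index in auto)
  then show ?thesis unfolding poly_deg_le_def by (intro exI[of _ "\<lambda>\<alpha>. if sum \<alpha> UNIV \<le> d then c \<alpha> else 0"] ext)
qed

lemma poly_fun_const: "poly_fun (\<lambda>_::real^'n. k)"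
proof -
  have S: "{\<alpha> :: 'n \<Rightarrow> nat. sum \<alpha> UNIV \<le> 0} = {\<lambda>_. 0}" by (auto simp: fun_eq_iff)
  have "poly_deg_le 0 (\<lambda>_::real^'n. k)"
    unfolding poly_deg_le_def S by (intro exI[of _ "\<lambda>_. k"]) simp
  then show ?thesis by (auto simp: poly_fun_def)
qed

lemma poly_fun_add:
  assumes "poly_fun p" "poly_fun q" shows "poly_fun (\<lambda>x. p x + q x)"
proof -
  obtain d e where "poly_deg_le d p" "poly_deg_le e q" using assms by (auto simp: poly_fun_def)
  then have "poly_deg_le (max d e) p" "poly_deg_le (max d e) q" using poly_deg_le_mono by (meson max.cobounded1 max.cobounded2)+
  then obtain a b where "p = (\<lambda>x. \<Sum>\<alpha>\<in>{\<alpha>. sum \<alpha> UNIV \<le> max d e}. a \<alpha> * (\<Prod>i\<in>UNIV. of_real (x $ i) ^ \<alpha> i))"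
    "q = (\<lambda>x. \<Sum>\<alpha>\<in>{\<alpha>. sum \<alpha> UNIV \<le> max d e}. b \<alpha> * (\<Prod>i\<in>UNIV. of_real (x $ i) ^ \<alpha> i))"
    unfolding poly_deg_le_def by blast
  then have "poly_deg_le (max d e) (\<lambda>x. p x + q x)"
    unfolding poly_deg_le_def by (intro exI[of _ "\<lambda>\<alpha>. a \<alpha> + b \<alpha>"]) (simp add: distrib_right sum.distrib)
  then show ?thesis by (auto simp: poly_fun_def)
qed

lemma poly_fun_cmult:
  assumes "poly_fun p" shows "poly_fun (\<lambda>x. k * p x)"
proof -
  obtain d c where "p = (\<lambda>x. \<Sum>\<alpha>\<in>{\<alpha>. sum \<alpha> UNIV \<le> d}. c \<alpha> * (\<Prod>i\<in>UNIV. of_real (x $ i) ^ \<alpha> i))"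
    using assms unfolding poly_fun_def poly_deg_le_def by blast
  then have "poly_deg_le d (\<lambda>x. k * p x)"
    unfolding poly_deg_le_def by (intro exI[of _ "\<lambda>\<alpha>. k * c \<alpha>"]) (simp add: sum_distrib_left mult.assoc)
  then show ?thesis by (auto simp: poly_fun_def)
qed

text \<open>Multiplication by a coordinate shifts multi-indices by the injective map
  \<open>inc\<close>; indices up to degree d + 1 outside its image have i-th entry 0 and receive
  coefficient 0.\<close>

lemma poly_fun_mult_coord:
  fixes p :: "real^'n \<Rightarrow> complex"
  assumes "poly_fun p" shows "poly_fun (\<lambda>x. p x * complex_of_real (x $ i))"
proof -
  let ?m = "\<lambda>\<alpha> x. \<Prod>i\<in>UNIV. of_real ((x::real^'n) $ i) ^ \<alpha> i"
  let ?S = "\<lambda>d. {\<alpha> :: 'n \<Rightarrow> nat. sum \<alpha> UNIV \<le> d}"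
  obtain d c where c: "p = (\<lambda>x. \<Sum>\<alpha>\<in>?S d. c \<alpha> * ?m \<alpha> x)"
    using assms unfolding poly_fun_def poly_deg_le_def by blast
  define inc where "inc \<alpha> = \<alpha>(i := Suc (\<alpha> i))" for \<alpha> :: "'n \<Rightarrow> nat"
  \<comment> \<open>The case distinction is essential: truncated subtraction would send an index
    with entry 0 to itself.\<close>
  define c' where "c' \<alpha> = (if \<alpha> i = 0 then 0 else c (\<alpha>(i := \<alpha> i - 1)))" for \<alpha> :: "'n \<Rightarrow> nat"
  have inj: "inj_on inc A" for A
    by (rule inj_onI) (metis inc_def fun_upd_triv fun_upd_upd fun_upd_same nat.inject)
  have sum_inc: "sum (inc \<alpha>) UNIV = Suc (sum \<alpha> UNIV)" for \<alpha>
  proof -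
    have "sum (inc \<alpha>) (UNIV - {i}) = sum \<alpha> (UNIV - {i})" by (intro sum.cong) (auto simp: inc_def)
    then show ?thesis using sum.remove[of UNIV i "inc \<alpha>"] sum.remove[of UNIV i \<alpha>] by (simp add: inc_def)
  qed
  have m_inc: "?m (inc \<alpha>) x = ?m \<alpha> x * complex_of_real (x $ i)" for \<alpha> x
  proof -
    have "(\<Prod>k\<in>UNIV - {i}. complex_of_real (x $ k) ^ inc \<alpha> k) = (\<Prod>k\<in>UNIV - {i}. complex_of_real (x $ k) ^ \<alpha> k)"
      by (intro prod.cong) (auto simp: inc_def)
    then show ?thesis
      using prod.remove[of UNIV i "\<lambda>k. complex_of_real (x $ k) ^ inc \<alpha> k"] prod.remove[of UNIV i "\<lambda>k. complex_of_real (x $ k) ^ \<alpha> k"]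
      by (simp add: inc_def)
  qed
  have "(\<Sum>\<alpha>\<in>?S (Suc d). c' \<alpha> * ?m \<alpha> x) = p x * complex_of_real (x $ i)" for x
  proof -
    have "(\<Sum>\<alpha>\<in>?S (Suc d). c' \<alpha> * ?m \<alpha> x) = (\<Sum>\<alpha>\<in>inc ` ?S d. c' \<alpha> * ?m \<alpha> x)"
    proof (rule sum.mono_neutral_right[OF finite_multi_index])
      show "inc ` ?S d \<subseteq> ?S (Suc d)" by (auto simp: sum_inc)
      show "\<forall>\<alpha>\<in>?S (Suc d) - inc ` ?S d. c' \<alpha> * ?m \<alpha> x = 0"
      proof
        fix \<alpha> assume \<alpha>: "\<alpha> \<in> ?S (Suc d) - inc ` ?S d"
        have "\<alpha> i = 0"
        proof (rule ccontr)
          assume "\<alpha> i \<noteq> 0"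
          then have eq: "\<alpha> = inc (\<alpha>(i := \<alpha> i - 1))" by (auto simp: inc_def)
          then have "sum (\<alpha>(i := \<alpha> i - 1)) UNIV \<le> d" using \<alpha> sum_inc[of "\<alpha>(i := \<alpha> i - 1)"] by auto
          then show False using \<alpha> eq by auto
        qed
        then show "c' \<alpha> * ?m \<alpha> x = 0" by (simp add: c'_def)
      qed
    qed
    also have "\<dots> = (\<Sum>\<alpha>\<in>?S d. c' (inc \<alpha>) * ?m (inc \<alpha>) x)"
      by (simp add: sum.reindex[OF inj])
    also have "\<dots> = (\<Sum>\<alpha>\<in>?S d. c \<alpha> * ?m \<alpha> x * complex_of_real (x $ i))"
      unfolding m_inc by (simp add: c'_def inc_def mult.assoc)
    finally show ?thesis by (simp add: c sum_distrib_right)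
  qed
  then have "poly_deg_le (Suc d) (\<lambda>x. p x * complex_of_real (x $ i))"
    unfolding poly_deg_le_def by (intro exI[of _ c']) auto
  then show ?thesis by (auto simp: poly_fun_def)
qed

lemma poly_fun_sum: "(\<And>j. j \<in> A \<Longrightarrow> poly_fun (p j)) \<Longrightarrow> poly_fun (\<lambda>x. \<Sum>j\<in>A. p j x)"
proof (induction A rule: infinite_finite_induct)
  case (insert a A)
  have "poly_fun (\<lambda>x. p a x + (\<Sum>j\<in>A. p j x))"
    by (rule poly_fun_add) (use insert in auto)
  then show ?case using insert.hyps by simp
qed (simp_all add: poly_fun_const)

lemma poly_fun_mult_poly:
  fixes p :: "real^'n \<Rightarrow> complex"
  assumes "poly_fun p" shows "poly_fun (\<lambda>x. p x * poly q (of_real (x $ i)))"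
proof (induction q rule: pCons_induct)
  case 0
  have "(\<lambda>x. p x * poly 0 (complex_of_real (x $ i))) = (\<lambda>x. 0)" by simp
  then show ?case using poly_fun_const[where 'n='n, of 0] by simp
next
  case (pCons a q)
  have "poly_fun (\<lambda>x. a * p x)" by (rule poly_fun_cmult[OF assms])
  moreover have "poly_fun (\<lambda>x. (p x * poly q (of_real (x $ i))) * complex_of_real (x $ i))"
    by (rule poly_fun_mult_coord[OF pCons.IH])
  ultimately have "poly_fun (\<lambda>x. a * p x + (p x * poly q (of_real (x $ i))) * complex_of_real (x $ i))"
    by (rule poly_fun_add)
  also have "(\<lambda>x. a * p x + (p x * poly q (of_real (x $ i))) * complex_of_real (x $ i))
    = (\<lambda>x. p x * poly (pCons a q) (of_real (x $ i)))"
    by (simp add: fun_eq_iff distrib_left)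
  finally show ?case .
qed

definition upd :: "real^'n \<Rightarrow> 'n \<Rightarrow> real \<Rightarrow> real^'n" where
  "upd x i t = (\<chi> j. if j = i then t else x $ j)"

text \<open>Induction over the set of coordinates on which \<open>F\<close> depends. Freezing
  coordinate i at a node gives a function of the remaining coordinates that inherits both
  hypotheses, since updates of different coordinates commute.\<close>

lemma poly_fun_if_coordinatewise:
  fixes F :: "real^'n \<Rightarrow> complex"
  assumes "\<And>i x. i \<in> S \<Longrightarrow> F x = (\<Sum>j\<le>n. F (upd x i (real j)) * poly (lagrange n j) (of_real (x $ i)))"
    and "\<And>x y. (\<And>i. i \<in> S \<Longrightarrow> x $ i = y $ i) \<Longrightarrow> F x = F y"
  shows "poly_fun F"
  using finite[of S] assms
proof (induction S arbitrary: F rule: finite_induct)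
  case empty
  have "F = (\<lambda>_. F 0)" by (rule ext) (rule empty.prems(2), simp)
  then show ?case by (rule ssubst[where P=poly_fun]) (rule poly_fun_const)
next
  case (insert i S)
  have "poly_fun (\<lambda>x. F (upd x i (real j)))" for j
  proof (rule insert.IH)
    fix k x assume k: "k \<in> S"
    then have ki: "k \<noteq> i" using insert.hyps by auto
    have "upd (upd x i s) k t = upd (upd x k t) i s" "upd x i s $ k = x $ k" for s t
      using ki by (auto simp: upd_def vec_eq_iff)
    then show "F (upd x i (real j)) = (\<Sum>l\<le>n. F (upd (upd x k (real l)) i (real j)) * poly (lagrange n l) (of_real (x $ k)))"
      using insert.prems(1)[of k "upd x i (real j)"] k by simp
  next
    fix x y :: "real^'n" assume "\<And>i. i \<in> S \<Longrightarrow> x $ i = y $ i"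
    then show "F (upd x i (real j)) = F (upd y i (real j))"
      by (intro insert.prems(2)) (auto simp: upd_def)
  qed
  then have p: "poly_fun (\<lambda>x. \<Sum>j\<le>n. F (upd x i (real j)) * poly (lagrange n j) (of_real (x $ i)))"
    by (intro poly_fun_sum poly_fun_mult_poly)
  have "F = (\<lambda>x. \<Sum>j\<le>n. F (upd x i (real j)) * poly (lagrange n j) (of_real (x $ i)))"
    by (rule ext) (rule insert.prems(1), simp)
  then show ?case by (rule ssubst[where P=poly_fun]) (rule p)
qed

text \<open>Along a line parallel to an axis the differences of the restriction are differences of
  \<open>F\<close> in the axis direction, so the one-variable result applies in each coordinate with
  the same n.\<close>

lemma poly_fun_if_fdiff_eq_0:
  fixes F :: "real^'n \<Rightarrow> complex"
  assumes cont: "continuous_on UNIV F" and fd: "\<And>h x. fdiff h n F x = 0"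
  shows "poly_fun F"
proof (rule poly_fun_if_coordinatewise[where S=UNIV and n=n])
  fix i and x :: "real^'n"
  define b where "b = upd x i 0"
  have u: "upd x i t = b + t *\<^sub>R axis i 1" for t
    by (auto simp: b_def upd_def vec_eq_iff axis_def)
  have xi: "upd x i (x $ i) = x" by (auto simp: upd_def vec_eq_iff)
  have "F (upd x i t) = (\<Sum>j\<le>n. F (upd x i (real j)) * poly (lagrange n j) (of_real t))" for t
  proof (rule continuous_fdiff_eq_0_imp_lagrange)
    show "continuous_on UNIV (\<lambda>t. F (upd x i t))"
      unfolding u by (intro continuous_on_compose2[OF cont] continuous_intros) auto
    show "fdiff h n (\<lambda>t. F (upd x i t)) s = 0" for h s
    proof -
      have "upd x i (s + h) = upd x i s + h *\<^sub>R axis i 1" for s by (simp add: u scaleR_add_left)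
      from fdiff_pullback[of "upd x i", OF this] show ?thesis by (simp add: fd)
    qed
  qed
  from this[of "x $ i"] show "F x = (\<Sum>j\<le>n. F (upd x i (real j)) * poly (lagrange n j) (of_real (x $ i)))"
    by (simp add: xi)
qed (metis UNIV_I vec_eq_iff)

section \<open>Growth bounds the degree\<close>

text \<open>The reflected polynomial at s is s^deg q(1/s), which tends to the leading coefficient as
  s tends to 0. The growth bound makes it at most a multiple of s^(deg - \<beta>) (1 + s)^\<beta>,
  which tends to 0 once the degree exceeds \<beta>.\<close>

lemma poly_growth_imp_coeff_eq_0:
  fixes q :: "complex poly"
  assumes b: "\<beta> \<ge> 0" and C: "\<And>t. t \<ge> 0 \<Longrightarrow> norm (poly q (of_real t)) \<le> C * (1 + t) powr \<beta>"
    and j: "j > nat \<lfloor>\<beta>\<rfloor>"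
  shows "coeff q j = 0"
proof (rule ccontr)
  assume "coeff q j \<noteq> 0"
  then have "j \<le> degree q" by (rule le_degree)
  then have D: "real (degree q) > \<beta>" using j by linarith
  let ?s = "\<lambda>n. 1 / real (Suc n)"
  have s0: "?s \<longlonglongrightarrow> 0" by (rule lim_1_over_n[THEN LIMSEQ_Suc])
  have le: "norm (poly (reflect_poly q) (of_real (?s n))) \<le> C * (?s n powr (real (degree q) - \<beta>) * (1 + ?s n) powr \<beta>)" for n
  proof -
    have s: "?s n > 0" by simp
    have "poly (reflect_poly q) (of_real (?s n)) = complex_of_real (?s n) ^ degree q * poly q (of_real (real (Suc n)))"
      by (subst poly_reflect_poly_nz) (auto simp del: of_nat_Suc)
    then have "norm (poly (reflect_poly q) (of_real (?s n))) = ?s n ^ degree q * norm (poly q (of_real (real (Suc n))))"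
      by (simp add: norm_mult norm_power norm_divide del: of_nat_Suc)
    also have "\<dots> \<le> ?s n ^ degree q * (C * (1 + real (Suc n)) powr \<beta>)"
      by (intro mult_left_mono C) auto
    also have "(1 + real (Suc n)) powr \<beta> = (?s n) powr (- \<beta>) * (1 + ?s n) powr \<beta>"
    proof -
      have "1 + real (Suc n) = (1 + ?s n) / ?s n" by (simp add: field_simps del: of_nat_Suc)
      then have "(1 + real (Suc n)) powr \<beta> = (1 + ?s n) powr \<beta> / ?s n powr \<beta>"
        by (simp only:) (subst powr_divide, auto)
      then show ?thesis by (simp add: powr_minus divide_inverse mult.commute del: of_nat_Suc)
    qed
    also have "?s n ^ degree q * (C * ((?s n) powr (- \<beta>) * (1 + ?s n) powr \<beta>)) = C * ((?s n powr real (degree q) * ?s n powr (- \<beta>)) * (1 + ?s n) powr \<beta>)"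
      using s by (simp add: powr_realpow del: of_nat_Suc)
    also have "?s n powr real (degree q) * ?s n powr (- \<beta>) = ?s n powr (real (degree q) - \<beta>)"
      by (simp flip: powr_add)
    finally show ?thesis .
  qed
  have "(\<lambda>n. C * (?s n powr (real (degree q) - \<beta>) * (1 + ?s n) powr \<beta>)) \<longlonglongrightarrow> C * (0 * (1 + 0) powr \<beta>)"
    by (intro tendsto_mult tendsto_const tendsto_zero_powrI[OF s0 tendsto_const] tendsto_powr tendsto_add s0) (use D in auto)
  then have lim: "(\<lambda>n. C * (?s n powr (real (degree q) - \<beta>) * (1 + ?s n) powr \<beta>)) \<longlonglongrightarrow> 0" by simp
  have "(\<lambda>n. norm (poly (reflect_poly q) (of_real (?s n)))) \<longlonglongrightarrow> 0"
    by (rule tendsto_sandwich[OF _ _ tendsto_const lim]) (intro always_eventually allI norm_ge_zero, intro always_eventually allI le)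
  moreover have "(\<lambda>n. norm (poly (reflect_poly q) (of_real (?s n)))) \<longlonglongrightarrow> norm (poly (reflect_poly q) (of_real 0))"
    by (intro tendsto_norm isCont_tendsto_compose[OF poly_isCont] tendsto_of_real s0)
  ultimately have "norm (poly (reflect_poly q) (of_real 0)) = 0" by (rule LIMSEQ_unique[rotated])
  then have "lead_coeff q = 0" by (simp add: poly_0_coeff_0)
  then show False using \<open>coeff q j \<noteq> 0\<close> by auto
qed

text \<open>On the ray through x, \<open>p\<close> is a one-variable polynomial in t whose
  coefficients are the homogeneous parts of \<open>p\<close> at x. Growth kills the parts above the
  floor of \<beta> for every x, so \<open>p\<close> equals its truncation as a function.\<close>

lemma poly_fun_growth_imp_poly_deg_le:
  fixes p :: "real^'n \<Rightarrow> complex"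
  assumes b: "\<beta> \<ge> 0" and p: "poly_fun p" and C: "\<And>x. norm (p x) \<le> C * wt \<beta> x"
  shows "poly_deg_le (nat \<lfloor>\<beta>\<rfloor>) p"
proof -
  let ?m = "\<lambda>\<alpha> x. \<Prod>i\<in>UNIV. of_real ((x::real^'n) $ i) ^ \<alpha> i"
  let ?S = "\<lambda>d. {\<alpha> :: 'n \<Rightarrow> nat. sum \<alpha> UNIV \<le> d}"
  let ?e = "nat \<lfloor>\<beta>\<rfloor>"
  obtain d' where "poly_deg_le d' p" using p by (auto simp: poly_fun_def)
  \<comment> \<open>Enlarging the degree ensures that the truncated index set is contained in the
    full one.\<close>
  then have "poly_deg_le (max d' ?e) p" by (rule poly_deg_le_mono) simp
  then obtain c where c: "\<And>x. p x = (\<Sum>\<alpha>\<in>?S (max d' ?e). c \<alpha> * ?m \<alpha> x)"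
    unfolding poly_deg_le_def by auto
  define d where "d = max d' ?e"
  define Q where "Q e x = (\<Sum>\<alpha>\<in>?S e. monom (c \<alpha> * ?m \<alpha> x) (sum \<alpha> UNIV))" for e x
  have C0: "C \<ge> 0" using order_trans[OF norm_ge_zero C[of 0]] by simp
  have Qp: "poly (Q d x) (of_real t) = p (t *\<^sub>R x)" for t x
    by (simp add: Q_def c d_def poly_sum poly_monom power_mult_distrib prod.distrib power_sum mult_ac)
  have high: "coeff (Q d x) j = 0" if j: "j > ?e" for j x
  proof (rule poly_growth_imp_coeff_eq_0[OF b _ j])
    fix t :: real assume t: "t \<ge> 0"
    have "1 + norm (t *\<^sub>R x) \<le> (1 + norm x) * (1 + t)" using t by (simp add: algebra_simps)
    then have "wt \<beta> (t *\<^sub>R x) \<le> ((1 + norm x) * (1 + t)) powr \<beta>" unfolding wt_def using b t by (intro powr_mono2) auto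
    then have "wt \<beta> (t *\<^sub>R x) \<le> wt \<beta> x * (1 + t) powr \<beta>" using t by (simp add: wt_def powr_mult)
    then have "norm (p (t *\<^sub>R x)) \<le> C * (wt \<beta> x * (1 + t) powr \<beta>)"
      using C C0 by (meson mult_left_mono order_trans)
    then show "norm (poly (Q d x) (of_real t)) \<le> (C * wt \<beta> x) * (1 + t) powr \<beta>"
      by (simp add: Qp mult.assoc)
  qed
  have "Q d x = Q ?e x" for x
  proof (rule poly_eqI)
    fix j
    have cf: "coeff (Q e x) j = (\<Sum>\<alpha>\<in>?S e. if sum \<alpha> UNIV = j then c \<alpha> * ?m \<alpha> x else 0)" for e
      by (simp add: Q_def coeff_sum coeff_monom)
    show "coeff (Q d x) j = coeff (Q ?e x) j"
    proof (cases "j > ?e")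
      case True
      then have "coeff (Q ?e x) j = 0" unfolding cf by (intro sum.neutral) auto
      then show ?thesis using high[OF True] by simp
    next
      case False
      show ?thesis unfolding cf
        by (rule sum.mono_neutral_right[OF finite_multi_index]) (use False in \<open>auto simp: d_def\<close>)
    qed
  qed
  then have "p x = poly (Q ?e x) 1" for x using Qp[of x 1] by simp
  then have "p = (\<lambda>x. \<Sum>\<alpha>\<in>?S ?e. c \<alpha> * ?m \<alpha> x)"
    by (simp add: fun_eq_iff Q_def poly_sum poly_monom)
  then show ?thesis unfolding poly_deg_le_def by blast
qed

subsection \<open>The theorem\<close>

lemma fourier_eq_hat: "fourier \<phi> \<xi> = complex_of_real ((2 * pi) powr (- real CARD('n))) * hat \<phi> \<xi>" for \<xi> :: "real^'n"
  by (simp add: fourier_def hat_def)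

lemma mult_image_iff_hat: "mult_image m \<phi> g \<longleftrightarrow> (\<forall>\<xi>. hat g \<xi> = m (- \<xi>) * hat \<phi> \<xi>)"
  by (auto simp: mult_image_def fourier_eq_hat)

lemma jbr_le: "jbr x \<le> 1 + norm x" and le_jbr: "1 + norm x \<le> 2 * jbr x" and jbr_ge_1: "1 \<le> jbr x"
proof -
  show "jbr x \<le> 1 + norm x" unfolding jbr_def by (rule real_le_lsqrt) (auto simp: power2_eq_square algebra_simps)
  have "norm x \<le> jbr x" unfolding jbr_def by (rule real_le_rsqrt) simp
  moreover show "1 \<le> jbr x" by (simp add: jbr_def)
  ultimately show "1 + norm x \<le> 2 * jbr x" by simp
qed

lemma jbr_nz [simp]: "jbr x \<noteq> 0"
  using jbr_ge_1[of x] by auto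

lemma L1w_imp_wint:
  fixes g :: "real^'n \<Rightarrow> complex"
  assumes b: "\<beta> \<ge> 0" and g: "g \<in> L1w \<beta>" shows "wint \<beta> g"
proof -
  have gi: "integrable lborel g" and gw: "integrable lborel (\<lambda>x. norm (g x) * jbr x powr \<beta>)"
    using g by (auto simp: L1w_def)
  have [measurable]: "g \<in> borel_measurable borel" using gi by auto
  have "integrable lborel (\<lambda>x. wt \<beta> x * norm (g x))"
  proof (rule integrable_boundI[OF integrable_mult_right[OF gw, of "2 powr \<beta>"]])
    fix x :: "real^'n"
    have "wt \<beta> x \<le> (2 * jbr x) powr \<beta>"
      unfolding wt_def by (intro powr_mono2 le_jbr b) auto
    also have "\<dots> = 2 powr \<beta> * jbr x powr \<beta>"
      using jbr_ge_1[of x] by (simp add: powr_mult)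
    finally show "norm (wt \<beta> x * norm (g x)) \<le> 2 powr \<beta> * (norm (g x) * jbr x powr \<beta>)"
      using mult_right_mono[OF _ norm_ge_zero[of "g x"]] by (fastforce simp: mult_ac)
  qed measurable
  then show ?thesis by (simp add: wint_def)
qed

lemma L1w_subset_L1w_0: "L1w \<beta> \<subseteq> L1w 0"
  by (auto simp: L1w_def integrable_norm)

lemma mult_op_props:
  assumes "\<beta> \<ge> 0" "maps_into_L1w m \<beta>" "test_fun \<phi>"
  shows "integrable lborel (mult_op m \<phi>)" "mult_image m \<phi> (mult_op m \<phi>)"
proof -
  obtain g where "g \<in> L1w \<beta>" "mult_image m \<phi> g" using assms(2,3) by (auto simp: maps_into_L1w_def)
  then have "g \<in> L1w 0 \<and> mult_image m \<phi> g" using L1w_subset_L1w_0 by blast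
  then have "mult_op m \<phi> \<in> L1w 0 \<and> mult_image m \<phi> (mult_op m \<phi>)"
    unfolding mult_op_def by (rule someI[of "\<lambda>g. g \<in> L1w 0 \<and> mult_image m \<phi> g"])
  then show "integrable lborel (mult_op m \<phi>)" "mult_image m \<phi> (mult_op m \<phi>)" by (auto simp: L1w_def)
qed

text \<open>The choice in \<open>mult_op\<close> only asks for an L1 function. By injectivity it
  agrees almost everywhere with any other candidate, in particular with one in
  \<open>L1w \<beta>\<close>, whose weighted integrability is what convolutions need.\<close>

lemma mult_op_AE_eq:
  assumes "\<beta> \<ge> 0" "maps_into_L1w m \<beta>" "test_fun \<phi>" "integrable lborel g" "mult_image m \<phi> g"
  shows "AE x in lborel. mult_op m \<phi> x = g x"
  using mult_op_props[OF assms(1-3)] assms(4,5)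
  by (intro hat_inject_AE) (auto simp: mult_image_iff_hat)

lemma Linfw_AE_pbd:
  fixes f :: "real^'n \<Rightarrow> complex"
  assumes b: "\<beta> \<ge> 0" and f: "f \<in> Linfw \<beta>"
  obtains f' where "pbd \<beta> f'" "AE x in lborel. f x = f' x"
proof -
  have [measurable]: "f \<in> borel_measurable borel" using f by (simp add: Linfw_def)
  obtain C where C: "AE x in lborel. norm (f x) \<le> C * jbr x powr \<beta>" using f by (auto simp: Linfw_def)
  define f' where "f' x = (if norm (f x) \<le> \<bar>C\<bar> * wt \<beta> x then f x else 0)" for x
  have [measurable]: "f' \<in> borel_measurable borel" unfolding f'_def by measurable
  have "norm (f' x) \<le> \<bar>C\<bar> * wt \<beta> x" for x by (simp add: f'_def)
  then have "pbd \<beta> f'" by (auto simp: pbd_def)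
  moreover have "AE x in lborel. f x = f' x"
    using C
  proof eventually_elim
    case (elim x)
    have "jbr x powr \<beta> \<le> wt \<beta> x"
      unfolding wt_def using jbr_ge_1[of x] by (intro powr_mono2 jbr_le b) auto
    then have "C * jbr x powr \<beta> \<le> \<bar>C\<bar> * wt \<beta> x" by (intro mult_mono) auto
    then show ?case using elim by (simp add: f'_def)
  qed
  ultimately show thesis using that by blast
qed

text \<open>Multipliers commute with translations. The value of the convolution at x is therefore
  the pairing of \<open>f\<close> with the multiplier image of the translate of \<phi> by x, which
  vanishes by assumption.\<close>

lemma conv_reflected_multiplier_eq_0:
  fixes f :: "real^'n \<Rightarrow> complex"
  assumes b: "\<beta> \<ge> 0" and m: "maps_into_L1w m \<beta>" and f: "f \<in> borel_measurable borel" and F: "pbd \<beta> F" "AE x in lborel. f x = F x"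
    and ann: "\<And>\<phi>. test_fun \<phi> \<Longrightarrow> (\<integral>x. f x * mult_op m \<phi> x \<partial>lborel) = 0"
    and \<phi>: "test_fun \<phi>"
  obtains k where "wint \<beta> k" "conv F k = (\<lambda>_. 0)" "\<And>\<xi>. hat k \<xi> = m \<xi> * hat \<phi> (- \<xi>)"
proof -
  note [measurable] = f pbd_measurable[OF F(1)]
  obtain g where g: "g \<in> L1w \<beta>" "mult_image m \<phi> g" using m \<phi> by (auto simp: maps_into_L1w_def)
  have gw: "wint \<beta> g" by (rule L1w_imp_wint[OF b g(1)])
  note [measurable] = wint_measurable[OF gw]
  note gi = wint_integrable[OF gw b]
  define k where "k y = g (- y)" for y
  have [measurable]: "k \<in> borel_measurable borel" unfolding k_def by measurable
  have k: "wint \<beta> k"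
    using wint_integrable_wt[OF gw] integrable_lborel_reflect_iff[of "\<lambda>x. wt \<beta> x * norm (g x)" 0]
    by (simp add: wint_def k_def)
  have hk: "hat k \<xi> = m \<xi> * hat \<phi> (- \<xi>)" for \<xi>
    using g(2) by (simp add: k_def[abs_def] hat_reflect mult_image_iff_hat)
  have "conv F k x = 0" for x
  proof -
    define gx where "gx z = g (- x + z)" for z
    define \<phi>x where "\<phi>x z = \<phi> (- x + z)" for z
    have t: "test_fun \<phi>x" unfolding \<phi>x_def using test_fun_affine[OF \<phi>, of 1 "- x"] by simp
    have i: "integrable lborel gx" unfolding gx_def using gi integrable_lborel_translate_iff[of g "- x"] by blast
    have "mult_image m \<phi>x gx"
      using g(2) unfolding mult_image_iff_hat gx_def[abs_def] \<phi>x_def[abs_def] hat_translate by simp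
    from mult_op_AE_eq[OF b m t i this] have ae: "AE z in lborel. mult_op m \<phi>x z = gx z" .
    have mi: "mult_op m \<phi>x \<in> borel_measurable borel" using mult_op_props(1)[OF b m t] by auto
    have "conv F k x = conv k F x" by (rule conv_commute)
    also have "\<dots> = (\<integral>z. F z * gx z \<partial>lborel)"
      unfolding conv_def k_def gx_def by (simp add: mult.commute)
    also have "\<dots> = (\<integral>z. f z * mult_op m \<phi>x z \<partial>lborel)"
    proof (rule integral_cong_AE)
      show "AE z in lborel. F z * gx z = f z * mult_op m \<phi>x z"
        using ae F(2) by eventually_elim simp
    qed (use i mi in auto)
    finally show ?thesis using ann[OF t] by simp
  qed
  then show thesis using that k hk by blast
qed

text \<open>The transform of the plateau is nonzero near 0; shrinking the plateau by the factor
  \<open>s\<close> stretches that neighbourhood beyond radius \<open>R\<close>.\<close>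

lemma exists_test_fun_hat_nonzero:
  obtains \<phi> :: "real^'n \<Rightarrow> complex" where "test_fun \<phi>" "\<And>\<xi>. norm \<xi> \<le> R \<Longrightarrow> hat \<phi> \<xi> \<noteq> 0"
proof -
  have "isCont (hat plc) (0::real^'n)"
    using continuous_hat[OF test_fun_integrable[OF test_fun_plateau[where 'n='n]]] by (simp add: continuous_on_eq_continuous_at)
  moreover have "hat plc (0::real^'n) \<noteq> 0" using hat_plc_0[where 'n='n] by auto
  ultimately obtain d where d: "d > 0" "\<And>x::real^'n. norm x < d \<Longrightarrow> hat plc x \<noteq> 0"
    using continuous_at_avoid[of "0::real^'n" "hat plc" 0] by (auto simp: dist_norm)
  define s where "s = d / (\<bar>R\<bar> + 1)"
  have s: "s > 0" using d by (simp add: s_def add_nonneg_pos)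
  let ?\<phi> = "\<lambda>x::real^'n. plc (inverse s *\<^sub>R x)"
  have t: "test_fun ?\<phi>" using test_fun_affine[OF test_fun_plateau[where 'n='n], of "inverse s" 0] s by simp
  have "hat ?\<phi> \<xi> \<noteq> 0" if "norm \<xi> \<le> R" for \<xi>
  proof -
    have "norm (s *\<^sub>R \<xi>) \<le> s * \<bar>R\<bar>" using that s by (simp add: mult_left_mono)
    also have "\<dots> < s * (\<bar>R\<bar> + 1)" using s by simp
    also have "\<dots> = d" by (simp add: s_def add_nonneg_eq_0_iff)
    finally have "hat plc (s *\<^sub>R \<xi>) \<noteq> 0" by (rule d)
    then show ?thesis using s hat_scale[of "inverse s" plc \<xi>] by simp
  qed
  then show thesis using that t by blast
qed

text \<open>On the annulus \<open>hat k\<close> has no zero, and compactness turns this into a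
  common lower bound \<open>c\<close>; the local vanishing result then yields one width for all its
  frequencies.\<close>

lemma spectrum_at_0_if_annihilates:
  fixes f :: "real^'n \<Rightarrow> complex"
  assumes b: "\<beta> \<ge> 0" and m: "maps_into_L1w m \<beta>" and f: "f \<in> borel_measurable borel" and F: "pbd \<beta> F" "AE x in lborel. f x = F x"
    and ann: "\<And>\<phi>. test_fun \<phi> \<Longrightarrow> (\<integral>x. f x * mult_op m \<phi> x \<partial>lborel) = 0"
    and nz: "{\<eta>. m \<eta> = 0} \<subseteq> {0}"
  shows "spectrum_at_0 F"
  unfolding spectrum_at_0_def
proof (intro allI impI)
  fix r R :: real assume r: "r > 0"
  obtain \<phi> :: "real^'n \<Rightarrow> complex" where \<phi>: "test_fun \<phi>" "\<And>\<xi>. norm \<xi> \<le> R \<Longrightarrow> hat \<phi> \<xi> \<noteq> 0"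
    using exists_test_fun_hat_nonzero[of R] by metis
  obtain k where k: "wint \<beta> k" "conv F k = (\<lambda>_. 0)" "\<And>\<xi>. hat k \<xi> = m \<xi> * hat \<phi> (- \<xi>)"
    using conv_reflected_multiplier_eq_0[OF b m f F ann \<phi>(1)] by metis
  define K where "K = {\<eta>::real^'n. r \<le> norm \<eta> \<and> norm \<eta> \<le> R}"
  have "K = cball 0 R - ball 0 r" by (auto simp: K_def)
  then have cK: "compact K" by (simp add: compact_diff)
  have hk: "hat k \<eta> \<noteq> 0" if "\<eta> \<in> K" for \<eta>
  proof -
    have "\<eta> \<noteq> 0" "norm (- \<eta>) \<le> R" using that r by (auto simp: K_def)
    then show ?thesis using k(3) \<phi>(2)[of "- \<eta>"] nz by auto
  qed
  have "\<exists>c>0. \<forall>\<eta>\<in>K. c \<le> norm (hat k \<eta>)"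
  proof (cases "K = {}")
    case False
    have "continuous_on K (\<lambda>\<eta>. norm (hat k \<eta>))"
      using continuous_hat[OF wint_integrable[OF k(1) b]] by (intro continuous_intros) (rule continuous_on_subset, auto)
    from continuous_attains_inf[OF cK False this] obtain \<eta>0 where "\<eta>0 \<in> K" "\<forall>\<eta>\<in>K. norm (hat k \<eta>0) \<le> norm (hat k \<eta>)" by blast
    then show ?thesis using hk by (intro exI[of _ "norm (hat k \<eta>0)"]) auto
  qed (auto intro: exI[of _ 1])
  then obtain c where c: "c > 0" "\<And>\<eta>. \<eta> \<in> K \<Longrightarrow> c \<le> norm (hat k \<eta>)" by blast
  obtain ep0 where "ep0 > 0"
    "\<And>ep \<eta>. 0 < ep \<Longrightarrow> ep \<le> ep0 \<Longrightarrow> c \<le> norm (hat k \<eta>) \<Longrightarrow> conv F (kerns ep \<eta>) = (\<lambda>_. 0)"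
    by (rule conv_kerns_eq_0_locally[OF b F(1) k(1,2) c(1)]) blast
  then show "\<exists>\<delta>>0. \<forall>ep \<eta>. 0 < ep \<longrightarrow> ep \<le> \<delta> \<longrightarrow> r \<le> norm \<eta> \<longrightarrow> norm \<eta> \<le> R \<longrightarrow> conv F (kerns ep \<eta>) = (\<lambda>_. 0)"
    using c(2) by (intro exI[of _ ep0]) (auto simp: K_def)
qed

lemma spectrum_at_0_imp_poly:
  fixes F :: "real^'n \<Rightarrow> complex"
  assumes b: "\<beta> \<ge> 0" and F: "pbd \<beta> F" and sp: "spectrum_at_0 F"
  shows "\<exists>p. poly_deg_le (nat \<lfloor>\<beta>\<rfloor>) p \<and> (AE x in lborel. F x = p x)"
proof (intro exI conjI)
  let ?p = "conv F (kerns 1 0)"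
  show "AE x in lborel. F x = ?p x" by (rule spectrum_at_0_AE_eq[OF b F sp])
  have p: "pbd \<beta> ?p" by (intro pbd_conv b F wint_kerns) simp
  obtain C where C: "\<And>x. norm (?p x) \<le> C * wt \<beta> x" using pbdE[OF p] by blast
  have fd: "fdiff h (nat \<lfloor>\<beta>\<rfloor> + 1) ?p x = 0" for h x
    by (rule fdiff_eq_0[OF b p conv_kerns_reproducing[OF b F sp]]) linarith+
  have "poly_fun ?p"
    by (rule poly_fun_if_fdiff_eq_0[OF continuous_conv_rapid[OF b F rapid_kerns[OF zero_less_one]] fd])
  then show "poly_deg_le (nat \<lfloor>\<beta>\<rfloor>) ?p"
    by (rule poly_fun_growth_imp_poly_deg_le[OF b _ C])
qed

lemma poly_fun_continuous: "poly_fun p \<Longrightarrow> continuous_on UNIV p"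
  unfolding poly_fun_def poly_deg_le_def by (auto intro!: continuous_intros)

text \<open>A bounded polynomial has degree at most 0 by the growth estimate with \<beta> = 0, hence
  is constant; the character takes the value 1 at the origin and -1 at \<pi>\<eta>/(\<eta> \<bullet>
  \<eta>).\<close>

lemma character_not_AE_poly:
  fixes \<eta> :: "real^'n"
  assumes p: "poly_fun p" and ae: "AE x in lborel. exp (\<i> * of_real (x \<bullet> \<eta>)) = p x"
  shows "\<eta> = 0"
proof (rule ccontr)
  assume \<eta>: "\<eta> \<noteq> 0"
  have "(\<lambda>x. exp (\<i> * of_real (x \<bullet> \<eta>))) = p"
    by (rule continuous_AE_imp_eq[OF _ poly_fun_continuous[OF p] ae]) (intro continuous_intros)
  then have eq: "p x = exp (\<i> * of_real (x \<bullet> \<eta>))" for x by (rule fun_cong[OF sym])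
  have "poly_deg_le (nat \<lfloor>0::real\<rfloor>) p"
    by (rule poly_fun_growth_imp_poly_deg_le[OF order_refl p, of 1]) (simp add: eq)
  then have d: "poly_deg_le 0 p" by simp
  have S: "{\<alpha> :: 'n \<Rightarrow> nat. sum \<alpha> UNIV \<le> 0} = {\<lambda>_. 0}" by (auto simp: fun_eq_iff)
  have const: "p x = p y" for x y using d unfolding poly_deg_le_def S by auto
  have "p ((pi / (\<eta> \<bullet> \<eta>)) *\<^sub>R \<eta>) = - 1" using \<eta> by (simp add: eq exp_pi_i' mult.commute)
  moreover have "p 0 = 1" by (simp add: eq)
  ultimately show False using const[of "(pi / (\<eta> \<bullet> \<eta>)) *\<^sub>R \<eta>" 0] by simp
qed

theorem theorem2p2:
  fixes m :: "real ^ 'n \<Rightarrow> complex" and \<beta> :: real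
  assumes "\<beta> \<ge> 0"
    and "continuous_on UNIV m"
    and "maps_into_L1w m \<beta>"
  shows "(\<forall>f. f \<in> Linfw \<beta> \<and>
              (\<forall>\<phi>. test_fun \<phi> \<longrightarrow> (\<integral>x. f x * mult_op m \<phi> x \<partial>lborel) = 0) \<and>
              {\<eta>. m \<eta> = 0} \<subseteq> {0}
            \<longrightarrow> (\<exists>p. poly_deg_le (nat \<lfloor>\<beta>\<rfloor>) p \<and> (AE x in lborel. f x = p x)))
       \<and> ((\<forall>f. f \<in> Linfw 0 \<and>
              (\<forall>\<phi>. test_fun \<phi> \<longrightarrow> (\<integral>x. f x * mult_op m \<phi> x \<partial>lborel) = 0)
            \<longrightarrow> (\<exists>p. poly_fun p \<and> (AE x in lborel. f x = p x)))
           \<longrightarrow> {\<eta>. m \<eta> = 0} \<subseteq> {0})"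
proof (intro conjI allI impI)
  fix f assume f: "f \<in> Linfw \<beta> \<and> (\<forall>\<phi>. test_fun \<phi> \<longrightarrow> (\<integral>x. f x * mult_op m \<phi> x \<partial>lborel) = 0) \<and> {\<eta>. m \<eta> = 0} \<subseteq> {0}"
  have fm: "f \<in> borel_measurable borel" using f by (simp add: Linfw_def)
  obtain F where F: "pbd \<beta> F" "AE x in lborel. f x = F x" using Linfw_AE_pbd[OF assms(1)] f by blast
  have "spectrum_at_0 F"
    by (rule spectrum_at_0_if_annihilates[OF assms(1,3) fm F]) (use f in auto)
  from spectrum_at_0_imp_poly[OF assms(1) F(1) this]
  obtain p where p: "poly_deg_le (nat \<lfloor>\<beta>\<rfloor>) p" "AE x in lborel. F x = p x" by blast
  have "AE x in lborel. f x = p x" using F(2) p(2) by eventually_elim simp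
  then show "\<exists>p. poly_deg_le (nat \<lfloor>\<beta>\<rfloor>) p \<and> (AE x in lborel. f x = p x)" using p(1) by blast
next
  assume H: "\<forall>f. f \<in> Linfw 0 \<and> (\<forall>\<phi>. test_fun \<phi> \<longrightarrow> (\<integral>x. f x * mult_op m \<phi> x \<partial>lborel) = 0)
            \<longrightarrow> (\<exists>p. poly_fun p \<and> (AE x in lborel. f x = p x))"
  show "{\<eta>. m \<eta> = 0} \<subseteq> {0}"
  proof
    fix \<eta> assume "\<eta> \<in> {\<eta>. m \<eta> = 0}"
    then have \<eta>: "m \<eta> = 0" by simp
    let ?f = "\<lambda>x. exp (\<i> * of_real (x \<bullet> \<eta>))"
    have "?f \<in> Linfw 0"
      by (auto simp: Linfw_def intro!: exI[of _ 1])
    moreover have "(\<integral>x. ?f x * mult_op m \<phi> x \<partial>lborel) = 0" if "test_fun \<phi>" for \<phi>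
    proof -
      \<comment> \<open>The pairing samples the transform at \<open>- \<eta>\<close>, and the
        reflection built into the multiplier turns this into the value of \<open>m\<close> at \<eta>
        itself.\<close>
      have "(\<integral>x. ?f x * mult_op m \<phi> x \<partial>lborel) = hat (mult_op m \<phi>) (- \<eta>)" by (simp add: hat_def)
      also have "\<dots> = 0" using mult_op_props(2)[OF assms(1,3) that] \<eta> by (simp add: mult_image_iff_hat)
      finally show ?thesis .
    qed
    ultimately obtain p where "poly_fun p" "AE x in lborel. ?f x = p x" using H[rule_format, of ?f] by auto
    then show "\<eta> \<in> {0}" using character_not_AE_poly by auto
  qed
qed

end
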